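(* Let $F:\mathscr{D}(F)\subset L^2(\Omega)\to H$, $y\in H$, $\bar u\in\mathcal{S}(y)\cap\operatorname{dom}h$ and $\eta,\rho>0$ satisfy the assumption (B) of the context, with $h(u)=\frac12\|u\|_{L^2(\Omega)}^2+|u|_{BV(\Omega)}$, so that $h(\bar u)<\infty$. Let $0<\gamma<\min\{\frac1\eta,\frac\rho2\}$ and let $0<\underline\alpha\le\alpha_k\le\overline\alpha$ for all $k\in\mathbb{N}_0$. Assume that the starting values $u_0\in\mathscr{D}(F)\cap\operatorname{dom}h$ and $\xi_0\in\partial h(u_0)$, $u_0,\xi_0\in L^2(\Omega)$, satisfy $D_h^{\xi_0}(\bar u,u_0)<\frac{\gamma^2}{8}$. Let $\delta_m>0$ be a sequence with $\delta_m\to0$, let $y^{\delta_m}\in H$ satisfy $\|y-y^{\delta_m}\|<\delta_m$, and for each $m$ let $(u_k)=(u_k^{(m)})_k$ be the iterates generated from $u_0,\xi_0$ with the data $y^\delta=y^{\delta_m}$ by $$u_{k+1}\in\operatorname{argmin}_{u\in\mathscr{D}(F)}\left\{\tfrac12\|F(u)-y^{\delta}\|^2+\alpha_kD_h^{\xi_k}(u,u_k)\right\},\qquad \xi_{k+1}=\xi_k-\tfrac1{\alpha_k}F'(u_{k+1})^*\left(F(u_{k+1})-y^{\delta}\right).$$ Let the stopping index $k_m^*$ be the smallest integer $k^*$ with $\|F(u_{k^*}^{(m)})-y^{\delta_m}\|\le\tau\delta_m$, where $\tau>\frac{1+\eta\gamma}{1-\eta\gamma}$. Then for every $\delta_m$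 the stopping index $k_m^*$ is finite, and the sequence $(u_{k_m^*})_m=(u^{(m)}_{k_m^*})_m$ has a subsequence converging to some $u\in\mathcal{S}(y)$ in the weak-$*$ topology of $BV(\Omega)$. Moreover, if $\mathcal{S}(y)\cap\overline{B_\rho(\bar u)}=\{\bar u\}$, then $u_{k_m^*}\overset{*}{\rightharpoonup}\bar u$ in $BV(\Omega)$.
   Context: $\Omega\subset\mathbb{R}^n$ is a bounded Lipschitz domain, $H$ is a Hilbert space, $F:\mathscr{D}(F)\subset L^2(\Omega)\to H$ is a nonlinear Fréchet differentiable operator with closed and convex domain $\mathscr{D}(F)$, and $\mathcal{S}(y)=\{u\in\mathscr{D}(F): F(u)=y\}$. $|u|_{BV(\Omega)}$ is the total variation seminorm of $u$ ($+\infty$ if $u\notin BV(\Omega)$), and $\operatorname{dom}h=\{u:h(u)<\infty\}$. Subgradients of $h$ are elements of $L^2(\Omega)$ (identified with its dual), and for $\xi\in\partial h(u)$ the Bregman distance is $D_h^\xi(v,u)=h(v)-h(u)-\langle\xi,v-u\rangle$; in the iteration $\xi_k\in\partial h(u_k)$. $F'(u)^*$ denotes the adjoint of $F'(u)$. Assumption (B): $F$ is weakly sequentially closed, $F'(\cdot)$ is locally bounded, and for some $\bar u\in\mathcal{S}(y)\cap\operatorname{dom}h$ and $\eta,\rho>0$, $$\|F(v)-F(u)-F'(u)(v-u)\|\le\eta\,\|u-v\|_{L^2(\Omega)}\,\|F(u)-F(v)\|\qquad\text{for all }u,v\in B_\rho(\bar u)\cap\mathscr{D}(F),$$ where $B_\rho(\bar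 u)$ is the open ball of radius $\rho$ around $\bar u$ in $L^2(\Omega)$. *)

theory Defs
  imports "HOL-Analysis.Analysis"
begin

definition lipschitz_domain :: "(real^'n) set \<Rightarrow> bool" where
  \<comment> \<open>Near every boundary point, \<open>\<Omega>\<close> lies on one side of the graph of a Lipschitz function.
     The graph is taken over the hyperplane orthogonal to a unit vector \<open>e\<close>, which replaces
     a rotated coordinate system with \<open>e\<close> as its last axis.\<close>
  "lipschitz_domain \<Omega> \<longleftrightarrow> open \<Omega> \<and> connected \<Omega> \<and> \<Omega> \<noteq> {} \<and>
     (\<forall>x\<in>frontier \<Omega>. \<exists>r>0. \<exists>e. norm e = 1 \<and>
        (\<exists>L g. L-lipschitz_on {z. z \<bullet> e = 0} g \<and>
           \<Omega> \<inter> ball x r = {z \<in> ball x r. g (z - (z \<bullet> e) *\<^sub>R e) < z \<bullet> e}))"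

text \<open>
  The library has no type of \<open>L\<^sup>2\<close> classes over a variable domain. Elements of \<open>L\<^sup>2(\<Omega>)\<close> are
  therefore represented by functions, of which only the almost-everywhere class on \<open>\<Omega>\<close> matters;
  equality in \<open>L\<^sup>2(\<Omega>)\<close> is \<open>ae_eq \<Omega>\<close>, and operators on \<open>L\<^sup>2(\<Omega>)\<close> have to respect it.
\<close>

definition L2 :: "(real^'n) set \<Rightarrow> (real^'n \<Rightarrow> real) set" where
  "L2 \<Omega> = {u. u \<in> borel_measurable (lebesgue_on \<Omega>) \<and>
              integrable (lebesgue_on \<Omega>) (\<lambda>x. (u x)\<^sup>2)}"

definition ae_eq :: "(real^'n) set \<Rightarrow> (real^'n \<Rightarrow> real) \<Rightarrow> (real^'n \<Rightarrow> real) \<Rightarrow> bool" where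
  "ae_eq \<Omega> u v \<longleftrightarrow> (AE x in lebesgue_on \<Omega>. u x = v x)"

definition inner_L2 :: "(real^'n) set \<Rightarrow> (real^'n \<Rightarrow> real) \<Rightarrow> (real^'n \<Rightarrow> real) \<Rightarrow> real" where
  "inner_L2 \<Omega> u v = (\<integral>x. u x * v x \<partial>lebesgue_on \<Omega>)"

definition norm_L2 :: "(real^'n) set \<Rightarrow> (real^'n \<Rightarrow> real) \<Rightarrow> real" where
  "norm_L2 \<Omega> u = sqrt (inner_L2 \<Omega> u u)"

definition dist_L2 :: "(real^'n) set \<Rightarrow> (real^'n \<Rightarrow> real) \<Rightarrow> (real^'n \<Rightarrow> real) \<Rightarrow> real" where
  "dist_L2 \<Omega> u v = norm_L2 \<Omega> (\<lambda>x. u x - v x)"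

definition weak_L2 ::
  "(real^'n) set \<Rightarrow> (nat \<Rightarrow> real^'n \<Rightarrow> real) \<Rightarrow> (real^'n \<Rightarrow> real) \<Rightarrow> bool" where
  "weak_L2 \<Omega> v u \<longleftrightarrow> (\<forall>g\<in>L2 \<Omega>. (\<lambda>j. inner_L2 \<Omega> (v j) g) \<longlonglongrightarrow> inner_L2 \<Omega> u g)"

definition weak_lim :: "(nat \<Rightarrow> 'h::real_inner) \<Rightarrow> 'h \<Rightarrow> bool" where
  "weak_lim f z \<longleftrightarrow> (\<forall>w. (\<lambda>j. f j \<bullet> w) \<longlonglongrightarrow> z \<bullet> w)"

definition closed_L2 :: "(real^'n) set \<Rightarrow> (real^'n \<Rightarrow> real) set \<Rightarrow> bool" where
  "closed_L2 \<Omega> D \<longleftrightarrow>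
     (\<forall>v. \<forall>u\<in>L2 \<Omega>. (\<forall>j. v j \<in> D) \<and> (\<lambda>j. dist_L2 \<Omega> (v j) u) \<longlonglongrightarrow> 0 \<longrightarrow> u \<in> D)"

definition convex_L2 :: "(real^'n \<Rightarrow> real) set \<Rightarrow> bool" where
  "convex_L2 D \<longleftrightarrow>
     (\<forall>u\<in>D. \<forall>v\<in>D. \<forall>t\<in>{0..1}. (\<lambda>x. (1 - t) * u x + t * v x) \<in> D)"

definition operator_L2 ::
  "(real^'n) set \<Rightarrow> (real^'n \<Rightarrow> real) set \<Rightarrow> ((real^'n \<Rightarrow> real) \<Rightarrow> 'h) \<Rightarrow> bool" where
  "operator_L2 \<Omega> D F \<longleftrightarrow> D \<subseteq> L2 \<Omega> \<and>
     (\<forall>u\<in>D. \<forall>v\<in>L2 \<Omega>. ae_eq \<Omega> u v \<longrightarrow> v \<in> D \<and> F v = F u)"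

definition bounded_linear_L2 ::
  "(real^'n) set \<Rightarrow> ((real^'n \<Rightarrow> real) \<Rightarrow> 'h::real_normed_vector) \<Rightarrow> bool" where
  "bounded_linear_L2 \<Omega> A \<longleftrightarrow>
     (\<forall>u\<in>L2 \<Omega>. \<forall>v\<in>L2 \<Omega>. A (\<lambda>x. u x + v x) = A u + A v) \<and>
     (\<forall>c. \<forall>u\<in>L2 \<Omega>. A (\<lambda>x. c * u x) = c *\<^sub>R A u) \<and>
     (\<exists>C. \<forall>u\<in>L2 \<Omega>. norm (A u) \<le> C * norm_L2 \<Omega> u)"

definition has_frechet_L2 ::
  "(real^'n) set \<Rightarrow> (real^'n \<Rightarrow> real) set \<Rightarrow> ((real^'n \<Rightarrow> real) \<Rightarrow> 'h::real_normed_vector)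
    \<Rightarrow> ((real^'n \<Rightarrow> real) \<Rightarrow> 'h) \<Rightarrow> (real^'n \<Rightarrow> real) \<Rightarrow> bool" where
  \<comment> \<open>\<open>A\<close> is a Frechet derivative at \<open>u\<close>, within \<open>D\<close>, of the operator \<open>F\<close> defined on \<open>D\<close>;
     as \<open>D\<close> may have empty interior in \<open>L\<^sup>2(\<Omega>)\<close>, \<open>A\<close> need not be unique.\<close>
  "has_frechet_L2 \<Omega> D F A u \<longleftrightarrow> bounded_linear_L2 \<Omega> A \<and>
     (\<forall>\<epsilon>>0. \<exists>d>0. \<forall>v\<in>D. dist_L2 \<Omega> v u < d \<longrightarrow>
        norm (F v - F u - A (\<lambda>x. v x - u x)) \<le> \<epsilon> * dist_L2 \<Omega> v u)"

definition adjoint_L2 ::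
  "(real^'n) set \<Rightarrow> ((real^'n \<Rightarrow> real) \<Rightarrow> 'h::real_inner) \<Rightarrow> ('h \<Rightarrow> real^'n \<Rightarrow> real) \<Rightarrow> bool" where
  "adjoint_L2 \<Omega> A B \<longleftrightarrow>
     (\<forall>w. B w \<in> L2 \<Omega> \<and> (\<forall>v\<in>L2 \<Omega>. A v \<bullet> w = inner_L2 \<Omega> v (B w)))"

definition Cc1 :: "(real^'n) set \<Rightarrow> (real^'n \<Rightarrow> real^'n) set" where
  "Cc1 \<Omega> = {\<phi>. (\<forall>x. \<phi> differentiable (at x)) \<and>
               (\<forall>v. continuous_on UNIV (\<lambda>x. frechet_derivative \<phi> (at x) v)) \<and>
               (\<exists>K. compact K \<and> K \<subseteq> \<Omega> \<and> (\<forall>x. x \<notin> K \<longrightarrow> \<phi> x = 0))}"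

definition divergence :: "(real^'n \<Rightarrow> real^'n) \<Rightarrow> real^'n \<Rightarrow> real" where
  "divergence \<phi> x = (\<Sum>i\<in>UNIV. frechet_derivative \<phi> (at x) (axis i 1) $ i)"

definition tv :: "(real^'n) set \<Rightarrow> (real^'n \<Rightarrow> real) \<Rightarrow> ereal" where
  "tv \<Omega> u = (SUP \<phi> \<in> {\<phi> \<in> Cc1 \<Omega>. \<forall>x. norm (\<phi> x) \<le> 1}.
               ereal (\<integral>x. u x * divergence \<phi> x \<partial>lebesgue_on \<Omega>))"

definition BV :: "(real^'n) set \<Rightarrow> (real^'n \<Rightarrow> real) set" where
  "BV \<Omega> = {u. integrable (lebesgue_on \<Omega>) u \<and> tv \<Omega> u < \<infinity>}"

definition C0 :: "(real^'n) set \<Rightarrow> (real^'n \<Rightarrow> real^'n) set" where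
  "C0 \<Omega> = {\<phi>. continuous_on \<Omega> \<phi> \<and>
              (\<forall>\<epsilon>>0. \<exists>K. compact K \<and> K \<subseteq> \<Omega> \<and> (\<forall>x\<in>\<Omega> - K. norm (\<phi> x) < \<epsilon>))}"

definition dual_C0 :: "(real^'n) set \<Rightarrow> ((real^'n \<Rightarrow> real^'n) \<Rightarrow> real) \<Rightarrow> bool" where
  "dual_C0 \<Omega> T \<longleftrightarrow>
     (\<forall>\<phi>\<in>C0 \<Omega>. \<forall>\<psi>\<in>C0 \<Omega>. T (\<lambda>x. \<phi> x + \<psi> x) = T \<phi> + T \<psi>) \<and>
     (\<forall>c. \<forall>\<phi>\<in>C0 \<Omega>. T (\<lambda>x. c *\<^sub>R \<phi> x) = c * T \<phi>) \<and>
     (\<exists>C. \<forall>\<phi>\<in>C0 \<Omega>. \<bar>T \<phi>\<bar> \<le> C * (SUP x\<in>\<Omega>. norm (\<phi> x)))"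

definition deriv_measure ::
  "(real^'n) set \<Rightarrow> (real^'n \<Rightarrow> real) \<Rightarrow> ((real^'n \<Rightarrow> real^'n) \<Rightarrow> real) \<Rightarrow> bool" where
  \<comment> \<open>\<open>T\<close> is the derivative \<open>Du\<close> of \<open>u\<close>, a finite \<open>\<real>\<^sup>n\<close>-valued Radon measure on \<open>\<Omega>\<close>. By the Riesz
     theorem these measures are the dual of \<open>C\<^sub>0(\<Omega>;\<real>\<^sup>n)\<close>, and \<open>T \<phi>\<close> is the integral of \<open>\<phi>\<close>
     with respect to \<open>Du\<close>.\<close>
  "deriv_measure \<Omega> u T \<longleftrightarrow> dual_C0 \<Omega> T \<and>
     (\<forall>\<phi>\<in>Cc1 \<Omega>. T \<phi> = - (\<integral>x. u x * divergence \<phi> x \<partial>lebesgue_on \<Omega>))"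

definition weakstar_BV ::
  "(real^'n) set \<Rightarrow> (nat \<Rightarrow> real^'n \<Rightarrow> real) \<Rightarrow> (real^'n \<Rightarrow> real) \<Rightarrow> bool" where
  \<comment> \<open>strong \<open>L\<^sup>1(\<Omega>)\<close> convergence together with weak-* convergence of the derivatives as measures\<close>
  "weakstar_BV \<Omega> v u \<longleftrightarrow> (\<forall>j. v j \<in> BV \<Omega>) \<and> u \<in> BV \<Omega> \<and>
     (\<lambda>j. \<integral>x. \<bar>v j x - u x\<bar> \<partial>lebesgue_on \<Omega>) \<longlonglongrightarrow> 0 \<and>
     (\<exists>Dv Du. (\<forall>j. deriv_measure \<Omega> (v j) (Dv j)) \<and> deriv_measure \<Omega> u Du \<and>
        (\<forall>\<phi>\<in>C0 \<Omega>. (\<lambda>j. Dv j \<phi>) \<longlonglongrightarrow> Du \<phi>))"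

definition hTV :: "(real^'n) set \<Rightarrow> (real^'n \<Rightarrow> real) \<Rightarrow> ereal" where
  "hTV \<Omega> u = ereal (1/2 * (norm_L2 \<Omega> u)\<^sup>2) + tv \<Omega> u"

definition dom_L2 :: "(real^'n) set \<Rightarrow> ((real^'n \<Rightarrow> real) \<Rightarrow> ereal) \<Rightarrow> (real^'n \<Rightarrow> real) set" where
  "dom_L2 \<Omega> h = {u \<in> L2 \<Omega>. h u < \<infinity>}"

definition subdiff_L2 ::
  "(real^'n) set \<Rightarrow> ((real^'n \<Rightarrow> real) \<Rightarrow> ereal) \<Rightarrow> (real^'n \<Rightarrow> real) \<Rightarrow> (real^'n \<Rightarrow> real) set" where
  "subdiff_L2 \<Omega> h u = {\<xi> \<in> L2 \<Omega>. u \<in> dom_L2 \<Omega> h \<and>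
     (\<forall>v\<in>L2 \<Omega>. h u + ereal (inner_L2 \<Omega> \<xi> (\<lambda>x. v x - u x)) \<le> h v)}"

definition bregman ::
  "(real^'n) set \<Rightarrow> ((real^'n \<Rightarrow> real) \<Rightarrow> ereal) \<Rightarrow> (real^'n \<Rightarrow> real) \<Rightarrow> (real^'n \<Rightarrow> real)
    \<Rightarrow> (real^'n \<Rightarrow> real) \<Rightarrow> ereal" where
  "bregman \<Omega> h \<xi> v u = h v - h u - ereal (inner_L2 \<Omega> \<xi> (\<lambda>x. v x - u x))"

definition solutions ::
  "(real^'n \<Rightarrow> real) set \<Rightarrow> ((real^'n \<Rightarrow> real) \<Rightarrow> 'h) \<Rightarrow> 'h \<Rightarrow> (real^'n \<Rightarrow> real) set" where
  "solutions D F y = {u \<in> D. F u = y}"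

definition weakly_seq_closed_L2 ::
  "(real^'n) set \<Rightarrow> (real^'n \<Rightarrow> real) set \<Rightarrow> ((real^'n \<Rightarrow> real) \<Rightarrow> 'h::real_inner) \<Rightarrow> bool" where
  "weakly_seq_closed_L2 \<Omega> D F \<longleftrightarrow>
     (\<forall>v. \<forall>u\<in>L2 \<Omega>. \<forall>z. (\<forall>j. v j \<in> D) \<and> weak_L2 \<Omega> v u \<and> weak_lim (\<lambda>j. F (v j)) z \<longrightarrow>
        u \<in> D \<and> F u = z)"

definition locally_bounded_deriv_L2 ::
  "(real^'n) set \<Rightarrow> (real^'n \<Rightarrow> real) set
    \<Rightarrow> ((real^'n \<Rightarrow> real) \<Rightarrow> (real^'n \<Rightarrow> real) \<Rightarrow> 'h::real_normed_vector) \<Rightarrow> bool" where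
  "locally_bounded_deriv_L2 \<Omega> D F' \<longleftrightarrow>
     (\<forall>u\<in>D. \<exists>r>0. \<exists>C. \<forall>v\<in>D. dist_L2 \<Omega> v u < r \<longrightarrow>
        (\<forall>w\<in>L2 \<Omega>. norm (F' v w) \<le> C * norm_L2 \<Omega> w))"

definition assumption_B ::
  "(real^'n) set \<Rightarrow> (real^'n \<Rightarrow> real) set \<Rightarrow> ((real^'n \<Rightarrow> real) \<Rightarrow> 'h::real_inner)
    \<Rightarrow> ((real^'n \<Rightarrow> real) \<Rightarrow> (real^'n \<Rightarrow> real) \<Rightarrow> 'h) \<Rightarrow> ((real^'n \<Rightarrow> real) \<Rightarrow> ereal)
    \<Rightarrow> 'h \<Rightarrow> (real^'n \<Rightarrow> real) \<Rightarrow> real \<Rightarrow> real \<Rightarrow> bool" where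
  "assumption_B \<Omega> D F F' h y ubar \<eta> \<rho> \<longleftrightarrow>
     weakly_seq_closed_L2 \<Omega> D F \<and> locally_bounded_deriv_L2 \<Omega> D F' \<and>
     ubar \<in> solutions D F y \<inter> dom_L2 \<Omega> h \<and> \<eta> > 0 \<and> \<rho> > 0 \<and>
     (\<forall>u\<in>D. \<forall>v\<in>D. dist_L2 \<Omega> u ubar < \<rho> \<and> dist_L2 \<Omega> v ubar < \<rho> \<longrightarrow>
        norm (F v - F u - F' u (\<lambda>x. v x - u x)) \<le> \<eta> * dist_L2 \<Omega> u v * norm (F u - F v))"

definition bregman_iterates ::
  "(real^'n) set \<Rightarrow> (real^'n \<Rightarrow> real) set \<Rightarrow> ((real^'n \<Rightarrow> real) \<Rightarrow> 'h::real_inner)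
    \<Rightarrow> ((real^'n \<Rightarrow> real) \<Rightarrow> 'h \<Rightarrow> real^'n \<Rightarrow> real) \<Rightarrow> ((real^'n \<Rightarrow> real) \<Rightarrow> ereal)
    \<Rightarrow> (nat \<Rightarrow> real) \<Rightarrow> (real^'n \<Rightarrow> real) \<Rightarrow> (real^'n \<Rightarrow> real) \<Rightarrow> 'h
    \<Rightarrow> (nat \<Rightarrow> real^'n \<Rightarrow> real) \<Rightarrow> (nat \<Rightarrow> real^'n \<Rightarrow> real) \<Rightarrow> bool" where
  \<comment> \<open>\<open>F'adj u\<close> stands for the adjoint of the derivative of \<open>F\<close> at \<open>u\<close>. That \<open>\<xi> k\<close> is a subgradient at
     \<open>u k\<close> is part of the method; it is not implied by minimality where the constraint
     \<open>u \<in> D\<close> is active.\<close>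
  "bregman_iterates \<Omega> D F F'adj h \<alpha> u0 \<xi>0 yd u \<xi> \<longleftrightarrow>
     u 0 \<in> D \<and> ae_eq \<Omega> (u 0) u0 \<and> ae_eq \<Omega> (\<xi> 0) \<xi>0 \<and>
     (\<forall>k. \<xi> k \<in> subdiff_L2 \<Omega> h (u k)) \<and>
     (\<forall>k. is_arg_min
        (\<lambda>v. ereal (1/2 * (norm (F v - yd))\<^sup>2) + ereal (\<alpha> k) * bregman \<Omega> h (\<xi> k) v (u k))
        (\<lambda>v. v \<in> D) (u (Suc k))) \<and>
     (\<forall>k. ae_eq \<Omega> (\<xi> (Suc k))
        (\<lambda>x. \<xi> k x - 1 / \<alpha> k * F'adj (u (Suc k)) (F (u (Suc k)) - yd) x))"

definition stop_index ::
  "((real^'n \<Rightarrow> real) \<Rightarrow> 'h::real_normed_vector) \<Rightarrow> 'h \<Rightarrow> real \<Rightarrow> real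
    \<Rightarrow> (nat \<Rightarrow> real^'n \<Rightarrow> real) \<Rightarrow> nat" where
  "stop_index F yd \<tau> \<delta> u = (LEAST k. norm (F (u k) - yd) \<le> \<tau> * \<delta>)"

end

theory Submission
  imports Defs "HOL-Complex_Analysis.Great_Picard"
begin

text \<open>
  Since \<open>h\<close> is strongly convex, the Bregman distance to \<open>ubar\<close> dominates \<open>1/2 \<parallel>ubar - u\<^sub>k\<parallel>\<^sup>2\<close>. As long as the
  residual exceeds \<open>\<tau> \<delta>\<close>, the tangential cone condition makes this distance decrease by a multiple of the
  squared residual, so the iteration stops and the squared residuals before stopping have a sum bounded
  independently of \<open>\<delta>\<close>. Writing \<open>\<xi>\<^sub>k\<close> as \<open>\<xi>\<^sub>0\<close> minus the accumulated updates, the same sum controls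
  \<open>\<langle>\<xi>\<^sub>k, ubar - u\<^sub>k\<rangle>\<close> at the stopping index, which bounds \<open>h\<close> there uniformly in \<open>\<delta>\<close>. Weak-* compactness in
  BV and weak closedness of \<open>F\<close> then give a limit solution, and uniqueness upgrades subsequences to the
  full sequence.

  The \<open>L\<^sup>1\<close> compactness is proved on the dual side. A smooth test function differs from its average over
  short coordinate segments by a derivative of a small function, so a bounded variation makes the two
  integrals close; averages are equi-Lipschitz, hence compact by Arzela-Ascoli, and against a compact family
  weak convergence is enough.
\<close>

section \<open>Averages of continuously differentiable functions along segments\<close>

text \<open>The constants interlock. A Bregman distance below \<open>\<gamma>\<^sup>2 / 8\<close>
  means a distance of at most \<open>\<gamma> / 2\<close> to \<open>ubar\<close>. Comparison with
  \<open>ubar\<close> bounds a step whose new residual exceeds \<open>\<delta>\<close> by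
  \<open>\<gamma> / 2\<close> as well, so the new iterate stays within \<open>\<gamma>\<close>,
  where \<open>\<eta> * \<gamma> < 1\<close> makes the cone condition effective. The last step
  escapes this argument, because its residual may fall below \<open>\<delta>\<close>; for small
  noise its length is at most \<open>3/2 * \<gamma>\<close>, and
  \<open>2 * \<gamma> < \<rho>\<close> keeps the stopped iterate in the ball. The number of
  iterations may grow without bound as \<open>\<delta>\<close> tends to zero, so the norms of the
  subgradients are not controlled. Their pairing with \<open>ubar - u k\<close> is, because the cone
  condition bounds derivatives on differences inside the ball by differences of \<open>F\<close>,
  and residuals decrease along the iteration. In the compactness proof test functions live on the
  whole space, since averaging samples them outside the domain. A cutoff factor on the BV function
  makes its derivative bound valid for test functions of arbitrary support.\<close>

definition has_C1_deriv :: "('a::euclidean_space \<Rightarrow> real) \<Rightarrow> ('a \<Rightarrow> 'a \<Rightarrow>\<^sub>L real) \<Rightarrow> bool" where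
  "has_C1_deriv f f' \<longleftrightarrow> continuous_on UNIV f' \<and> (\<forall>x. (f has_derivative blinfun_apply (f' x)) (at x))"

definition C1 :: "('a::euclidean_space \<Rightarrow> real) \<Rightarrow> bool" where
  "C1 f \<longleftrightarrow> (\<exists>f'. has_C1_deriv f f')"

lemma C1I: "has_C1_deriv f f' \<Longrightarrow> C1 f"
  by (auto simp: C1_def)

lemma has_C1_deriv_derivative: "has_C1_deriv f f' \<Longrightarrow> (f has_derivative blinfun_apply (f' x)) (at x)"
  by (auto simp: has_C1_deriv_def)

lemma has_C1_deriv_frechet:
  "has_C1_deriv f f' \<Longrightarrow> frechet_derivative f (at x) = blinfun_apply (f' x)"
  using has_C1_deriv_derivative frechet_derivative_at by metis

lemma has_C1_deriv_continuous:
  assumes "has_C1_deriv f f'"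
  shows "continuous_on S f" "continuous_on S f'"
proof -
  have "continuous_on UNIV f"
    using has_C1_deriv_derivative[OF assms]
    by (meson continuous_at_imp_continuous_on has_derivative_continuous)
  thus "continuous_on S f" using continuous_on_subset by blast
  show "continuous_on S f'" using assms continuous_on_subset unfolding has_C1_deriv_def by blast
qed

lemma C1_continuous: "C1 f \<Longrightarrow> continuous_on S f"
  by (auto simp: C1_def has_C1_deriv_continuous)

lemma C1_continuous_derivative: "C1 f \<Longrightarrow> continuous_on S (\<lambda>x. frechet_derivative f (at x) v)"
  unfolding C1_def by (auto simp: has_C1_deriv_frechet intro!: blinfun.continuous_on has_C1_deriv_continuous(2) continuous_on_const)

lemma C1_const: "C1 (\<lambda>x. c)"
  by (rule C1I[of _ "\<lambda>x. 0"]) (auto simp: has_C1_deriv_def zero_blinfun.rep_eq)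

lemma C1_linear: assumes "bounded_linear f" shows "C1 f"
proof (rule C1I)
  show "has_C1_deriv f (\<lambda>x. Blinfun f)"
    using assms by (auto simp: has_C1_deriv_def bounded_linear_Blinfun_apply bounded_linear_imp_has_derivative)
qed

lemma has_C1_deriv_add:
  "has_C1_deriv f f' \<Longrightarrow> has_C1_deriv g g' \<Longrightarrow> has_C1_deriv (\<lambda>x. f x + g x) (\<lambda>x. f' x + g' x)"
  unfolding has_C1_deriv_def by (auto intro!: continuous_intros derivative_eq_intros simp: plus_blinfun.rep_eq)

lemma has_C1_deriv_mult:
  assumes "has_C1_deriv f f'" "has_C1_deriv g g'"
  shows "has_C1_deriv (\<lambda>x. f x * g x) (\<lambda>x. f x *\<^sub>R g' x + g x *\<^sub>R f' x)"
  using assms has_C1_deriv_continuous[of f f' UNIV] has_C1_deriv_continuous[of g g' UNIV]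
  unfolding has_C1_deriv_def
  by (auto intro!: continuous_intros derivative_eq_intros simp: plus_blinfun.rep_eq scaleR_blinfun.rep_eq)

lemma has_C1_deriv_comp:
  assumes "has_C1_deriv f f'" "\<And>s. (g has_real_derivative g' s) (at s)" "continuous_on UNIV g'"
  shows "has_C1_deriv (\<lambda>x. g (f x)) (\<lambda>x. g' (f x) *\<^sub>R f' x)"
  unfolding has_C1_deriv_def
proof (intro conjI allI)
  show "continuous_on UNIV (\<lambda>x. g' (f x) *\<^sub>R f' x)"
    using has_C1_deriv_continuous[OF assms(1)]
    by (intro continuous_intros continuous_on_compose2[OF assms(3)]) auto
next
  fix x
  have "((\<lambda>x. g (f x)) has_derivative (\<lambda>v. g' (f x) * f' x v)) (at x)"
    using has_derivative_compose[OF has_C1_deriv_derivative[OF assms(1), of x], of g "(*) (g' (f x))"]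
      assms(2)[of "f x"] by (auto simp: has_field_derivative_def)
  thus "((\<lambda>x. g (f x)) has_derivative blinfun_apply (g' (f x) *\<^sub>R f' x)) (at x)"
    by (simp add: scaleR_blinfun.rep_eq)
qed

lemma C1_add: "C1 f \<Longrightarrow> C1 g \<Longrightarrow> C1 (\<lambda>x. f x + g x)"
  unfolding C1_def by (blast intro: has_C1_deriv_add)

lemma C1_mult: "C1 f \<Longrightarrow> C1 g \<Longrightarrow> C1 (\<lambda>x. f x * g x)"
  unfolding C1_def by (blast intro: has_C1_deriv_mult)

lemma frechet_derivative_C1_mult:
  assumes "C1 f" "C1 g"
  shows "frechet_derivative (\<lambda>x. f x * g x) (at x) v =
    f x * frechet_derivative g (at x) v + g x * frechet_derivative f (at x) v"
proof -
  obtain f' g' where *: "has_C1_deriv f f'" "has_C1_deriv g g'" using assms by (auto simp: C1_def)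
  show ?thesis
    by (simp add: has_C1_deriv_frechet[OF has_C1_deriv_mult[OF *]] has_C1_deriv_frechet[OF *(1)]
        has_C1_deriv_frechet[OF *(2)] plus_blinfun.rep_eq scaleR_blinfun.rep_eq)
qed

lemma C1_comp:
  "C1 f \<Longrightarrow> (\<And>s. (g has_real_derivative g' s) (at s)) \<Longrightarrow> continuous_on UNIV g' \<Longrightarrow> C1 (\<lambda>x. g (f x))"
  unfolding C1_def by (blast intro: has_C1_deriv_comp)

lemma C1_real_polynomial_function: "real_polynomial_function p \<Longrightarrow> C1 p"
  by (induction rule: real_polynomial_function.induct) (auto intro: C1_linear C1_const C1_add C1_mult)

section \<open>Integrals along segments and the defect of the average\<close>

text \<open>Differentiation under the integral sign. With derivatives stored as bounded linear
  functionals, the Leibniz rule sees a single Banach-space-valued integrand, and continuity of the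
  new derivative is that of a parameter integral.\<close>

lemma has_C1_deriv_line_integral:
  fixes e :: "'a::euclidean_space"
  assumes psi: "has_C1_deriv \<psi> \<psi>'" and k: "continuous_on UNIV \<kappa>"
  shows "has_C1_deriv (\<lambda>x. integral {0..\<epsilon>} (\<lambda>t. \<kappa> t * \<psi> (x - t *\<^sub>R e)))
           (\<lambda>x. integral {0..\<epsilon>} (\<lambda>t. \<kappa> t *\<^sub>R \<psi>' (x - t *\<^sub>R e)))"
  unfolding has_C1_deriv_def
proof (intro conjI allI)
  have c: "continuous_on (UNIV \<times> cbox 0 \<epsilon>) (\<lambda>(x, t). \<kappa> t *\<^sub>R \<psi>' (x - t *\<^sub>R e))"
    unfolding split_def
    by (intro continuous_intros continuous_on_compose2[OF k]
        continuous_on_compose2[OF has_C1_deriv_continuous(2)[OF psi, of UNIV]]) auto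
  show "continuous_on UNIV (\<lambda>x. integral {0..\<epsilon>} (\<lambda>t. \<kappa> t *\<^sub>R \<psi>' (x - t *\<^sub>R e)))"
    using integral_continuous_on_param[OF c] by simp
  fix x0
  have "((\<lambda>x. integral (cbox 0 \<epsilon>) (\<lambda>t. \<kappa> t * \<psi> (x - t *\<^sub>R e))) has_derivative
      blinfun_apply (integral (cbox 0 \<epsilon>) (\<lambda>t. \<kappa> t *\<^sub>R \<psi>' (x0 - t *\<^sub>R e)))) (at x0 within UNIV)"
  proof (rule leibniz_rule)
    fix x :: 'a and t :: real
    have "((\<lambda>x. \<psi> (x - t *\<^sub>R e)) has_derivative blinfun_apply (\<psi>' (x - t *\<^sub>R e))) (at x)"
      by (rule has_derivative_compose[OF _ has_C1_deriv_derivative[OF psi], of _ "\<lambda>v. v", unfolded o_def])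
        (auto intro!: derivative_eq_intros)
    then show "((\<lambda>x. \<kappa> t * \<psi> (x - t *\<^sub>R e)) has_derivative
        blinfun_apply (\<kappa> t *\<^sub>R \<psi>' (x - t *\<^sub>R e))) (at x within UNIV)"
      by (auto simp: scaleR_blinfun.rep_eq intro!: derivative_eq_intros)
  next
    fix x
    show "(\<lambda>t. \<kappa> t * \<psi> (x - t *\<^sub>R e)) integrable_on cbox 0 \<epsilon>"
      by (intro integrable_continuous continuous_intros continuous_on_compose2[OF k]
        continuous_on_compose2[OF has_C1_deriv_continuous(1)[OF psi, of UNIV]]) auto
  qed (use c in auto)
  thus "((\<lambda>x. integral {0..\<epsilon>} (\<lambda>t. \<kappa> t * \<psi> (x - t *\<^sub>R e))) has_derivative
      blinfun_apply (integral {0..\<epsilon>} (\<lambda>t. \<kappa> t *\<^sub>R \<psi>' (x0 - t *\<^sub>R e)))) (at x0)"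
    by simp
qed

lemma frechet_derivative_line_integral:
  fixes e :: "'a::euclidean_space"
  assumes psi: "C1 \<psi>" and k: "continuous_on UNIV \<kappa>"
  shows "frechet_derivative (\<lambda>x. integral {0..\<epsilon>} (\<lambda>t. \<kappa> t * \<psi> (x - t *\<^sub>R e))) (at x) v =
     integral {0..\<epsilon>} (\<lambda>t. \<kappa> t * frechet_derivative \<psi> (at (x - t *\<^sub>R e)) v)"
proof -
  obtain \<psi>' where p: "has_C1_deriv \<psi> \<psi>'" using psi by (auto simp: C1_def)
  have "(\<lambda>t. \<kappa> t *\<^sub>R \<psi>' (x - t *\<^sub>R e)) integrable_on {0..\<epsilon>}"
    by (intro integrable_continuous_real continuous_intros continuous_on_compose2[OF k]
        continuous_on_compose2[OF has_C1_deriv_continuous(2)[OF p, of UNIV]]) auto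
  thus ?thesis
    by (simp add: has_C1_deriv_frechet[OF has_C1_deriv_line_integral[OF p k]] has_C1_deriv_frechet[OF p]
       blinfun_apply_integral scaleR_blinfun.rep_eq)
qed

definition line_avg :: "real \<Rightarrow> 'a::euclidean_space \<Rightarrow> ('a \<Rightarrow> real) \<Rightarrow> 'a \<Rightarrow> real" where
  "line_avg \<epsilon> e \<psi> x = integral {0..\<epsilon>} (\<lambda>t. (1 / \<epsilon>) * \<psi> (x - t *\<^sub>R e))"

text \<open>The weight \<open>1 - t / \<epsilon>\<close> is the tail integral of the averaging
  kernel \<open>1 / \<epsilon>\<close> over \<open>{t..\<epsilon>}\<close>. Integration by parts
  against it turns the difference between \<open>\<psi>\<close> and its average into a directional
  derivative.\<close>

definition line_prim :: "real \<Rightarrow> 'a::euclidean_space \<Rightarrow> ('a \<Rightarrow> real) \<Rightarrow> 'a \<Rightarrow> real" where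
  "line_prim \<epsilon> e \<psi> x = integral {0..\<epsilon>} (\<lambda>t. (1 - t / \<epsilon>) * \<psi> (x - t *\<^sub>R e))"

lemma C1_line_avg: "C1 \<psi> \<Longrightarrow> C1 (line_avg \<epsilon> e \<psi>)"
  unfolding C1_def line_avg_def[abs_def]
  using has_C1_deriv_line_integral[OF _ continuous_on_const[of UNIV "1 / \<epsilon>"]] by blast

lemma C1_line_prim: "\<epsilon> > 0 \<Longrightarrow> C1 \<psi> \<Longrightarrow> C1 (line_prim \<epsilon> e \<psi>)"
proof -
  assume "\<epsilon> > 0" "C1 \<psi>"
  then obtain \<psi>' where "has_C1_deriv \<psi> \<psi>'" by (auto simp: C1_def)
  moreover have "continuous_on UNIV (\<lambda>t. 1 - t / \<epsilon>)"
    using \<open>\<epsilon> > 0\<close> by (auto intro!: continuous_intros)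
  ultimately have "has_C1_deriv (\<lambda>x. integral {0..\<epsilon>} (\<lambda>t. (1 - t / \<epsilon>) * \<psi> (x - t *\<^sub>R e)))
      (\<lambda>x. integral {0..\<epsilon>} (\<lambda>t. (1 - t / \<epsilon>) *\<^sub>R \<psi>' (x - t *\<^sub>R e)))"
    by (rule has_C1_deriv_line_integral)
  thus ?thesis
    unfolding line_prim_def[abs_def] by (rule C1I)
qed

lemma line_integrand_continuous:
  fixes \<psi> :: "'a::real_normed_vector \<Rightarrow> real"
  assumes "continuous_on UNIV \<psi>" "continuous_on UNIV \<kappa>"
  shows "continuous_on S (\<lambda>t. \<kappa> t * \<psi> (x - t *\<^sub>R e))"
  by (intro continuous_on_mult continuous_on_compose2[OF assms(1)] continuous_on_compose2[OF assms(2)] continuous_intros) auto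

lemma line_avg_bound:
  assumes "\<epsilon> > 0" "continuous_on UNIV \<psi>" "\<And>x. \<bar>\<psi> x\<bar> \<le> B"
  shows "\<bar>line_avg \<epsilon> e \<psi> x\<bar> \<le> B"
proof -
  have "norm (integral {0..\<epsilon>} (\<lambda>t. (1 / \<epsilon>) * \<psi> (x - t *\<^sub>R e))) \<le> (1 / \<epsilon>) * B * (\<epsilon> - 0)"
    using assms by (intro integral_bound line_integrand_continuous) (auto simp: abs_mult divide_right_mono)
  thus ?thesis using assms by (simp add: line_avg_def)
qed

text \<open>The weight lies in \<open>{0..1}\<close> on a segment of length
  \<open>\<epsilon>\<close>. This factor \<open>\<epsilon>\<close> is what makes it cheap to replace
  a test function by its average.\<close>

lemma line_prim_bound:
  assumes "\<epsilon> > 0" "continuous_on UNIV \<psi>" "\<And>x. \<bar>\<psi> x\<bar> \<le> B"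
  shows "\<bar>line_prim \<epsilon> e \<psi> x\<bar> \<le> \<epsilon> * B"
proof -
  have "norm (integral {0..\<epsilon>} (\<lambda>t. (1 - t / \<epsilon>) * \<psi> (x - t *\<^sub>R e))) \<le> (1 * B) * (\<epsilon> - 0)"
  proof (intro integral_bound line_integrand_continuous)
    fix t assume "t \<in> {0..\<epsilon>}"
    hence "\<bar>1 - t / \<epsilon>\<bar> \<le> 1" using assms(1) by (auto simp: field_simps abs_le_iff)
    thus "norm ((1 - t / \<epsilon>) * \<psi> (x - t *\<^sub>R e)) \<le> 1 * B"
      using assms(3) by (metis abs_ge_zero abs_mult mult_mono' real_norm_def)
  qed (use assms in \<open>auto intro!: continuous_intros\<close>)
  thus ?thesis using assms by (simp add: line_prim_def mult.commute)
qed

lemma has_real_derivative_along_line: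
  assumes "C1 \<psi>"
  shows "((\<lambda>t. \<psi> (x - t *\<^sub>R e)) has_real_derivative - frechet_derivative \<psi> (at (x - t *\<^sub>R e)) e) (at t within S)"
proof -
  obtain \<psi>' where p: "has_C1_deriv \<psi> \<psi>'" using assms by (auto simp: C1_def)
  have "((\<lambda>t. \<psi> (x - t *\<^sub>R e)) has_derivative (\<lambda>h. \<psi>' (x - t *\<^sub>R e) (- (h *\<^sub>R e)))) (at t within S)"
    by (rule has_derivative_compose[OF _ has_C1_deriv_derivative[OF p], unfolded o_def])
      (auto intro!: derivative_eq_intros)
  thus ?thesis unfolding has_field_derivative_def has_C1_deriv_frechet[OF p]
    by (simp add: blinfun.minus_right blinfun.scaleR_right mult.commute fun_eq_iff)
       (erule back_subst[where P="\<lambda>f. (_ has_derivative f) _"], auto)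
qed

text \<open>Fundamental theorem of calculus for
  \<open>- (1 - t / \<epsilon>) * \<psi> (x - t *\<^sub>R e)\<close>, which is \<open>0\<close> at
  \<open>t = \<epsilon>\<close> and \<open>- \<psi> x\<close> at \<open>t = 0\<close>.\<close>

lemma line_avg_eq:
  assumes "\<epsilon> > 0" "C1 \<psi>"
  shows "\<psi> x - line_avg \<epsilon> e \<psi> x = frechet_derivative (line_prim \<epsilon> e \<psi>) (at x) e"
proof -
  let ?d = "\<lambda>t. frechet_derivative \<psi> (at (x - t *\<^sub>R e)) e"
  have c: "continuous_on UNIV (\<lambda>x. frechet_derivative \<psi> (at x) e)" "continuous_on UNIV \<psi>"
    using assms(2) by (auto intro: C1_continuous_derivative C1_continuous)
  have k: "continuous_on UNIV (\<lambda>t. 1 - t / \<epsilon>)" using assms(1) by (auto intro!: continuous_intros)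
  have "((\<lambda>t. (1 / \<epsilon>) * \<psi> (x - t *\<^sub>R e) + (1 - t / \<epsilon>) * ?d t) has_integral
      - (1 - \<epsilon> / \<epsilon>) * \<psi> (x - \<epsilon> *\<^sub>R e) - (- (1 - 0 / \<epsilon>) * \<psi> (x - 0 *\<^sub>R e))) {0..\<epsilon>}"
    using assms(1)
    by (intro fundamental_theorem_of_calculus, simp)
       (auto intro!: derivative_eq_intros has_real_derivative_along_line[OF assms(2)]
         simp flip: has_real_derivative_iff_has_vector_derivative simp: field_simps)
  hence "integral {0..\<epsilon>} (\<lambda>t. (1 / \<epsilon>) * \<psi> (x - t *\<^sub>R e) + (1 - t / \<epsilon>) * ?d t) = \<psi> x"
    using assms(1) by (simp add: integral_unique)
  moreover have "integral {0..\<epsilon>} (\<lambda>t. (1 / \<epsilon>) * \<psi> (x - t *\<^sub>R e) + (1 - t / \<epsilon>) * ?d t) =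
      line_avg \<epsilon> e \<psi> x + integral {0..\<epsilon>} (\<lambda>t. (1 - t / \<epsilon>) * ?d t)"
    unfolding line_avg_def
    by (intro Henstock_Kurzweil_Integration.integral_add integrable_continuous_real line_integrand_continuous c continuous_on_const
        line_integrand_continuous[where \<psi>="\<lambda>x. frechet_derivative \<psi> (at x) e"] k)
  ultimately show ?thesis
    unfolding line_prim_def[abs_def] frechet_derivative_line_integral[OF assms(2) k] by simp
qed

text \<open>Averaging in a further direction does not spoil derivative bounds obtained before; this
  is what allows the averages to be iterated.\<close>

lemma line_avg_deriv_bound:
  assumes "\<epsilon> > 0" "C1 \<psi>" "\<And>x. \<bar>frechet_derivative \<psi> (at x) v\<bar> \<le> B"
  shows "\<bar>frechet_derivative (line_avg \<epsilon> e \<psi>) (at x) v\<bar> \<le> B"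
proof -
  have "frechet_derivative (line_avg \<epsilon> e \<psi>) (at x) v = line_avg \<epsilon> e (\<lambda>x. frechet_derivative \<psi> (at x) v) x"
    unfolding line_avg_def[abs_def] frechet_derivative_line_integral[OF assms(2) continuous_on_const] by simp
  thus ?thesis using line_avg_bound[OF assms(1) C1_continuous_derivative[OF assms(2)] assms(3)] by simp
qed

text \<open>Along its own direction, the derivative of the average is a difference quotient of
  \<open>\<psi>\<close>, so the sup norm of \<open>\<psi>\<close> alone bounds it.\<close>

lemma line_avg_deriv_along:
  assumes "\<epsilon> > 0" "C1 \<psi>" "\<And>x. \<bar>\<psi> x\<bar> \<le> B"
  shows "\<bar>frechet_derivative (line_avg \<epsilon> e \<psi>) (at x) e\<bar> \<le> 2 * B / \<epsilon>"
proof -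
  let ?d = "\<lambda>t. frechet_derivative \<psi> (at (x - t *\<^sub>R e)) e"
  have "((\<lambda>t. (1 / \<epsilon>) * ?d t) has_integral
      - (1 / \<epsilon>) * \<psi> (x - \<epsilon> *\<^sub>R e) - (- (1 / \<epsilon>) * \<psi> (x - 0 *\<^sub>R e))) {0..\<epsilon>}"
    using assms(1)
    by (intro fundamental_theorem_of_calculus, simp)
       (auto intro!: derivative_eq_intros has_real_derivative_along_line[OF assms(2)]
         simp flip: has_real_derivative_iff_has_vector_derivative simp: algebra_simps)
  hence "frechet_derivative (line_avg \<epsilon> e \<psi>) (at x) e = (\<psi> x - \<psi> (x - \<epsilon> *\<^sub>R e)) / \<epsilon>"
    unfolding line_avg_def[abs_def] frechet_derivative_line_integral[OF assms(2) continuous_on_const]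
    by (simp only: integral_unique) (simp add: diff_divide_distrib)
  moreover have "\<bar>\<psi> x - \<psi> (x - \<epsilon> *\<^sub>R e)\<bar> \<le> 2 * B"
    using assms(3)[of x] assms(3)[of "x - \<epsilon> *\<^sub>R e"] by linarith
  ultimately show ?thesis using assms(1) by (simp add: divide_right_mono)
qed

text \<open>The outermost average supplies the bound in its own direction, and the bounds from the
  inner averages persist. No derivative of \<open>\<psi>\<close> enters the constants, which gives
  equicontinuity for an arbitrary family of test functions with a common sup bound.\<close>

lemma iterated_line_avg:
  assumes "\<epsilon> > 0" "C1 \<psi>" "\<And>x. \<bar>\<psi> x\<bar> \<le> B"
  shows "C1 (foldr (line_avg \<epsilon>) es \<psi>)"
    and "\<bar>foldr (line_avg \<epsilon>) es \<psi> x\<bar> \<le> B"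
    and "e \<in> set es \<Longrightarrow> \<bar>frechet_derivative (foldr (line_avg \<epsilon>) es \<psi>) (at x) e\<bar> \<le> 2 * B / \<epsilon>"
proof -
  show 1: "C1 (foldr (line_avg \<epsilon>) es \<psi>)" for es
    by (induction es) (auto simp: assms C1_line_avg)
  show 2: "\<bar>foldr (line_avg \<epsilon>) es \<psi> x\<bar> \<le> B" for es x
    by (induction es arbitrary: x) (auto simp: assms intro!: line_avg_bound C1_continuous 1)
  show "e \<in> set es \<Longrightarrow> \<bar>frechet_derivative (foldr (line_avg \<epsilon>) es \<psi>) (at x) e\<bar> \<le> 2 * B / \<epsilon>"
    by (induction es arbitrary: x)
      (auto simp: assms 1 2 intro: line_avg_deriv_bound line_avg_deriv_along)
qed

lemma C1_directional_lipschitz: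
  assumes "C1 f" "\<And>x b. b \<in> Basis \<Longrightarrow> \<bar>frechet_derivative f (at x) b\<bar> \<le> L"
  shows "\<bar>f x - f y\<bar> \<le> (real DIM('a) * L) * norm (x - y :: 'a::euclidean_space)"
proof -
  obtain f' where f: "has_C1_deriv f f'" using assms by (auto simp: C1_def)
  have "onorm (blinfun_apply (f' z)) \<le> real DIM('a) * L" for z
  proof (rule onorm_le)
    fix v
    have "norm (f' z v) = \<bar>\<Sum>b\<in>Basis. (v \<bullet> b) * f' z b\<bar>"
      by (subst euclidean_representation[of v, symmetric])
         (simp add: blinfun.sum_right blinfun.scaleR_right)
    also have "\<dots> \<le> (\<Sum>b\<in>Basis. \<bar>(v \<bullet> b) * f' z b\<bar>)" by (rule sum_abs)
    also have "\<dots> \<le> (\<Sum>b\<in>(Basis::'a set). norm v * L)"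
      using assms(2) unfolding has_C1_deriv_frechet[OF f]
      by (intro sum_mono) (auto simp: abs_mult Basis_le_norm intro!: mult_mono)
    finally show "norm (f' z v) \<le> real DIM('a) * L * norm v" by (simp add: mult_ac)
  qed
  thus ?thesis
    using differentiable_bound[of UNIV f "\<lambda>z. blinfun_apply (f' z)" "real DIM('a) * L" x y] has_C1_deriv_derivative[OF f]
    by auto
qed

section \<open>Weak convergence and bounded variation imply strong convergence\<close>

lemma not_tendsto_0_subseq:
  fixes f :: "nat \<Rightarrow> real"
  assumes "\<not> f \<longlonglongrightarrow> 0"
  obtains c r where "c > 0" "strict_mono (r :: nat \<Rightarrow> nat)" "\<And>m. \<bar>f (r m)\<bar> \<ge> c"
proof -
  obtain c where c: "c > 0" "\<And>N. \<exists>n\<ge>N. \<bar>f n\<bar> \<ge> c"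
    using assms unfolding LIMSEQ_iff by (auto simp: not_less)
  have "infinite {n. \<bar>f n\<bar> \<ge> c}"
    using c(2) by (auto simp: infinite_nat_iff_unbounded_le)
  from infinite_enumerate[OF this] show ?thesis using that c(1) by auto
qed

lemma continuous_on_closure_bounded:
  fixes g :: "'a::euclidean_space \<Rightarrow> real"
  assumes "bounded S" "continuous_on (closure S) g"
  shows "\<exists>B. \<forall>x\<in>closure S. \<bar>g x\<bar> \<le> B"
proof -
  have "compact (g ` closure S)" using assms by (intro compact_continuous_image) auto
  thus ?thesis by (metis bounded_iff compact_imp_bounded imageI real_norm_def)
qed

lemma integrable_mult_continuous:
  fixes S :: "'a::euclidean_space set"
  assumes "bounded S" "S \<in> sets lebesgue" "integrable (lebesgue_on S) w" "continuous_on (closure S) g"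
  shows "integrable (lebesgue_on S) (\<lambda>x. w x * g x :: real)"
proof -
  obtain B where B: "\<And>x. x \<in> closure S \<Longrightarrow> \<bar>g x\<bar> \<le> B"
    using continuous_on_closure_bounded[OF assms(1,4)] by blast
  have [measurable]: "g \<in> borel_measurable (lebesgue_on S)"
    using assms continuous_on_subset[OF assms(4) closure_subset]
    by (intro continuous_imp_measurable_on_sets_lebesgue) auto
  have [measurable]: "w \<in> borel_measurable (lebesgue_on S)" using assms by auto
  show ?thesis
  proof (rule Bochner_Integration.integrable_bound[of _ "\<lambda>x. B * w x"])
    show "AE x in lebesgue_on S. norm (w x * g x) \<le> norm (B * w x)"
    proof (rule AE_I2)
      fix x assume "x \<in> space (lebesgue_on S)"
      hence "\<bar>g x\<bar> \<le> \<bar>B\<bar>" using B[of x] closure_subset by (force simp: space_restrict_space)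
      thus "norm (w x * g x) \<le> norm (B * w x)"
        by (simp add: abs_mult) (metis mult.commute mult_right_mono abs_ge_zero)
    qed
  qed (use assms in auto)
qed

lemma integral_mult_bound:
  fixes w g :: "'a::euclidean_space \<Rightarrow> real"
  assumes "integrable (lebesgue_on S) w" "\<And>x. x \<in> S \<Longrightarrow> \<bar>g x\<bar> \<le> B"
  shows "\<bar>\<integral>x. w x * g x \<partial>lebesgue_on S\<bar> \<le> B * (\<integral>x. \<bar>w x\<bar> \<partial>lebesgue_on S)"
proof -
  have "\<bar>\<integral>x. w x * g x \<partial>lebesgue_on S\<bar> \<le> (\<integral>x. \<bar>w x * g x\<bar> \<partial>lebesgue_on S)"
    by (rule integral_abs_bound)
  also have "\<dots> \<le> (\<integral>x. B * \<bar>w x\<bar> \<partial>lebesgue_on S)"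
  proof (rule integral_mono')
    fix x assume "x \<in> space (lebesgue_on S)"
    hence x: "\<bar>g x\<bar> \<le> B" using assms by (simp add: space_restrict_space)
    hence "\<bar>g x\<bar> * \<bar>w x\<bar> \<le> B * \<bar>w x\<bar>" by (rule mult_right_mono) simp
    thus "\<bar>w x * g x\<bar> \<le> B * \<bar>w x\<bar>" by (simp add: abs_mult mult.commute)
    show "0 \<le> B * \<bar>w x\<bar>" using x by (intro mult_nonneg_nonneg) auto
  qed (use assms in auto)
  finally show ?thesis by simp
qed

lemma abs_sin_diff_le: "\<bar>sin a - sin b\<bar> \<le> \<bar>a - b :: real\<bar>"
proof -
  have "(sin has_derivative (\<lambda>h. cos x * h)) (at x within UNIV)" for x :: real
    using DERIV_sin[of x] by (simp add: has_field_derivative_def)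
  moreover have "onorm (\<lambda>h. cos x * h) \<le> 1" for x :: real
    by (rule onorm_le) (simp add: abs_mult mult_left_le_one_le)
  ultimately show ?thesis using differentiable_bound[of UNIV sin "\<lambda>x h. cos x * h" 1 a b] by auto
qed

text \<open>The clipped continuous approximation \<open>h\<close> of \<open>sgn w\<close> is made smooth as \<open>sin \<circ> p\<close> with a polynomial
  \<open>p\<close> close to \<open>arcsin \<circ> h\<close>; this keeps the bound \<open>1\<close> on the whole space.\<close>

lemma L1_norm_smooth_test:
  fixes S :: "'a::euclidean_space set"
  assumes "bounded S" and meas: "S \<in> sets lebesgue" and w: "integrable (lebesgue_on S) w" and "\<eta> > 0"
  obtains \<psi> where "C1 \<psi>" "\<And>x. \<bar>\<psi> x\<bar> \<le> 1"
    "(\<integral>x. \<bar>w x\<bar> \<partial>lebesgue_on S) - \<eta> < (\<integral>x. w x * \<psi> x \<partial>lebesgue_on S)"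
proof -
  let ?M = "lebesgue_on S"
  let ?c = "\<lambda>t::real. max (-1) (min 1 t)"
  have [measurable]: "w \<in> borel_measurable ?M" using w by auto
  have "(\<lambda>x. sgn (w x)) measurable_on S"
    unfolding measurable_on_iff_borel_measurable[OF meas] sgn_if by measurable
  \<comment> \<open>Measurability yields continuous functions on the whole space that converge to
    \<open>sgn w\<close> off a negligible set. Clipping them to \<open>{-1..1}\<close> makes
    \<open>\<bar>w\<bar>\<close> a dominating function.\<close>
  then obtain N g where N: "negligible N" and g: "\<And>n. continuous_on UNIV (g n)"
     and lim: "\<And>x. x \<notin> N \<Longrightarrow> (\<lambda>n. g n x) \<longlonglongrightarrow> (if x \<in> S then sgn (w x) else 0)"
    unfolding measurable_on_def by metis
  have cg: "continuous_on UNIV (\<lambda>x. ?c (g n x))" for n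
    by (intro continuous_intros g)
  have [measurable]: "(\<lambda>x. ?c (g n x)) \<in> borel_measurable ?M" for n
    using continuous_on_subset[OF cg[of n]] meas
    by (intro continuous_imp_measurable_on_sets_lebesgue) auto
  have "(\<lambda>n. \<integral>x. w x * ?c (g n x) \<partial>?M) \<longlonglongrightarrow> (\<integral>x. w x * sgn (w x) \<partial>?M)"
  proof (rule integral_dominated_convergence[where w="\<lambda>x. \<bar>w x\<bar>"])
    have "AE x in ?M. x \<notin> N"
      using N meas AE_not_in[of N lebesgue] by (auto simp: AE_restrict_space_iff negligible_iff_null_sets)
    moreover have "(\<lambda>n. w x * ?c (g n x)) \<longlonglongrightarrow> w x * sgn (w x)" if "x \<notin> N" "x \<in> S" for x
    proof -
      have "(\<lambda>n. w x * ?c (g n x)) \<longlonglongrightarrow> w x * ?c (sgn (w x))"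
        using lim[OF that(1)] that(2) by (intro tendsto_intros) auto
      thus ?thesis by (simp add: sgn_if split: if_splits)
    qed
    ultimately show "AE x in ?M. (\<lambda>n. w x * ?c (g n x)) \<longlonglongrightarrow> w x * sgn (w x)"
      by (auto simp: space_restrict_space elim!: AE_mp)
    show "AE x in ?M. norm (w x * ?c (g n x)) \<le> \<bar>w x\<bar>" for n
    proof -
      have "\<bar>?c (g n x)\<bar> \<le> 1" for x by auto
      thus ?thesis by (simp add: abs_mult mult_left_le)
    qed
  qed (use w in auto)
  moreover have "w x * sgn (w x) = \<bar>w x\<bar>" for x by (simp add: abs_sgn)
  ultimately have "(\<lambda>n. \<integral>x. w x * ?c (g n x) \<partial>?M) \<longlonglongrightarrow> (\<integral>x. \<bar>w x\<bar> \<partial>?M)" by simp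
  from order_tendstoD(1)[OF this, of "(\<integral>x. \<bar>w x\<bar> \<partial>?M) - \<eta> / 2"] \<open>\<eta> > 0\<close>
  obtain n where n: "(\<integral>x. \<bar>w x\<bar> \<partial>?M) - \<eta> / 2 < (\<integral>x. w x * ?c (g n x) \<partial>?M)"
    by (auto simp: eventually_sequentially)
  define h where "h x = ?c (g n x)" for x
  have h: "continuous_on UNIV h" "\<And>x. \<bar>h x\<bar> \<le> 1" using cg[of n] by (auto simp: h_def[abs_def])
  define I where "I = (\<integral>x. \<bar>w x\<bar> \<partial>?M)"
  have I: "I \<ge> 0" by (simp add: I_def)
  have "continuous_on (closure S) (\<lambda>x. arcsin (h x))"
    using h by (intro continuous_on_arcsin continuous_on_subset[OF h(1)]) (auto simp: abs_le_iff minus_le_iff)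
  \<comment> \<open>The tolerance is multiplied by the norm \<open>I\<close> later;
    \<open>I + 1\<close> in the denominator covers \<open>I = 0\<close>. The other half of
    \<open>\<eta>\<close> was spent on choosing \<open>n\<close>.\<close>
  then obtain p where p: "real_polynomial_function p"
      and pa: "\<And>x. x \<in> closure S \<Longrightarrow> \<bar>arcsin (h x) - p x\<bar> < \<eta> / (2 * (I + 1))"
    using Stone_Weierstrass_real_polynomial_function[of "closure S" "\<lambda>x. arcsin (h x)" "\<eta> / (2 * (I + 1))"]
      \<open>bounded S\<close> \<open>\<eta> > 0\<close> I by auto
  define \<psi> where "\<psi> x = sin (p x)" for x
  have C1: "C1 \<psi>" unfolding \<psi>_def[abs_def]
    by (rule C1_comp[OF C1_real_polynomial_function[OF p], of sin cos]) (auto intro!: derivative_eq_intros continuous_intros)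
  have iw: "integrable ?M (\<lambda>x. w x * \<psi> x)" "integrable ?M (\<lambda>x. w x * h x)"
    using assms C1_continuous[OF C1] continuous_on_subset[OF h(1)] by (auto intro!: integrable_mult_continuous)
  have "\<bar>\<integral>x. w x * (\<psi> x - h x) \<partial>?M\<bar> \<le> (\<eta> / (2 * (I + 1))) * I" unfolding I_def
  proof (rule integral_mult_bound[OF w])
    fix x assume "x \<in> S"
    hence "\<bar>p x - arcsin (h x)\<bar> \<le> \<eta> / (2 * (I + 1))" using pa[of x] closure_subset[of S] by auto
    moreover have "h x = sin (arcsin (h x))" using h(2)[of x] by (simp add: abs_le_iff)
    ultimately show "\<bar>\<psi> x - h x\<bar> \<le> \<eta> / (2 * (integral\<^sup>L ?M (\<lambda>x. \<bar>w x\<bar>) + 1))"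
      unfolding \<psi>_def I_def[symmetric] using abs_sin_diff_le[of "p x" "arcsin (h x)"] by linarith
  qed
  also have "\<dots> \<le> \<eta> / 2" using I \<open>\<eta> > 0\<close> by (simp add: field_simps)
  finally have "\<bar>(\<integral>x. w x * \<psi> x \<partial>?M) - (\<integral>x. w x * h x \<partial>?M)\<bar> \<le> \<eta> / 2"
    using iw by (simp add: right_diff_distrib)
  with n have "(\<integral>x. \<bar>w x\<bar> \<partial>?M) - \<eta> < (\<integral>x. w x * \<psi> x \<partial>?M)"
    unfolding h_def[symmetric] by linarith
  moreover have "\<bar>\<psi> x\<bar> \<le> 1" for x by (simp add: \<psi>_def)
  ultimately show ?thesis using that C1 by blast
qed

text \<open>Telescoping over the directions: each average changes the integral by the derivative of
  a \<open>line_prim\<close>, whose sup norm is at most \<open>\<epsilon>\<close>. The bound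
  \<open>bv\<close> is required for every \<open>C1\<close> function, without a support condition,
  because averages and primitives spread the support.\<close>

lemma iterated_line_avg_test:
  fixes S :: "'a::euclidean_space set"
  assumes "bounded S" "S \<in> sets lebesgue" and w: "integrable (lebesgue_on S) w"
    and bv: "\<And>f b B. C1 f \<Longrightarrow> (\<And>x. \<bar>f x\<bar> \<le> B) \<Longrightarrow> b \<in> Basis \<Longrightarrow>
       \<bar>\<integral>x. w x * frechet_derivative f (at x) b \<partial>lebesgue_on S\<bar> \<le> M * B"
    and "\<epsilon> > 0" "C1 \<psi>" "\<And>x. \<bar>\<psi> x\<bar> \<le> 1" "set es \<subseteq> Basis"
  shows "\<bar>\<integral>x. w x * (\<psi> x - foldr (line_avg \<epsilon>) es \<psi> x) \<partial>lebesgue_on S\<bar> \<le> real (length es) * (\<epsilon> * M)"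
  using \<open>set es \<subseteq> Basis\<close>
proof (induction es)
  case (Cons e es)
  let ?M = "lebesgue_on S"
  let ?G = "foldr (line_avg \<epsilon>) es \<psi>"
  have G: "C1 ?G" "\<And>x. \<bar>?G x\<bar> \<le> 1"
    using iterated_line_avg[of \<epsilon> \<psi> 1] assms by auto
  have i: "integrable ?M (\<lambda>x. w x * (\<psi> x - ?G x))" "integrable ?M (\<lambda>x. w x * (?G x - line_avg \<epsilon> e ?G x))"
    using assms G by (intro integrable_mult_continuous continuous_on_diff C1_continuous C1_line_avg; simp)+
  have "(\<integral>x. w x * (\<psi> x - foldr (line_avg \<epsilon>) (e # es) \<psi> x) \<partial>?M) =
      (\<integral>x. w x * (\<psi> x - ?G x) \<partial>?M) + (\<integral>x. w x * (?G x - line_avg \<epsilon> e ?G x) \<partial>?M)"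
    by (subst Bochner_Integration.integral_add[OF i, symmetric]) (simp add: algebra_simps)
  moreover have "(\<integral>x. w x * (?G x - line_avg \<epsilon> e ?G x) \<partial>?M)
      = (\<integral>x. w x * frechet_derivative (line_prim \<epsilon> e ?G) (at x) e \<partial>?M)"
    using line_avg_eq[OF \<open>\<epsilon> > 0\<close> G(1)] by simp
  moreover have "\<bar>\<dots>\<bar> \<le> M * (\<epsilon> * 1)"
    using Cons.prems assms(5) G by (intro bv C1_line_prim line_prim_bound C1_continuous) auto
  ultimately show ?case using Cons by (simp add: algebra_simps)
qed simp

text \<open>Replacing the test functions by their iterated line averages costs only \<open>O(\<epsilon>)\<close> by the bound on
  the derivatives; the averages are equi-Lipschitz, and against a uniformly convergent sequence weak
  convergence suffices.\<close>

lemma weak_BV_imp_L1_tendsto_0: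
  fixes S :: "'a::euclidean_space set"
  assumes S: "bounded S" "S \<in> sets lebesgue" and w: "\<And>m. integrable (lebesgue_on S) (w m)"
    and C: "\<And>m. (\<integral>x. \<bar>w m x\<bar> \<partial>lebesgue_on S) \<le> C"
    and bv: "\<And>m f b B. C1 f \<Longrightarrow> (\<And>x. \<bar>f x\<bar> \<le> B) \<Longrightarrow> b \<in> Basis \<Longrightarrow>
       \<bar>\<integral>x. w m x * frechet_derivative f (at x) b \<partial>lebesgue_on S\<bar> \<le> M * B"
    and weak: "\<And>g. continuous_on (closure S) g \<Longrightarrow> (\<lambda>m. \<integral>x. w m x * g x \<partial>lebesgue_on S) \<longlonglongrightarrow> 0"
  shows "(\<lambda>m. \<integral>x. \<bar>w m x\<bar> \<partial>lebesgue_on S) \<longlonglongrightarrow> 0"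
proof (rule ccontr)
  let ?M = "lebesgue_on S"
  assume "\<not> ?thesis"
  then obtain c r where c: "c > 0" and r: "strict_mono (r :: nat \<Rightarrow> nat)" and "\<And>m. \<bar>\<integral>x. \<bar>w (r m) x\<bar> \<partial>?M\<bar> \<ge> c"
    by (rule not_tendsto_0_subseq) blast
  hence cr: "\<And>m. (\<integral>x. \<bar>w (r m) x\<bar> \<partial>?M) \<ge> c" by simp
  have "\<exists>\<psi>. C1 \<psi> \<and> (\<forall>x. \<bar>\<psi> x\<bar> \<le> 1) \<and> (\<integral>x. \<bar>w (r m) x\<bar> \<partial>?M) - c / 4 < (\<integral>x. w (r m) x * \<psi> x \<partial>?M)" for m
  proof -
    from c have "c / 4 > 0" by simp
    from L1_norm_smooth_test[OF S w this, of "r m"] show ?thesis by blast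
  qed
  then obtain \<psi> where \<psi>: "\<And>m. C1 (\<psi> m)" "\<And>m x. \<bar>\<psi> m x\<bar> \<le> 1"
    and \<psi>w: "\<And>m. (\<integral>x. \<bar>w (r m) x\<bar> \<partial>?M) - c / 4 < (\<integral>x. w (r m) x * \<psi> m x \<partial>?M)" by metis
  obtain es :: "'a list" where es: "set es = Basis" "length es = DIM('a)"
    using finite_distinct_list[OF finite_Basis] distinct_card by metis
  \<comment> \<open>Chosen so that averaging in all \<open>DIM('a)\<close> directions costs at most
    \<open>c / 4\<close>. The modulus is taken because \<open>M\<close> has no assumed sign.\<close>
  define \<epsilon> where "\<epsilon> = c / (4 * (DIM('a) * \<bar>M\<bar> + 1))"
  have pos: "DIM('a) * \<bar>M\<bar> + 1 > 0" by (intro add_nonneg_pos) auto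
  hence \<epsilon>: "\<epsilon> > 0" using c by (simp add: \<epsilon>_def)
  have "\<epsilon> * (DIM('a) * \<bar>M\<bar> + 1) = c / 4" using pos by (simp add: \<epsilon>_def field_simps)
  hence "\<epsilon> * (DIM('a) * \<bar>M\<bar>) \<le> c / 4" using \<epsilon> by (simp add: algebra_simps)
  moreover have "\<epsilon> * (DIM('a) * M) \<le> \<epsilon> * (DIM('a) * \<bar>M\<bar>)" using \<epsilon> by (intro mult_left_mono) auto
  ultimately have \<epsilon>M: "DIM('a) * (\<epsilon> * M) \<le> c / 4" by (simp add: mult_ac)
  define G where "G m = foldr (line_avg \<epsilon>) es (\<psi> m)" for m
  have G: "C1 (G m)" "\<And>x. \<bar>G m x\<bar> \<le> 1"
      and "\<And>x b. b \<in> Basis \<Longrightarrow> \<bar>frechet_derivative (G m) (at x) b\<bar> \<le> 2 / \<epsilon>" for m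
    using iterated_line_avg[OF \<epsilon> \<psi>(1)[of m] \<psi>(2), where es=es] es by (auto simp: G_def)
  hence Lip: "\<bar>G m x - G m y\<bar> \<le> (DIM('a) * (2 / \<epsilon>)) * norm (x - y)" for m x y
    by (intro C1_directional_lipschitz) auto
  obtain g k where g: "continuous_on (closure S) g" and k: "strict_mono (k :: nat \<Rightarrow> nat)"
    and gk: "\<And>e. 0 < e \<Longrightarrow> \<exists>N. \<forall>n x. n \<ge> N \<and> x \<in> closure S \<longrightarrow> norm (G (k n) x - g x) < e"
  proof (rule Arzela_Ascoli[of "closure S" G 1])
    show "compact (closure S)" using S by simp
    show "\<And>n x. norm (G n x) \<le> 1" using G by simp
    fix x and e :: real assume "e > 0"
    define L where "L = DIM('a) * (2 / \<epsilon>)"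
    have L: "L > 0" using \<epsilon> by (simp add: L_def)
    show "\<exists>d>0. \<forall>n y. y \<in> closure S \<and> norm (x - y) < d \<longrightarrow> norm (G n x - G n y) < e"
    proof (intro exI[of _ "e / L"] conjI allI impI)
      fix n y assume "y \<in> closure S \<and> norm (x - y) < e / L"
      hence "L * norm (x - y) < e" using L by (simp add: field_simps)
      thus "norm (G n x - G n y) < e" using Lip[of n x y] by (simp add: L_def)
    qed (use L \<open>e > 0\<close> in auto)
  qed blast
  have i: "integrable ?M (\<lambda>x. w (r m) x * G m' x)" "integrable ?M (\<lambda>x. w (r m) x * \<psi> m' x)"
       "integrable ?M (\<lambda>x. w (r m) x * g x)"  for m m'
    using S w G \<psi> g by (auto intro!: integrable_mult_continuous C1_continuous)
  \<comment> \<open>A loss of \<open>c / 4\<close> comes from the choice of the test function and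
    another \<open>c / 4\<close> from averaging it, so \<open>c / 2\<close> remains.\<close>
  have low: "(\<integral>x. w (r m) x * G m x \<partial>?M) \<ge> c / 2" for m
  proof -
    have "\<bar>\<integral>x. w (r m) x * (\<psi> m x - G m x) \<partial>?M\<bar> \<le> DIM('a) * (\<epsilon> * M)"
      unfolding G_def es(2)[symmetric]
      by (rule iterated_line_avg_test[OF S w bv \<epsilon> \<psi>(1) \<psi>(2)]) (use es in auto)
    moreover have "(\<integral>x. w (r m) x * (\<psi> m x - G m x) \<partial>?M) =
        (\<integral>x. w (r m) x * \<psi> m x \<partial>?M) - (\<integral>x. w (r m) x * G m x \<partial>?M)"
      using i by (simp add: right_diff_distrib)
    ultimately show ?thesis using \<psi>w[of m] cr[of m] \<epsilon>M by linarith
  qed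
  \<comment> \<open>Replacing \<open>G (k m)\<close> by the limit \<open>g\<close> costs at most
    \<open>e * \<bar>C\<bar> \<le> c / 8\<close>, and weak convergence brings the integral against
    \<open>g\<close> below \<open>c / 8\<close>; together this contradicts
    \<open>c / 2\<close>.\<close>
  define e where "e = c / (8 * (\<bar>C\<bar> + 1))"
  have e: "e > 0" "e * \<bar>C\<bar> \<le> c / 8" using c by (auto simp: e_def field_simps)
  obtain N where N: "\<And>n x. n \<ge> N \<Longrightarrow> x \<in> closure S \<Longrightarrow> norm (G (k n) x - g x) < e"
    using gk[OF e(1)] by blast
  have "(\<lambda>m. \<integral>x. w (r (k m)) x * g x \<partial>?M) \<longlonglongrightarrow> 0"
    using LIMSEQ_subseq_LIMSEQ[OF weak[OF g] strict_mono_o[OF r k]] by (simp add: o_def)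
  from order_tendstoD(2)[OF this, of "c / 8"] c
  obtain m where m: "m \<ge> N" "(\<integral>x. w (r (k m)) x * g x \<partial>?M) < c / 8"
    by (auto simp: eventually_sequentially) (meson nle_le)
  have "\<bar>\<integral>x. w (r (k m)) x * (G (k m) x - g x) \<partial>?M\<bar> \<le> e * (\<integral>x. \<bar>w (r (k m)) x\<bar> \<partial>?M)"
    using N[OF m(1)] closure_subset[of S] by (intro integral_mult_bound w) (auto intro: less_imp_le)
  also have "\<dots> \<le> e * \<bar>C\<bar>" using C[of "r (k m)"] e by (intro mult_left_mono) auto
  finally have "\<bar>(\<integral>x. w (r (k m)) x * G (k m) x \<partial>?M) - (\<integral>x. w (r (k m)) x * g x \<partial>?M)\<bar> \<le> c / 8"
    using i e by (simp add: right_diff_distrib)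
  with m(2) low[of "k m"] c show False by linarith
qed

section \<open>Subsequences that converge against every continuous test function\<close>

text \<open>A monomial is coded by the list of its coordinate directions. The monomials are then
  indexed by the countable set \<open>lists Basis\<close>, and multiplication by a coordinate is
  \<open>Cons\<close>.\<close>

definition basis_monomial :: "'a::euclidean_space list \<Rightarrow> 'a \<Rightarrow> real" where
  "basis_monomial bs x = prod_list (map (\<lambda>b. x \<bullet> b) bs)"

lemma continuous_on_basis_monomial: "continuous_on S (basis_monomial bs)"
  unfolding basis_monomial_def by (induction bs) (auto intro!: continuous_intros)

lemma basis_monomial_bound:
  assumes "norm x \<le> R" "set bs \<subseteq> Basis"
  shows "\<bar>basis_monomial bs x\<bar> \<le> R ^ length bs"
  using assms(2)
proof (induction bs)
  case (Cons b bs)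
  hence "\<bar>x \<bullet> b\<bar> \<le> R" using assms(1) Basis_le_norm[of b x] by auto
  thus ?case using Cons by (auto simp: basis_monomial_def abs_mult intro!: mult_mono)
qed (simp add: basis_monomial_def)

text \<open>A diagonal sequence handles the countably many monomials. Linearity extends convergence
  to polynomials, and the uniform bound on the integrals of \<open>\<bar>w m\<bar>\<close> lets
  uniform approximation extend it to all continuous functions.\<close>

lemma weakly_convergent_subseq:
  fixes S :: "'a::euclidean_space set" and w :: "nat \<Rightarrow> 'a \<Rightarrow> real"
  assumes S: "bounded S" "S \<in> sets lebesgue" and w: "\<And>m. integrable (lebesgue_on S) (w m)"
    and C: "\<And>m::nat. (\<integral>x. \<bar>w m x\<bar> \<partial>lebesgue_on S) \<le> C"
  obtains r where "strict_mono (r :: nat \<Rightarrow> nat)"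
    "\<And>g. continuous_on (closure S) g \<Longrightarrow> convergent (\<lambda>m. \<integral>x. w (r m) x * g x \<partial>lebesgue_on S)"
proof -
  let ?M = "lebesgue_on S"
  obtain R where R: "R > 0" "\<And>x. x \<in> S \<Longrightarrow> norm x \<le> R" using S(1) bounded_pos by blast
  \<comment> \<open>Division by \<open>R ^ length bs\<close> gives all monomials the common bound
    \<open>C\<close> that the diagonal argument asks for.\<close>
  define f where "f m bs = (\<integral>x. w m x * basis_monomial bs x \<partial>?M) / R ^ length bs" for m bs
  have "norm (f m bs) \<le> C" if "bs \<in> lists Basis" for m bs
  proof -
    have "\<bar>\<integral>x. w m x * basis_monomial bs x \<partial>?M\<bar> \<le> R ^ length bs * (\<integral>x. \<bar>w m x\<bar> \<partial>?M)"
      using that by (intro integral_mult_bound w basis_monomial_bound R) auto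
    also have "\<dots> \<le> R ^ length bs * C" using C R by (intro mult_left_mono) auto
    finally show ?thesis using R by (simp add: f_def field_simps)
  qed
  moreover have "countable (lists (Basis :: 'a set))" by (intro countable_lists countable_finite finite_Basis)
  ultimately obtain r where r: "strict_mono (r :: nat \<Rightarrow> nat)"
      and fr: "\<And>bs. bs \<in> lists Basis \<Longrightarrow> \<exists>l. (\<lambda>m. f (r m) bs) \<longlonglongrightarrow> l"
    using function_convergent_subsequence[of "lists Basis" f C] by metis
  let ?conv = "\<lambda>q. convergent (\<lambda>m. \<integral>x. w (r m) x * q x \<partial>?M)"
  have mono: "?conv (basis_monomial bs)" if "set bs \<subseteq> Basis" for bs
  proof -
    have "convergent (\<lambda>m. R ^ length bs * f (r m) bs)"
      using fr[of bs] that by (intro convergent_mult convergent_const) (auto simp: convergent_def in_lists_conv_set)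
    thus ?thesis using R by (simp add: f_def)
  qed
  \<comment> \<open>The claim carries a spare factor \<open>q\<close> and a spare monomial so that
    the induction closes: for a product, the second factor is absorbed into \<open>q\<close>, and
    for a linear function the coordinates are absorbed into \<open>bs\<close>.\<close>
  have step: "\<And>q bs. continuous_on (closure S) q \<Longrightarrow>
        (\<And>bs. set bs \<subseteq> Basis \<Longrightarrow> ?conv (\<lambda>x. q x * basis_monomial bs x)) \<Longrightarrow>
        set bs \<subseteq> Basis \<Longrightarrow> ?conv (\<lambda>x. p x * q x * basis_monomial bs x)"
    if "real_polynomial_function p" for p
    using that
  proof (induction rule: real_polynomial_function.induct)
    case (linear p)
    note q = linear(2-)
    interpret bounded_linear p by fact
    have lin: "p x = (\<Sum>b\<in>Basis. (x \<bullet> b) * p b)" for x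
      by (subst euclidean_representation[of x, symmetric]) (simp add: sum scaleR)
    have "(\<integral>x. w (r m) x * (p x * q x * basis_monomial bs x) \<partial>?M) =
       (\<Sum>b\<in>Basis. p b * (\<integral>x. w (r m) x * (q x * basis_monomial (b # bs) x) \<partial>?M))" for m
    proof -
      have "(\<lambda>x. w (r m) x * (p x * q x * basis_monomial bs x)) =
         (\<lambda>x. \<Sum>b\<in>Basis. p b * (w (r m) x * (q x * basis_monomial (b # bs) x)))"
        by (rule ext, subst lin) (simp add: sum_distrib_left sum_distrib_right basis_monomial_def mult_ac)
      moreover have "integrable ?M (\<lambda>x. w (r m) x * (q x * basis_monomial (b # bs) x))" for b
        using q by (intro integrable_mult_continuous S w continuous_intros continuous_on_basis_monomial)
      ultimately show ?thesis by (simp add: Bochner_Integration.integral_sum)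
    qed
    moreover have "convergent (\<lambda>m. \<Sum>b\<in>Basis. p b * (\<integral>x. w (r m) x * (q x * basis_monomial (b # bs) x) \<partial>?M))"
      using q by (intro convergent_sum convergent_mult convergent_const) auto
    ultimately show ?case by simp
  next
    case (const c)
    have "convergent (\<lambda>m. c * (\<integral>x. w (r m) x * (q x * basis_monomial bs x) \<partial>?M))"
      using const by (intro convergent_mult convergent_const) auto
    moreover have "c * (\<integral>x. w (r m) x * (q x * basis_monomial bs x) \<partial>?M) =
       (\<integral>x. w (r m) x * (c * q x * basis_monomial bs x) \<partial>?M)" for m
      by (subst integral_mult_right_zero[symmetric]) (simp add: mult_ac)
    ultimately show ?case by simp
  next
    case (add p1 p2)
    have "(\<integral>x. w (r m) x * ((p1 x + p2 x) * q x * basis_monomial bs x) \<partial>?M) =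
      (\<integral>x. w (r m) x * (p1 x * q x * basis_monomial bs x) \<partial>?M) + (\<integral>x. w (r m) x * (p2 x * q x * basis_monomial bs x) \<partial>?M)" for m
    proof -
      have "integrable ?M (\<lambda>x. w (r m) x * (p x * q x * basis_monomial bs x))" if "real_polynomial_function p" for p
        using add.prems C1_continuous[OF C1_real_polynomial_function[OF that]]
        by (intro integrable_mult_continuous S w continuous_on_mult continuous_on_basis_monomial)
      from Bochner_Integration.integral_add[OF this[OF add.hyps(1)] this[OF add.hyps(2)], symmetric]
      show ?thesis by (simp add: algebra_simps)
    qed
    thus ?case using add by (simp add: convergent_add)
  next
    case (mult p1 p2)
    have "?conv (\<lambda>x. p1 x * (p2 x * q x) * basis_monomial bs x)"
    proof (rule mult.IH(1))
      show "continuous_on (closure S) (\<lambda>x. p2 x * q x)"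
        using mult.prems(1) C1_continuous[OF C1_real_polynomial_function[OF mult.hyps(2)]]
        by (intro continuous_on_mult)
      fix bs :: "'a list" assume "set bs \<subseteq> Basis"
      thus "?conv (\<lambda>x. p2 x * q x * basis_monomial bs x)" using mult.prems(1,2) by (intro mult.IH(2))
    qed fact
    thus ?case by (simp add: mult_ac)
  qed
  have poly: "?conv p" if "real_polynomial_function p" for p
    using step[OF that, of "\<lambda>x. 1" "[]"] mono by (simp add: basis_monomial_def[of "[]"])
  have "?conv g" if g: "continuous_on (closure S) g" for g
  proof (rule Cauchy_convergent, rule metric_CauchyI)
    fix e :: real assume e: "e > 0"
    define d where "d = e / (3 * (\<bar>C\<bar> + 1))"
    have d: "d > 0" "d * \<bar>C\<bar> < e / 3" using e by (auto simp: d_def field_simps)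
    obtain p where p: "real_polynomial_function p" and pg: "\<And>x. x \<in> closure S \<Longrightarrow> \<bar>g x - p x\<bar> < d"
      using Stone_Weierstrass_real_polynomial_function[OF _ g d(1)] S by (metis compact_closure)
    obtain N where N: "\<And>m n. m \<ge> N \<Longrightarrow> n \<ge> N \<Longrightarrow>
        \<bar>(\<integral>x. w (r m) x * p x \<partial>?M) - (\<integral>x. w (r n) x * p x \<partial>?M)\<bar> < e / 3"
      using convergent_Cauchy[OF poly[OF p]] e by (force dest!: metric_CauchyD[where e="e/3"] simp: dist_real_def)
    have close: "\<bar>(\<integral>x. w (r m) x * g x \<partial>?M) - (\<integral>x. w (r m) x * p x \<partial>?M)\<bar> < e / 3" for m
    proof -
      have "integrable ?M (\<lambda>x. w (r m) x * g x)" "integrable ?M (\<lambda>x. w (r m) x * p x)"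
        using g p by (auto intro!: integrable_mult_continuous S w C1_continuous C1_real_polynomial_function)
      moreover have "\<bar>\<integral>x. w (r m) x * (g x - p x) \<partial>?M\<bar> \<le> d * (\<integral>x. \<bar>w (r m) x\<bar> \<partial>?M)"
        using pg closure_subset[of S] by (intro integral_mult_bound w) (auto intro: less_imp_le)
      moreover have "d * (\<integral>x. \<bar>w (r m) x\<bar> \<partial>?M) \<le> d * \<bar>C\<bar>" using C[of "r m"] d by (intro mult_left_mono) auto
      ultimately show ?thesis using d(2) by (simp add: right_diff_distrib)
    qed
    have "dist (\<integral>x. w (r m) x * g x \<partial>?M) (\<integral>x. w (r n) x * g x \<partial>?M) < e" if "m \<ge> N" "n \<ge> N" for m n
      using close[of m] close[of n] N[OF that] unfolding dist_real_def by linarith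
    thus "\<exists>N. \<forall>m\<ge>N. \<forall>n\<ge>N. dist (\<integral>x. w (r m) x * g x \<partial>?M) (\<integral>x. w (r n) x * g x \<partial>?M) < e" by blast
  qed
  thus ?thesis using that r by blast
qed

section \<open>Test functions with compact support and the total variation\<close>

text \<open>Squaring removes the kink of the positive part; at the origin the difference quotient is
  bounded by \<open>\<bar>h\<bar>\<close>.\<close>

lemma has_real_derivative_max0_sq: "((\<lambda>t::real. (max 0 t)\<^sup>2) has_real_derivative 2 * max 0 s) (at s)"
proof -
  consider "s > 0" | "s < 0" | "s = 0" by linarith
  thus ?thesis
  proof cases
    case 1
    have "((\<lambda>t. t\<^sup>2) has_real_derivative 2 * max 0 s) (at s)"
      using 1 by (auto intro!: derivative_eq_intros)
    thus ?thesis by (rule DERIV_cong_ev[THEN iffD1, rotated 3, OF _ refl _ refl])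
       (use 1 eventually_nhds_in_open[of "{0<..}" s] in \<open>auto elim!: eventually_mono\<close>)
  next
    case 2
    have "((\<lambda>t. 0) has_real_derivative 2 * max 0 s) (at s)" using 2 by simp
    thus ?thesis by (rule DERIV_cong_ev[THEN iffD1, rotated 3, OF _ refl _ refl])
       (use 2 eventually_nhds_in_open[of "{..<0}" s] in \<open>auto elim!: eventually_mono\<close>)
  next
    case 3
    have "(\<lambda>h::real. ((max 0 h)\<^sup>2) / h) \<midarrow>0\<rightarrow> 0"
    proof (rule tendsto_rabs_zero_cancel, rule tendsto_sandwich[of "\<lambda>_. 0" _ _ "\<lambda>h. \<bar>h\<bar>"])
      show "\<forall>\<^sub>F h in at 0. \<bar>(max 0 h)\<^sup>2 / h\<bar> \<le> \<bar>h::real\<bar>"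
        by (intro always_eventually) (auto simp: max_def power2_eq_square)
    qed (auto intro!: tendsto_eq_intros)
    thus ?thesis using 3 by (simp add: DERIV_def)
  qed
qed

text \<open>A \<open>C\<^sup>1\<close> variant of soft thresholding: \<open>s \<mapsto> s \<cdot> smooth_gate \<delta> (s\<^sup>2 - \<delta>\<^sup>2)\<close> vanishes for \<open>\<bar>s\<bar> \<le> \<delta>\<close>
  and stays within \<open>2 \<delta>\<close> of the identity.\<close>

definition smooth_gate :: "real \<Rightarrow> real \<Rightarrow> real" where
  "smooth_gate \<delta> t = (max 0 t)\<^sup>2 / ((max 0 t)\<^sup>2 + \<delta>^4)"

lemma smooth_gate_denom: "\<delta> > 0 \<Longrightarrow> (max 0 t)\<^sup>2 + \<delta>^4 > (0::real)"
  by (intro add_nonneg_pos) auto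

lemma C1_smooth_gate:
  assumes "\<delta> > 0" "C1 f" shows "C1 (\<lambda>x. smooth_gate \<delta> (f x))"
proof (rule C1_comp[OF assms(2), where g'="\<lambda>t. 2 * max 0 t * \<delta>^4 / ((max 0 t)\<^sup>2 + \<delta>^4)\<^sup>2"])
  fix s :: real
  have nz: "(max 0 s)\<^sup>2 + \<delta>^4 \<noteq> 0" using smooth_gate_denom[OF assms(1), of s] by linarith
  show "(smooth_gate \<delta> has_real_derivative 2 * max 0 s * \<delta>^4 / ((max 0 s)\<^sup>2 + \<delta>^4)\<^sup>2) (at s)"
    unfolding smooth_gate_def[abs_def]
    by (rule DERIV_cong[OF DERIV_divide[OF has_real_derivative_max0_sq DERIV_add[OF has_real_derivative_max0_sq DERIV_const] nz]])
       (simp add: algebra_simps power2_eq_square)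
next
  show "continuous_on UNIV (\<lambda>t. 2 * max 0 t * \<delta> ^ 4 / ((max 0 t)\<^sup>2 + \<delta> ^ 4)\<^sup>2)"
    using smooth_gate_denom[OF assms(1)] by (intro continuous_intros) (auto simp: less_le)
qed

lemma smooth_gate_eq_0: "t \<le> 0 \<Longrightarrow> smooth_gate \<delta> t = 0"
  by (simp add: smooth_gate_def max_def)

text \<open>With \<open>q\<close> the squared positive part, the error is
  \<open>\<bar>s\<bar> * \<delta>^4 / (q + \<delta>^4)\<close>. For
  \<open>\<bar>s\<bar> \<le> 2 * \<delta>\<close> the quotient is at most \<open>1\<close>; beyond
  that, \<open>q\<close> is at least \<open>9/16 * \<bar>s\<bar>^4\<close>, and three of the four
  factors \<open>\<delta>\<close> are traded for \<open>\<bar>s\<bar> / 2\<close>.\<close>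

lemma smooth_threshold_close:
  assumes \<delta>: "\<delta> > 0"
  shows "\<bar>s - s * smooth_gate \<delta> (s\<^sup>2 - \<delta>\<^sup>2)\<bar> \<le> 2 * \<delta>"
proof -
  let ?q = "(max 0 (s\<^sup>2 - \<delta>\<^sup>2))\<^sup>2"
  have d: "?q + \<delta>^4 > 0" by (rule smooth_gate_denom[OF \<delta>])
  have "s - s * smooth_gate \<delta> (s\<^sup>2 - \<delta>\<^sup>2) = s * (\<delta>^4 / (?q + \<delta>^4))"
    using d unfolding smooth_gate_def by (simp add: field_simps)
  hence eq: "\<bar>s - s * smooth_gate \<delta> (s\<^sup>2 - \<delta>\<^sup>2)\<bar> = \<bar>s\<bar> * (\<delta>^4 / (?q + \<delta>^4))"
    using d by (simp add: abs_mult)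
  show ?thesis
  proof (cases "\<bar>s\<bar> \<le> 2 * \<delta>")
    case True
    have "\<delta>^4 / (?q + \<delta>^4) \<le> 1" using d by (simp add: field_simps)
    hence "\<bar>s\<bar> * (\<delta>^4 / (?q + \<delta>^4)) \<le> \<bar>s\<bar> * 1" by (intro mult_left_mono) auto
    thus ?thesis using True eq by linarith
  next
    case False
    hence s: "\<bar>s\<bar> > 2 * \<delta>" by simp
    have "s\<^sup>2 \<ge> (2 * \<delta>)\<^sup>2" using s \<delta> by (metis abs_ge_zero abs_of_pos less_eq_real_def mult_2 add_pos_pos power2_abs power_mono)
    hence "s\<^sup>2 - \<delta>\<^sup>2 \<ge> 3/4 * s\<^sup>2" by simp
    hence "3/4 * s\<^sup>2 \<le> max 0 (s\<^sup>2 - \<delta>\<^sup>2)" by linarith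
    hence "(3/4 * s\<^sup>2)\<^sup>2 \<le> ?q" by (intro power_mono) auto
    hence q: "9/16 * \<bar>s\<bar>^4 \<le> ?q" by (simp add: power_mult_distrib power_divide)
    have "\<bar>s\<bar> * \<delta>^4 = \<bar>s\<bar> * \<delta>^3 * \<delta>" by (simp add: eval_nat_numeral)
    also have "\<dots> \<le> \<bar>s\<bar> * (\<bar>s\<bar>/2)^3 * \<delta>" using s \<delta> by (intro mult_right_mono mult_left_mono power_mono) auto
    also have "\<dots> = \<delta> * (1/8 * \<bar>s\<bar>^4)" by (simp add: eval_nat_numeral)
    also have "\<dots> \<le> \<delta> * ?q"
    proof (rule mult_left_mono)
      have "\<bar>s\<bar>^4 \<ge> 0" by simp
      thus "1/8 * \<bar>s\<bar>^4 \<le> ?q" using q by linarith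
    qed (use \<delta> in simp)
    also have "\<dots> \<le> 2 * \<delta> * (?q + \<delta>^4)" using \<delta> by (simp add: algebra_simps)
    finally show ?thesis unfolding eq using d by (simp add: field_simps)
  qed
qed

text \<open>\<open>U\<close> and the complement of \<open>K\<close> form an open cover. On the
  overlap \<open>f\<close> vanishes on an open set, so its derivative vanishes too and the two local
  derivatives glue continuously.\<close>

lemma C1_extend_by_zero:
  assumes f: "C1 f" and "open U" "closed K" "K \<subseteq> U" and 0: "\<And>x. x \<in> U - K \<Longrightarrow> f x = 0"
  shows "C1 (\<lambda>x. if x \<in> U then f x else 0)"
proof -
  obtain f' where f': "has_C1_deriv f f'" using f by (auto simp: C1_def)
  define g' where "g' x = (if x \<in> U then f' x else 0)" for x
  have un: "U \<union> - K = UNIV" using assms by auto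
  have opn: "open (U - K)" "open (- K)" using assms by auto
  have z: "f' x = 0" if x: "x \<in> U - K" for x
  proof -
    have "(f has_derivative (\<lambda>v. 0)) (at x)"
      by (rule has_derivative_transform_within_open[OF has_derivative_const[of 0] opn(1) x]) (simp add: 0)
    from has_derivative_unique[OF this has_C1_deriv_derivative[OF f']]
    show ?thesis by (intro blinfun_eqI) (metis zero_blinfun.rep_eq)
  qed
  have "continuous_on (U \<union> - K) g'"
  proof (rule continuous_on_open_Un)
    show "continuous_on U g'"
      by (rule continuous_on_eq[OF has_C1_deriv_continuous(2)[OF f']]) (simp add: g'_def)
    show "continuous_on (- K) g'"
      by (rule continuous_on_eq[OF continuous_on_const[of _ 0]]) (auto simp: g'_def z)
  qed (use assms in auto)
  moreover have "((\<lambda>x. if x \<in> U then f x else 0) has_derivative blinfun_apply (g' x)) (at x)" for x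
  proof (cases "x \<in> U")
    case True
    thus ?thesis unfolding g'_def
      using has_derivative_transform_within_open[OF has_C1_deriv_derivative[OF f', of x] \<open>open U\<close> True] by simp
  next
    case False
    hence "x \<in> - K" using un by auto
    from has_derivative_transform_within_open[OF has_derivative_const[of 0] opn(2) this, of "\<lambda>x. if x \<in> U then f x else 0"]
    show ?thesis using False 0 by (simp add: g'_def zero_blinfun.rep_eq)
  qed
  ultimately show ?thesis unfolding un by (auto simp: C1_def has_C1_deriv_def)
qed

text \<open>A uniformly close polynomial is smooth but has no compact support. Where
  \<open>f\<close> is small the polynomial is at most \<open>\<delta>\<close> in modulus, and the
  soft threshold sends such values to \<open>0\<close>, so the result vanishes on \<open>U\<close>
  outside a compact set and extends by zero.\<close>

lemma C1_compact_support_approx: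
  fixes U :: "'a::euclidean_space set"
  assumes "bounded U" "open U" and f: "continuous_on U f"
    and f0: "\<And>\<epsilon>. \<epsilon> > 0 \<Longrightarrow> \<exists>K. compact K \<and> K \<subseteq> U \<and> (\<forall>x\<in>U - K. \<bar>f x\<bar> < \<epsilon>)" and "\<epsilon> > 0"
  obtains \<psi> K where "C1 \<psi>" "compact K" "K \<subseteq> U" "\<And>x. x \<notin> K \<Longrightarrow> \<psi> x = 0" "\<And>x. x \<in> U \<Longrightarrow> \<bar>\<psi> x - f x\<bar> \<le> \<epsilon>"
proof -
  \<comment> \<open>One \<open>\<delta>\<close> pays for the polynomial approximation and two for
    the threshold.\<close>
  define \<delta> where "\<delta> = \<epsilon> / 3"
  have \<delta>: "\<delta> > 0" using \<open>\<epsilon> > 0\<close> by (simp add: \<delta>_def)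
  \<comment> \<open>Smallness of \<open>f\<close> off compact subsets of \<open>U\<close> is exactly
    what makes the extension by zero continuous at the boundary.\<close>
  define F where "F x = (if x \<in> U then f x else 0)" for x
  have "isCont F x" for x
  proof (cases "x \<in> U")
    case True
    have "continuous_on U F" by (rule continuous_on_eq[OF f]) (simp add: F_def)
    thus ?thesis using True \<open>open U\<close> continuous_on_eq_continuous_at by blast
  next
    case False
    have "(F \<longlongrightarrow> 0) (at x)"
    proof (rule tendstoI)
      fix e :: real assume "e > 0"
      then obtain K where K: "compact K" "K \<subseteq> U" "\<forall>x\<in>U - K. \<bar>f x\<bar> < e" using f0 by blast
      hence "\<forall>\<^sub>F z in at x. z \<in> - K"
        using False by (intro eventually_at_in_open') (auto intro: compact_imp_closed)
      thus "\<forall>\<^sub>F z in at x. dist (F z) 0 < e"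
        using K \<open>e > 0\<close> by (auto simp: F_def elim!: eventually_mono)
    qed
    thus ?thesis using False by (simp add: isCont_def F_def)
  qed
  hence "continuous_on (closure U) F" by (simp add: continuous_at_imp_continuous_on)
  then obtain p where p: "real_polynomial_function p" and pF: "\<And>x. x \<in> closure U \<Longrightarrow> \<bar>F x - p x\<bar> < \<delta> / 2"
    using Stone_Weierstrass_real_polynomial_function[of "closure U" F "\<delta> / 2"] \<open>bounded U\<close> \<delta> by auto
  obtain K where K: "compact K" "K \<subseteq> U" "\<And>x. x \<in> U - K \<Longrightarrow> \<bar>f x\<bar> < \<delta> / 2" using f0[of "\<delta> / 2"] \<delta> by auto
  define g where "g x = p x * smooth_gate \<delta> ((p x)\<^sup>2 - \<delta>\<^sup>2)" for x
  have "C1 (\<lambda>x. p x * p x + - \<delta>\<^sup>2)"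
    using p by (intro C1_add C1_mult C1_real_polynomial_function C1_const)
  hence "C1 (\<lambda>x. (p x)\<^sup>2 - \<delta>\<^sup>2)" by (simp add: power2_eq_square)
  hence g: "C1 g" unfolding g_def[abs_def] using p \<delta>
    by (intro C1_mult[OF C1_real_polynomial_function] C1_smooth_gate)
  have px: "\<bar>f x - p x\<bar> < \<delta> / 2" if "x \<in> U" for x
    using pF[of x] that closure_subset[of U] by (auto simp: F_def)
  have g0: "g x = 0" if "x \<in> U - K" for x
  proof -
    have "\<bar>f x\<bar> < \<delta> / 2" "\<bar>f x - p x\<bar> < \<delta> / 2" using K(3)[OF that] px[of x] that by auto
    hence "\<bar>p x\<bar> \<le> \<delta>" by linarith
    hence "(p x)\<^sup>2 \<le> \<delta>\<^sup>2" using \<delta> by (simp add: abs_le_square_iff[symmetric])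
    thus ?thesis by (simp add: g_def smooth_gate_eq_0)
  qed
  show ?thesis
  proof (rule that[of "\<lambda>x. if x \<in> U then g x else 0" K])
    show "C1 (\<lambda>x. if x \<in> U then g x else 0)"
      by (rule C1_extend_by_zero[OF g \<open>open U\<close> compact_imp_closed[OF K(1)] K(2) g0])
    show "\<bar>(if x \<in> U then g x else 0) - f x\<bar> \<le> \<epsilon>" if "x \<in> U" for x
    proof -
      have "\<bar>p x - g x\<bar> \<le> 2 * \<delta>" using smooth_threshold_close[OF \<delta>] by (simp add: g_def)
      hence "\<bar>g x - f x\<bar> \<le> 3 * \<delta>" using px[OF that] \<delta> by linarith
      thus ?thesis using that by (simp add: \<delta>_def)
    qed
  qed (use K g0 in auto)
qed

text \<open>The distance to the complement is continuous, tends to zero at the boundary and is at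
  least some \<open>m > 0\<close> on \<open>K\<close>; an approximation within \<open>m / 2\<close>
  keeps half of it. A positive lower bound on \<open>K\<close>, instead of the value
  \<open>1\<close>, suffices for recovering the mass on \<open>K\<close>.\<close>

lemma C1_cutoff:
  fixes U :: "'a::euclidean_space set"
  assumes "bounded U" "open U" "compact K" "K \<subseteq> U"
  obtains \<kappa> K' c where "C1 \<kappa>" "compact K'" "K' \<subseteq> U" "\<And>x. x \<notin> K' \<Longrightarrow> \<kappa> x = 0" "c > 0" "\<And>x. x \<in> K \<Longrightarrow> \<bar>\<kappa> x\<bar> \<ge> (c::real)"
proof -
  let ?f = "\<lambda>x. infdist x (- U)"
  \<comment> \<open>The complement has to be nonempty, since \<open>infdist\<close> to the empty set
    is \<open>0\<close> by convention.\<close>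
  have "U \<noteq> UNIV" using \<open>bounded U\<close> not_bounded_UNIV[where 'a='a] by metis
  hence ne: "- U \<noteq> {}" by auto
  have cl: "closed (- U)" using \<open>open U\<close> by (simp add: closed_def)
  have pos: "?f x > 0" if "x \<in> U" for x
    using that by (intro infdist_pos_not_in_closed cl ne) auto
  obtain m where m: "m > 0" "\<And>x. x \<in> K \<Longrightarrow> ?f x \<ge> m"
  proof (cases "K = {}")
    case False
    have "continuous_on K ?f" by (intro continuous_intros)
    then obtain z where "z \<in> K" "\<And>x. x \<in> K \<Longrightarrow> ?f z \<le> ?f x"
      using continuous_attains_inf[OF \<open>compact K\<close> False] by blast
    thus ?thesis using that pos \<open>K \<subseteq> U\<close> by blast
  qed (use that[of 1] in auto)
  have co: "continuous_on U ?f" by (intro continuous_intros)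
  have ex: "\<exists>K. compact K \<and> K \<subseteq> U \<and> (\<forall>x\<in>U - K. \<bar>?f x\<bar> < e)" if "e > 0" for e
  proof (intro exI conjI)
    have "closed {x. e \<le> ?f x}" by (intro closed_Collect_le continuous_intros)
    moreover have sub: "{x. e \<le> ?f x} \<subseteq> U"
    proof
      fix x assume "x \<in> {x. e \<le> ?f x}"
      hence "?f x \<noteq> 0" using that by auto
      thus "x \<in> U" by (metis ComplI infdist_zero)
    qed
    ultimately show "compact {x. e \<le> ?f x}" "{x. e \<le> ?f x} \<subseteq> U"
      using bounded_subset[OF \<open>bounded U\<close>] by (auto simp: compact_eq_bounded_closed)
  qed (auto simp: infdist_nonneg)
  have "m / 2 > 0" using m by simp
  from C1_compact_support_approx[OF assms(1,2) co ex this]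
  obtain \<kappa> K' where \<kappa>: "C1 \<kappa>" "compact K'" "K' \<subseteq> U" "\<And>x. x \<notin> K' \<Longrightarrow> \<kappa> x = 0"
      "\<And>x. x \<in> U \<Longrightarrow> \<bar>\<kappa> x - ?f x\<bar> \<le> m / 2" by blast
  have "\<bar>\<kappa> x\<bar> \<ge> m / 2" if "x \<in> K" for x
  proof -
    have "x \<in> U" using that assms(4) by auto
    from \<kappa>(5)[OF this] m(2)[OF that] show ?thesis by linarith
  qed
  thus ?thesis using that[OF \<kappa>(1-4) \<open>m / 2 > 0\<close>] by blast
qed

section \<open>Vector test fields, divergence and total variation\<close>

lemma Cc1_vec_lambdaI:
  fixes \<psi> :: "'n::finite \<Rightarrow> real^'n \<Rightarrow> real"
  assumes "\<And>i. C1 (\<psi> i)" "compact K" "K \<subseteq> U" "\<And>i x. x \<notin> K \<Longrightarrow> \<psi> i x = 0"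
  shows "(\<lambda>x. \<chi> i. \<psi> i x) \<in> Cc1 U"
    and "divergence (\<lambda>x. \<chi> i. \<psi> i x) x = (\<Sum>i\<in>UNIV. frechet_derivative (\<psi> i) (at x) (axis i 1))"
proof -
  obtain \<psi>' where \<psi>': "\<And>i. has_C1_deriv (\<psi> i) (\<psi>' i)" using assms(1) unfolding C1_def by metis
  have der: "((\<lambda>x. \<chi> i. \<psi> i x) has_derivative (\<lambda>v. \<chi> i. \<psi>' i x v)) (at x)" for x
    by (subst has_derivative_componentwise_within)
       (auto simp: Basis_vec_def inner_axis intro!: has_C1_deriv_derivative[OF \<psi>'])
  have eq: "frechet_derivative (\<lambda>x. \<chi> i. \<psi> i x) (at x) = (\<lambda>v. \<chi> i. \<psi>' i x v)" for x
    by (rule frechet_derivative_at[OF der, symmetric])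
  show "(\<lambda>x. \<chi> i. \<psi> i x) \<in> Cc1 U"
    unfolding Cc1_def mem_Collect_eq
  proof (intro conjI allI exI[of _ K] impI)
    show "(\<lambda>x. \<chi> i. \<psi> i x) differentiable at x" for x using der differentiableI by blast
    show "continuous_on UNIV (\<lambda>x. frechet_derivative (\<lambda>x. \<chi> i. \<psi> i x) (at x) v)" for v
      unfolding eq by (intro continuous_intros has_C1_deriv_continuous(2)[OF \<psi>'] blinfun.continuous_on)
  qed (use assms in \<open>auto simp: vec_eq_iff\<close>)
  show "divergence (\<lambda>x. \<chi> i. \<psi> i x) x = (\<Sum>i\<in>UNIV. frechet_derivative (\<psi> i) (at x) (axis i 1))"
    unfolding divergence_def eq by (simp add: has_C1_deriv_frechet[OF \<psi>'])
qed

lemma continuous_on_divergence: "\<phi> \<in> Cc1 U \<Longrightarrow> continuous_on S (divergence \<phi>)"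
  unfolding divergence_def[abs_def] Cc1_def
  by (intro continuous_intros) (auto intro: continuous_on_subset)

lemma divergence_lincomb:
  assumes "\<phi> \<in> Cc1 U" "\<psi> \<in> Cc1 U"
  shows "(\<lambda>x. a *\<^sub>R \<phi> x + b *\<^sub>R \<psi> x) \<in> Cc1 U"
    and "divergence (\<lambda>x. a *\<^sub>R \<phi> x + b *\<^sub>R \<psi> x) x = a * divergence \<phi> x + b * divergence \<psi> x"
proof -
  have d: "(\<phi> has_derivative frechet_derivative \<phi> (at x)) (at x)" "(\<psi> has_derivative frechet_derivative \<psi> (at x)) (at x)" for x
    using assms by (auto simp: Cc1_def frechet_derivative_works[symmetric])
  have der: "((\<lambda>x. a *\<^sub>R \<phi> x + b *\<^sub>R \<psi> x) has_derivative
      (\<lambda>v. a *\<^sub>R frechet_derivative \<phi> (at x) v + b *\<^sub>R frechet_derivative \<psi> (at x) v)) (at x)" for x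
    by (intro has_derivative_add has_derivative_scaleR_right d)
  have eq: "frechet_derivative (\<lambda>x. a *\<^sub>R \<phi> x + b *\<^sub>R \<psi> x) (at x) =
      (\<lambda>v. a *\<^sub>R frechet_derivative \<phi> (at x) v + b *\<^sub>R frechet_derivative \<psi> (at x) v)" for x
    by (rule frechet_derivative_at[OF der, symmetric])
  obtain K1 K2 where K: "compact K1" "K1 \<subseteq> U" "\<forall>x. x \<notin> K1 \<longrightarrow> \<phi> x = 0" "compact K2" "K2 \<subseteq> U" "\<forall>x. x \<notin> K2 \<longrightarrow> \<psi> x = 0"
    using assms unfolding Cc1_def by blast
  show "(\<lambda>x. a *\<^sub>R \<phi> x + b *\<^sub>R \<psi> x) \<in> Cc1 U"
    unfolding Cc1_def mem_Collect_eq
  proof (intro conjI allI exI[of _ "K1 \<union> K2"] impI)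
    show "(\<lambda>x. a *\<^sub>R \<phi> x + b *\<^sub>R \<psi> x) differentiable at x" for x using der differentiableI by blast
    show "continuous_on UNIV (\<lambda>x. frechet_derivative (\<lambda>x. a *\<^sub>R \<phi> x + b *\<^sub>R \<psi> x) (at x) v)" for v
      unfolding eq using assms by (intro continuous_intros) (auto simp: Cc1_def)
  qed (use K in auto)
  show "divergence (\<lambda>x. a *\<^sub>R \<phi> x + b *\<^sub>R \<psi> x) x = a * divergence \<phi> x + b * divergence \<psi> x"
    unfolding divergence_def eq by (simp add: sum.distrib sum_distrib_left)
qed

lemma zero_in_Cc1: "(\<lambda>x. 0) \<in> Cc1 U"
  by (auto simp: Cc1_def intro!: exI[of _ "{}"])

lemma tv_nonneg: fixes U :: "(real^'n) set" shows "tv U u \<ge> 0"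
proof -
  have "divergence (\<lambda>x. 0) x = 0" for x :: "real^'n" by (simp add: divergence_def)
  hence "ereal 0 = ereal (\<integral>x. u x * divergence (\<lambda>x. 0) x \<partial>lebesgue_on U)" by simp
  thus ?thesis unfolding tv_def zero_ereal_def by (intro SUP_upper2[of "\<lambda>x. 0"]) (auto simp: zero_in_Cc1)
qed

text \<open>Homogeneity of the pairing in the field, applied to both signs. Since \<open>B\<close>
  may be \<open>0\<close>, the field is scaled by \<open>1 / t\<close> with \<open>t\<close>
  slightly above \<open>B\<close>, and the excess is removed at the end.\<close>

lemma tv_bound:
  assumes tv: "tv U u \<le> ereal M" and \<phi>: "\<phi> \<in> Cc1 U" and B: "\<And>x. norm (\<phi> x) \<le> B"
  shows "\<bar>\<integral>x. u x * divergence \<phi> x \<partial>lebesgue_on U\<bar> \<le> M * B"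
proof -
  let ?I = "\<integral>x. u x * divergence \<phi> x \<partial>lebesgue_on U"
  have B0: "B \<ge> 0" using B[of 0] norm_ge_zero order_trans by blast
  have M0: "M \<ge> 0" using order_trans[OF tv_nonneg tv] by simp
  have 1: "c * ?I \<le> M" if c: "\<bar>c\<bar> * B \<le> 1" for c
  proof -
    have mem: "(\<lambda>x. c *\<^sub>R \<phi> x + 0 *\<^sub>R \<phi> x) \<in> Cc1 U" using divergence_lincomb(1)[OF \<phi> \<phi>] .
    have "norm (c *\<^sub>R \<phi> x + 0 *\<^sub>R \<phi> x) \<le> 1" for x
      using order_trans[OF mult_left_mono[OF B[of x], of "\<bar>c\<bar>"] c] by simp
    hence "ereal (\<integral>x. u x * divergence (\<lambda>x. c *\<^sub>R \<phi> x + 0 *\<^sub>R \<phi> x) x \<partial>lebesgue_on U) \<le> tv U u"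
      unfolding tv_def using mem by (intro SUP_upper) auto
    also have "(\<integral>x. u x * divergence (\<lambda>x. c *\<^sub>R \<phi> x + 0 *\<^sub>R \<phi> x) x \<partial>lebesgue_on U) = c * ?I"
      unfolding divergence_lincomb(2)[OF \<phi> \<phi>] by (simp add: mult.left_commute)
    finally show ?thesis using tv by (metis ereal_less_eq(3) order_trans)
  qed
  show ?thesis
  proof (rule field_le_epsilon)
    fix e :: real assume e: "e > 0"
    define t where "t = B + e / (M + 1)"
    have "B \<le> t" using M0 e by (simp add: t_def)
    moreover have t: "t > 0" using B0 M0 e by (auto simp: t_def intro!: add_nonneg_pos)
    ultimately have t': "B / t \<le> 1" by simp
    have "M * t = M * B + e * (M / (M + 1))" using M0 by (simp add: t_def field_simps)
    also have "\<dots> \<le> M * B + e * 1" using M0 e by (intro add_left_mono mult_left_mono) auto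
    finally have Mt: "M * t \<le> M * B + e" by simp
    have "(1 / t) * ?I \<le> M" "(- 1 / t) * ?I \<le> M" using t t' 1[of "1 / t"] 1[of "- 1 / t"] by auto
    hence "\<bar>?I\<bar> \<le> M * t" using t by (auto simp: field_simps abs_le_iff)
    thus "\<bar>?I\<bar> \<le> M * B + e" using Mt by linarith
  qed
qed

lemma tv_leI:
  "(\<And>\<phi>. \<phi> \<in> Cc1 U \<Longrightarrow> (\<And>x. norm (\<phi> x) \<le> 1) \<Longrightarrow> (\<integral>x. u x * divergence \<phi> x \<partial>lebesgue_on U) \<le> M) \<Longrightarrow> tv U u \<le> ereal M"
  unfolding tv_def by (intro SUP_least) auto

lemma norm_axis_eq: "norm (axis i x :: real^'n) = \<bar>x\<bar>"
  by (simp add: norm_eq_sqrt_inner inner_axis_axis real_sqrt_mult_self)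

text \<open>The field whose only nonzero component is \<open>f\<close>, in the direction
  \<open>b\<close>, has the partial derivative of \<open>f\<close> as its divergence.\<close>

lemma tv_partial_bound:
  fixes u :: "real^'n \<Rightarrow> real"
  assumes tv: "tv U u \<le> ereal M" and f: "C1 f" "compact K" "K \<subseteq> U" "\<And>x. x \<notin> K \<Longrightarrow> f x = 0" "\<And>x. \<bar>f x\<bar> \<le> B"
    and b: "b \<in> Basis"
  shows "\<bar>\<integral>x. u x * frechet_derivative f (at x) b \<partial>lebesgue_on U\<bar> \<le> M * B"
proof -
  obtain j where j: "b = axis j 1" using b by (auto simp: Basis_vec_def)
  define \<psi> where "\<psi> i x = (if i = j then f x else 0)" for i x
  have \<psi>: "C1 (\<psi> i)" "\<And>x. x \<notin> K \<Longrightarrow> \<psi> i x = 0" for i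
    using f by (cases "i = j"; simp add: \<psi>_def[abs_def] C1_const)+
  have "(\<chi> i. \<psi> i x) = axis j (f x)" for x by (simp add: \<psi>_def axis_def vec_eq_iff)
  hence n: "norm (\<chi> i. \<psi> i x) \<le> B" for x using f(5) by (simp add: norm_axis_eq)
  have d: "divergence (\<lambda>x. \<chi> i. \<psi> i x) x = frechet_derivative f (at x) b" for x
  proof -
    have "frechet_derivative (\<psi> i) (at x) (axis i 1) = (if i = j then frechet_derivative f (at x) b else 0)" for i
      by (cases "i = j") (simp_all add: \<psi>_def[abs_def] j)
    thus ?thesis by (simp add: Cc1_vec_lambdaI(2)[OF \<psi>(1) f(2,3) \<psi>(2)])
  qed
  show ?thesis using tv_bound[OF tv Cc1_vec_lambdaI(1)[OF \<psi>(1) f(2,3) \<psi>(2)] n] by (simp add: d)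
qed

text \<open>By the product rule, \<open>\<kappa>\<close> times the derivative of \<open>f\<close> is
  the derivative of \<open>\<kappa> * f\<close> minus \<open>f\<close> times the derivative of
  \<open>\<kappa>\<close>. The first has compact support in \<open>U\<close> and is seen by the
  total variation; the second is bounded. Hence \<open>f\<close> itself is free of any support
  condition.\<close>

lemma cutoff_BV_bound:
  fixes u :: "real^'n \<Rightarrow> real"
  assumes U: "bounded U" "open U" and u: "integrable (lebesgue_on U) u" "tv U u \<le> ereal M"
    and \<kappa>: "C1 \<kappa>" "compact K" "K \<subseteq> U" "\<And>x. x \<notin> K \<Longrightarrow> \<kappa> x = 0"
    and c: "\<And>x. \<bar>\<kappa> x\<bar> \<le> c0" "\<And>x b. x \<in> U \<Longrightarrow> b \<in> Basis \<Longrightarrow> \<bar>frechet_derivative \<kappa> (at x) b\<bar> \<le> c1"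
    and f: "C1 f" "\<And>x. \<bar>f x\<bar> \<le> B" "b \<in> Basis"
  shows "\<bar>\<integral>x. (u x * \<kappa> x) * frechet_derivative f (at x) b \<partial>lebesgue_on U\<bar>
     \<le> (M * c0 + c1 * (\<integral>x. \<bar>u x\<bar> \<partial>lebesgue_on U)) * B"
proof -
  let ?M = "lebesgue_on U"
  have meas: "U \<in> sets lebesgue" using U by auto
  have B: "B \<ge> 0" using f(2)[of 0] by linarith
  have i: "integrable ?M (\<lambda>x. u x * (f x * frechet_derivative \<kappa> (at x) b))"
      "integrable ?M (\<lambda>x. u x * (\<kappa> x * frechet_derivative f (at x) b))"
    by (rule integrable_mult_continuous[OF U(1) meas u(1)] continuous_on_mult
        C1_continuous[OF f(1)] C1_continuous[OF \<kappa>(1)] C1_continuous_derivative \<kappa>(1) f(1))+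
  have "(\<integral>x. u x * frechet_derivative (\<lambda>x. \<kappa> x * f x) (at x) b \<partial>?M) =
     (\<integral>x. u x * (\<kappa> x * frechet_derivative f (at x) b) \<partial>?M) + (\<integral>x. u x * (f x * frechet_derivative \<kappa> (at x) b) \<partial>?M)"
    unfolding frechet_derivative_C1_mult[OF \<kappa>(1) f(1)]
    by (subst Bochner_Integration.integral_add[OF i(2,1), symmetric]) (simp add: algebra_simps)
  moreover have "\<bar>\<integral>x. u x * frechet_derivative (\<lambda>x. \<kappa> x * f x) (at x) b \<partial>?M\<bar> \<le> M * (c0 * B)"
    using c(1) f(2) \<kappa>(4) by (intro tv_partial_bound[OF u(2) C1_mult[OF \<kappa>(1) f(1)] \<kappa>(2,3) _ _ f(3)])
      (auto simp: abs_mult intro!: mult_mono order_trans[OF abs_ge_zero])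
  moreover have "\<bar>\<integral>x. u x * (f x * frechet_derivative \<kappa> (at x) b) \<partial>?M\<bar> \<le> (c1 * B) * (\<integral>x. \<bar>u x\<bar> \<partial>?M)"
  proof (rule integral_mult_bound[OF u(1)])
    fix x assume "x \<in> U"
    hence "\<bar>f x\<bar> * \<bar>frechet_derivative \<kappa> (at x) b\<bar> \<le> B * c1" using c(2) f B by (intro mult_mono) auto
    thus "\<bar>f x * frechet_derivative \<kappa> (at x) b\<bar> \<le> c1 * B" by (simp add: abs_mult mult.commute)
  qed
  ultimately have "\<bar>\<integral>x. u x * (\<kappa> x * frechet_derivative f (at x) b) \<partial>?M\<bar> \<le> M * (c0 * B) + (c1 * B) * (\<integral>x. \<bar>u x\<bar> \<partial>?M)"
    by linarith
  thus ?thesis by (simp add: algebra_simps)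
qed

section \<open>Compactness of sequences bounded in BV and in the Lebesgue space\<close>

text \<open>Fatou's lemma for the Bochner integral. Integrability of the limit belongs to the
  conclusion, which is how limit functions are later recognised as square integrable.\<close>

lemma fatou_integrable_bound:
  fixes f :: "nat \<Rightarrow> 'a \<Rightarrow> real"
  assumes f: "\<And>k. integrable M (f k)" "\<And>k x. f k x \<ge> 0" "\<And>k. (\<integral>x. f k x \<partial>M) \<le> C"
    and lim: "AE x in M. (\<lambda>k. f k x) \<longlonglongrightarrow> g x" and [measurable]: "g \<in> borel_measurable M"
  shows "integrable M g \<and> (\<integral>x. g x \<partial>M) \<le> C"
proof -
  have [measurable]: "f k \<in> borel_measurable M" for k using f(1) by auto
  have g0: "AE x in M. g x \<ge> 0" using lim by eventually_elim (auto intro: LIMSEQ_le_const f(2))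
  have "(\<integral>x. f 0 x \<partial>M) \<ge> 0" by (intro integral_nonneg_AE AE_I2 f(2))
  hence C0: "C \<ge> 0" using f(3)[of 0] by linarith
  have "(\<integral>\<^sup>+x. ennreal (g x) \<partial>M) = (\<integral>\<^sup>+x. liminf (\<lambda>k. ennreal (f k x)) \<partial>M)"
  proof (rule nn_integral_cong_AE)
    show "AE x in M. ennreal (g x) = liminf (\<lambda>k. ennreal (f k x))"
      using lim by eventually_elim (metis lim_imp_Liminf sequentially_bot tendsto_ennrealI)
  qed
  also have "\<dots> \<le> liminf (\<lambda>k. \<integral>\<^sup>+x. ennreal (f k x) \<partial>M)" by (rule nn_integral_liminf) auto
  also have "\<dots> \<le> ennreal C"
    by (rule Liminf_le) (auto simp: nn_integral_eq_integral[OF f(1)] f ennreal_leI)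
  finally have le: "(\<integral>\<^sup>+x. ennreal (g x) \<partial>M) \<le> ennreal C" .
  have "integrable M g"
  proof (rule integrableI_bounded)
    have "(\<integral>\<^sup>+x. ennreal (norm (g x)) \<partial>M) = (\<integral>\<^sup>+x. ennreal (g x) \<partial>M)"
      using g0 by (intro nn_integral_cong_AE) auto
    thus "(\<integral>\<^sup>+x. ennreal (norm (g x)) \<partial>M) < \<infinity>" using le by (simp add: order_le_less_trans)
  qed simp
  moreover from this have "(\<integral>x. g x \<partial>M) \<le> C"
    using le C0 nn_integral_eq_integral[OF _ g0] by (simp add: ennreal_le_iff)
  ultimately show ?thesis by blast
qed

text \<open>A subsequence is Cauchy almost everywhere, so its pointwise limit exists there; Fatou's
  lemma then turns the Cauchy estimate for the full sequence into an estimate against this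
  limit.\<close>

lemma L1_Cauchy_limit:
  fixes u :: "nat \<Rightarrow> 'a \<Rightarrow> real"
  assumes int: "\<And>n. integrable M (u n)"
    and C: "\<And>e. e > 0 \<Longrightarrow> \<exists>N. \<forall>i\<ge>N. \<forall>j\<ge>N. (\<integral>x. \<bar>u i x - u j x\<bar> \<partial>M) < e"
  obtains v where "integrable M v" "(\<lambda>n. \<integral>x. \<bar>u n x - v x\<bar> \<partial>M) \<longlonglongrightarrow> 0"
proof -
  have [measurable]: "u n \<in> borel_measurable M" for n using int by auto
  obtain r where r: "strict_mono r" "AE x in M. Cauchy (\<lambda>i. u (r i) x)"
    using cauchy_L1_AE_cauchy_subseq[of M u] int C by auto
  define v where "v x = lim (\<lambda>i. u (r i) x)" for x
  have [measurable]: "v \<in> borel_measurable M" unfolding v_def by measurable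
  have lim: "AE x in M. (\<lambda>i. u (r i) x) \<longlonglongrightarrow> v x"
    using r(2) by eventually_elim (auto simp: v_def Cauchy_convergent convergent_LIMSEQ_iff[symmetric])
  have key: "\<exists>N. \<forall>n\<ge>N. integrable M (\<lambda>x. \<bar>u n x - v x\<bar>) \<and> (\<integral>x. \<bar>u n x - v x\<bar> \<partial>M) \<le> e" if e: "e > 0" for e
  proof -
    obtain N where N: "\<And>i j. i \<ge> N \<Longrightarrow> j \<ge> N \<Longrightarrow> (\<integral>x. \<bar>u i x - u j x\<bar> \<partial>M) < e" using C[OF e] by blast
    show ?thesis
    proof (intro exI[of _ N] allI impI)
      fix n assume n: "n \<ge> N"
      show "integrable M (\<lambda>x. \<bar>u n x - v x\<bar>) \<and> (\<integral>x. \<bar>u n x - v x\<bar> \<partial>M) \<le> e"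
      proof (rule fatou_integrable_bound[where f="\<lambda>k x. \<bar>u n x - u (r (k + N)) x\<bar>"])
        show "(\<integral>x. \<bar>u n x - u (r (k + N)) x\<bar> \<partial>M) \<le> e" for k
          using N[OF n, of "r (k + N)"] seq_suble[OF r(1), of "k + N"] by auto
        show "AE x in M. (\<lambda>k. \<bar>u n x - u (r (k + N)) x\<bar>) \<longlonglongrightarrow> \<bar>u n x - v x\<bar>"
          using lim by eventually_elim (auto intro!: tendsto_intros LIMSEQ_ignore_initial_segment)
      qed (use int in auto)
    qed
  qed
  have "(\<lambda>n. \<integral>x. \<bar>u n x - v x\<bar> \<partial>M) \<longlonglongrightarrow> 0"
  proof (rule LIMSEQ_I)
    fix e :: real assume "e > 0"
    with key[of "e / 2"] obtain N where "\<forall>n\<ge>N. (\<integral>x. \<bar>u n x - v x\<bar> \<partial>M) \<le> e / 2" by auto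
    moreover have "(\<integral>x. \<bar>u n x - v x\<bar> \<partial>M) \<ge> 0" for n by simp
    ultimately show "\<exists>no. \<forall>n\<ge>no. norm ((\<integral>x. \<bar>u n x - v x\<bar> \<partial>M) - 0) < e"
      using \<open>e > 0\<close> by (intro exI[of _ N]) (auto simp: abs_of_nonneg intro: order_le_less_trans)
  qed
  moreover have "integrable M v"
  proof -
    obtain n where "integrable M (\<lambda>x. \<bar>u n x - v x\<bar>)" using key[of 1] by auto
    hence "integrable M (\<lambda>x. u n x - v x)" by (subst integrable_norm_iff[symmetric]) auto
    from Bochner_Integration.integrable_diff[OF int[of n] this] show ?thesis by simp
  qed
  ultimately show ?thesis using that by blast
qed

lemma L1_limit_test:
  fixes U :: "'a::euclidean_space set" and g :: "'a \<Rightarrow> real"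
  assumes U: "bounded U" "U \<in> sets lebesgue" and v: "\<And>j. integrable (lebesgue_on U) (v j)" "integrable (lebesgue_on U) u"
    and lim: "(\<lambda>j. \<integral>x. \<bar>v j x - u x\<bar> \<partial>lebesgue_on U) \<longlonglongrightarrow> 0" and g: "continuous_on (closure U) g"
  shows "(\<lambda>j. \<integral>x. v j x * g x \<partial>lebesgue_on U) \<longlonglongrightarrow> (\<integral>x. u x * g x \<partial>lebesgue_on U)"
proof -
  let ?M = "lebesgue_on U"
  obtain B where B: "\<And>x. x \<in> closure U \<Longrightarrow> \<bar>g x\<bar> \<le> B"
    using continuous_on_closure_bounded[OF U(1) g] by blast
  have "\<bar>(\<integral>x. v j x * g x \<partial>?M) - (\<integral>x. u x * g x \<partial>?M)\<bar> \<le> B * (\<integral>x. \<bar>v j x - u x\<bar> \<partial>?M)" for j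
  proof -
    have "(\<integral>x. v j x * g x \<partial>?M) - (\<integral>x. u x * g x \<partial>?M) = (\<integral>x. (v j x - u x) * g x \<partial>?M)"
      using integrable_mult_continuous[OF U v(1) g, of j] integrable_mult_continuous[OF U v(2) g]
      by (simp add: left_diff_distrib)
    also have "\<bar>\<dots>\<bar> \<le> B * (\<integral>x. \<bar>v j x - u x\<bar> \<partial>?M)"
      using v B closure_subset[of U] by (intro integral_mult_bound) auto
    finally show ?thesis .
  qed
  moreover have "(\<lambda>j. B * (\<integral>x. \<bar>v j x - u x\<bar> \<partial>?M)) \<longlonglongrightarrow> 0"
    using tendsto_mult_right_zero[OF lim] by simp
  ultimately have "(\<lambda>j. (\<integral>x. v j x * g x \<partial>?M) - (\<integral>x. u x * g x \<partial>?M)) \<longlonglongrightarrow> 0"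
    using Lim_null_comparison[of "\<lambda>j. (\<integral>x. v j x * g x \<partial>?M) - (\<integral>x. u x * g x \<partial>?M)"
      "\<lambda>j. B * (\<integral>x. \<bar>v j x - u x\<bar> \<partial>?M)" sequentially] by simp
  thus ?thesis using LIM_zero_iff by blast
qed

lemma tv_lower_semicontinuous:
  fixes U :: "(real^'n) set"
  assumes U: "bounded U" "open U" and v: "\<And>j. integrable (lebesgue_on U) (v j)" "integrable (lebesgue_on U) u"
    and lim: "(\<lambda>j. \<integral>x. \<bar>v j x - u x\<bar> \<partial>lebesgue_on U) \<longlonglongrightarrow> 0"
    and M: "\<forall>\<^sub>F j in sequentially. tv U (v j) \<le> ereal M"
  shows "tv U u \<le> ereal M"
proof (rule tv_leI)
  fix \<phi> assume \<phi>: "\<phi> \<in> Cc1 U" "\<And>x. norm (\<phi> x) \<le> 1"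
  have "(\<lambda>j. \<integral>x. v j x * divergence \<phi> x \<partial>lebesgue_on U) \<longlonglongrightarrow> (\<integral>x. u x * divergence \<phi> x \<partial>lebesgue_on U)"
    using U by (intro L1_limit_test v lim continuous_on_divergence[OF \<phi>(1)]) auto
  moreover have "\<forall>\<^sub>F j in sequentially. (\<integral>x. v j x * divergence \<phi> x \<partial>lebesgue_on U) \<le> M"
    using M
  proof eventually_elim
    case (elim j)
    from tv_bound[OF elim \<phi>] show ?case by simp
  qed
  ultimately show "(\<integral>x. u x * divergence \<phi> x \<partial>lebesgue_on U) \<le> M"
    by (intro tendsto_upperbound[of _ _ sequentially]) auto
qed

lemma finite_measure_bounded_open: "bounded U \<Longrightarrow> open U \<Longrightarrow> finite_measure (lebesgue_on U)"
  by (intro finite_measure_lebesgue_on lmeasurable_open)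

lemma L2_imp_integrable:
  assumes U: "bounded U" "open U" and "u \<in> borel_measurable (lebesgue_on U)" "integrable (lebesgue_on U) (\<lambda>x. (u x)\<^sup>2 :: real)"
  shows "integrable (lebesgue_on U) u"
    and "(\<integral>x. \<bar>u x\<bar> \<partial>lebesgue_on U) \<le> measure lebesgue U + (\<integral>x. (u x)\<^sup>2 \<partial>lebesgue_on U)"
proof -
  interpret finite_measure "lebesgue_on U" using U by (rule finite_measure_bounded_open)
  have le: "\<bar>u x\<bar> \<le> 1 + (u x)\<^sup>2" for x
  proof (cases "\<bar>u x\<bar> \<le> 1")
    case False
    hence "\<bar>u x\<bar> * 1 \<le> \<bar>u x\<bar> * \<bar>u x\<bar>" by (intro mult_left_mono) auto
    thus ?thesis by (simp add: power2_eq_square)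
  qed (simp add: add_increasing2)
  have i: "integrable (lebesgue_on U) (\<lambda>x. 1 + (u x)\<^sup>2)" using assms by auto
  show int: "integrable (lebesgue_on U) u"
    by (rule Bochner_Integration.integrable_bound[OF i]) (use assms le in auto)
  have "(\<integral>x. \<bar>u x\<bar> \<partial>lebesgue_on U) \<le> (\<integral>x. 1 + (u x)\<^sup>2 \<partial>lebesgue_on U)"
    using int i le by (intro integral_mono) auto
  also have "\<dots> = measure lebesgue U + (\<integral>x. (u x)\<^sup>2 \<partial>lebesgue_on U)"
    using assms by (simp add: measure_restrict_space)
  finally show "(\<integral>x. \<bar>u x\<bar> \<partial>lebesgue_on U) \<le> measure lebesgue U + (\<integral>x. (u x)\<^sup>2 \<partial>lebesgue_on U)" .
qed

text \<open>A failure provides index pairs \<open>a N\<close>, \<open>b N\<close> beyond every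
  \<open>N\<close>. The differences along these pairs, times a cutoff, have uniform bounds and
  converge weakly to zero, hence strongly, although their mass on \<open>K\<close> stays above
  \<open>c * e\<close>. Working with differences avoids the need for a limit function.\<close>

lemma local_L1_Cauchy:
  fixes u :: "nat \<Rightarrow> real^'n \<Rightarrow> real"
  assumes U: "bounded U" "open U" and u: "\<And>j. integrable (lebesgue_on U) (u j)"
      "\<And>j. (\<integral>x. \<bar>u j x\<bar> \<partial>lebesgue_on U) \<le> C" "\<And>j. tv U (u j) \<le> ereal M"
    and weak: "\<And>g. continuous_on (closure U) g \<Longrightarrow> convergent (\<lambda>j. \<integral>x. u j x * g x \<partial>lebesgue_on U)"
    and K: "compact K" "K \<subseteq> U" and "e > 0"
  shows "\<exists>N. \<forall>i\<ge>N. \<forall>j\<ge>N. (\<integral>x. \<bar>u i x - u j x\<bar> * indicator K x \<partial>lebesgue_on U) < e"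
proof (rule ccontr)
  let ?M = "lebesgue_on U"
  have meas: "U \<in> sets lebesgue" using U by auto
  assume "\<not> ?thesis"
  hence "\<forall>N. \<exists>i j. i \<ge> N \<and> j \<ge> N \<and> (\<integral>x. \<bar>u i x - u j x\<bar> * indicator K x \<partial>?M) \<ge> e"
    by (auto simp: not_less)
  then obtain a b where ab: "\<And>N. a N \<ge> N" "\<And>N. b N \<ge> N"
      "\<And>N. (\<integral>x. \<bar>u (a N) x - u (b N) x\<bar> * indicator K x \<partial>?M) \<ge> e" by metis
  obtain \<kappa> K' c where \<kappa>: "C1 \<kappa>" "compact K'" "K' \<subseteq> U" "\<And>x. x \<notin> K' \<Longrightarrow> \<kappa> x = 0" "c > 0" "\<And>x. x \<in> K \<Longrightarrow> \<bar>\<kappa> x\<bar> \<ge> c"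
    using C1_cutoff[OF U K] by blast
  note bdd = continuous_on_closure_bounded[OF U(1)]
  obtain c0 where "\<forall>x\<in>closure U. \<bar>\<kappa> x\<bar> \<le> c0" using bdd[OF C1_continuous[OF \<kappa>(1)]] by blast
  hence c0: "\<bar>\<kappa> x\<bar> \<le> \<bar>c0\<bar>" for x using \<kappa>(3,4) closure_subset[of U] by (cases "x \<in> K'") force+
  have "\<forall>b. \<exists>B. \<forall>x\<in>closure U. \<bar>frechet_derivative \<kappa> (at x) b\<bar> \<le> B"
    using bdd[OF C1_continuous_derivative[OF \<kappa>(1)]] by blast
  then obtain B where B: "\<And>b x. x \<in> closure U \<Longrightarrow> \<bar>frechet_derivative \<kappa> (at x) b\<bar> \<le> B b" by metis
  define c1 where "c1 = (\<Sum>b\<in>(Basis::(real^'n) set). \<bar>B b\<bar>)"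
  have c1: "\<bar>frechet_derivative \<kappa> (at x) b\<bar> \<le> c1" if "x \<in> U" "b \<in> Basis" for x b
    using order_trans[OF order_trans[OF B abs_ge_self] member_le_sum[of b Basis "\<lambda>b. \<bar>B b\<bar>"]] that closure_subset[of U]
    by (auto simp: c1_def)
  define w where "w N x = (u (a N) x - u (b N) x) * \<kappa> x" for N x
  have iu: "integrable ?M (\<lambda>x. u j x * \<kappa> x * g x)" if "continuous_on (closure U) g" for j g
    using integrable_mult_continuous[OF U(1) meas u(1) continuous_on_mult[OF C1_continuous[OF \<kappa>(1)] that], of j]
    by (simp add: mult.assoc)
  have iu1: "integrable ?M (\<lambda>x. u j x * \<kappa> x)" for j using iu[of "\<lambda>x. 1"] by simp
  have weq: "(\<integral>x. w N x * g x \<partial>?M) = (\<integral>x. u (a N) x * \<kappa> x * g x \<partial>?M) - (\<integral>x. u (b N) x * \<kappa> x * g x \<partial>?M)"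
    if "continuous_on (closure U) g" for N g
    by (subst Bochner_Integration.integral_diff[OF iu[OF that] iu[OF that], symmetric]) (simp add: w_def algebra_simps)
  have "(\<lambda>N. \<integral>x. \<bar>w N x\<bar> \<partial>?M) \<longlonglongrightarrow> 0"
  proof (rule weak_BV_imp_L1_tendsto_0[OF U(1) meas])
    show wi: "integrable ?M (w N)" for N
      unfolding w_def[abs_def] by (intro integrable_mult_continuous U meas C1_continuous \<kappa>(1)) (use u in auto)
    show "(\<integral>x. \<bar>w N x\<bar> \<partial>?M) \<le> 2 * (\<bar>c0\<bar> * C)" for N
    proof -
      have 1: "(\<integral>x. \<bar>u j x * \<kappa> x\<bar> \<partial>?M) \<le> \<bar>c0\<bar> * C" for j
      proof -
        have "(\<integral>x. \<bar>u j x * \<kappa> x\<bar> \<partial>?M) \<le> (\<integral>x. \<bar>c0\<bar> * \<bar>u j x\<bar> \<partial>?M)"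
        proof (rule integral_mono)
          show "integrable ?M (\<lambda>x. \<bar>u j x * \<kappa> x\<bar>)" using iu1 by (rule integrable_abs)
          show "\<bar>u j x * \<kappa> x\<bar> \<le> \<bar>c0\<bar> * \<bar>u j x\<bar>" for x
            using mult_right_mono[OF c0[of x], of "\<bar>u j x\<bar>"] by (simp add: abs_mult mult.commute)
        qed (use u in auto)
        also have "\<dots> \<le> \<bar>c0\<bar> * C" using u(2)[of j] by (simp add: mult_left_mono)
        finally show ?thesis .
      qed
      have "(\<integral>x. \<bar>w N x\<bar> \<partial>?M) \<le> (\<integral>x. \<bar>u (a N) x * \<kappa> x\<bar> + \<bar>u (b N) x * \<kappa> x\<bar> \<partial>?M)"
        using wi iu1 by (intro integral_mono) (auto simp: w_def left_diff_distrib)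
      also have "\<dots> = (\<integral>x. \<bar>u (a N) x * \<kappa> x\<bar> \<partial>?M) + (\<integral>x. \<bar>u (b N) x * \<kappa> x\<bar> \<partial>?M)"
        using iu1 by (intro Bochner_Integration.integral_add) auto
      finally show ?thesis using 1[of "a N"] 1[of "b N"] by linarith
    qed
    show "\<bar>\<integral>x. w N x * frechet_derivative f (at x) bb \<partial>?M\<bar> \<le> 2 * (M * \<bar>c0\<bar> + c1 * C) * Bf"
      if f: "C1 f" "\<And>x. \<bar>f x\<bar> \<le> Bf" "bb \<in> Basis" for N f bb Bf
    proof -
      have Bf: "Bf \<ge> 0" using f(2)[of 0] by linarith
      have c10: "c1 \<ge> 0" by (auto simp: c1_def intro: sum_nonneg)
      have "\<bar>\<integral>x. (u j x * \<kappa> x) * frechet_derivative f (at x) bb \<partial>?M\<bar> \<le> (M * \<bar>c0\<bar> + c1 * C) * Bf" for j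
      proof -
        have "\<bar>\<integral>x. (u j x * \<kappa> x) * frechet_derivative f (at x) bb \<partial>?M\<bar> \<le> (M * \<bar>c0\<bar> + c1 * (\<integral>x. \<bar>u j x\<bar> \<partial>?M)) * Bf"
          by (rule cutoff_BV_bound[OF U u(1,3) \<kappa>(1-4) c0 c1 f])
        also have "\<dots> \<le> (M * \<bar>c0\<bar> + c1 * C) * Bf"
          using u(2)[of j] c10 Bf by (intro mult_right_mono add_left_mono mult_left_mono) auto
        finally show ?thesis .
      qed
      from this[of "a N"] this[of "b N"] show ?thesis
        unfolding weq[OF C1_continuous_derivative[OF f(1)]] by (simp add: algebra_simps abs_le_iff)
    qed
    show "(\<lambda>N. \<integral>x. w N x * g x \<partial>?M) \<longlonglongrightarrow> 0" if g: "continuous_on (closure U) g" for g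
    proof -
      have "convergent (\<lambda>j. \<integral>x. u j x * \<kappa> x * g x \<partial>?M)"
        using weak[OF continuous_on_mult[OF C1_continuous[OF \<kappa>(1)] g]] by (simp add: mult.assoc)
      then obtain l where l: "(\<lambda>j. \<integral>x. u j x * \<kappa> x * g x \<partial>?M) \<longlonglongrightarrow> l" by (auto simp: convergent_def)
      \<comment> \<open>The chosen indices satisfy \<open>a N \<ge> N\<close> and
        \<open>b N \<ge> N\<close> but need not increase strictly, so convergence along the filter
        replaces a subsequence argument.\<close>
      have "filterlim a sequentially sequentially" "filterlim b sequentially sequentially"
        using ab by (auto intro: filterlim_at_top_mono[OF filterlim_ident])
      from tendsto_diff[OF filterlim_compose[OF l this(1)] filterlim_compose[OF l this(2)]]
      show ?thesis unfolding weq[OF g] by simp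
    qed
  qed
  from order_tendstoD(2)[OF this, of "c * e"] \<kappa>(5) \<open>e > 0\<close>
  obtain N where N: "(\<integral>x. \<bar>w N x\<bar> \<partial>?M) < c * e" by (auto simp: eventually_sequentially)
  have iw: "integrable ?M (w N)" unfolding w_def[abs_def] by (intro integrable_mult_continuous U meas C1_continuous \<kappa>(1)) (use u in auto)
  have Ks: "K \<in> sets ?M" using K meas by (auto simp: sets_restrict_space_iff compact_imp_closed)
  have "c * e \<le> c * (\<integral>x. \<bar>u (a N) x - u (b N) x\<bar> * indicator K x \<partial>?M)"
    using ab(3) \<kappa>(5) by (intro mult_left_mono) auto
  also have "\<dots> = (\<integral>x. c * (\<bar>u (a N) x - u (b N) x\<bar> * indicator K x) \<partial>?M)" by simp
  also have "\<dots> \<le> (\<integral>x. \<bar>w N x\<bar> \<partial>?M)"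
  proof (rule integral_mono)
    show "integrable ?M (\<lambda>x. c * (\<bar>u (a N) x - u (b N) x\<bar> * indicator K x))"
      using u Ks by (intro integrable_mult_right integrable_real_mult_indicator) auto
    show "c * (\<bar>u (a N) x - u (b N) x\<bar> * indicator K x) \<le> \<bar>w N x\<bar>" for x
      using \<kappa>(6)[of x] mult_left_mono[of c "\<bar>\<kappa> x\<bar>" "\<bar>u (a N) x - u (b N) x\<bar>"]
      by (auto simp: w_def abs_mult indicator_def mult.commute)
  qed (use iw in auto)
  finally show False using N by simp
qed

text \<open>Near the boundary the \<open>L\<^sup>2\<close> bound makes the mass uniformly small, so local compactness suffices.\<close>

lemma BV_L2_compactness:
  fixes u :: "nat \<Rightarrow> real^'n \<Rightarrow> real"
  assumes U: "bounded U" "open U" and u: "\<And>j. u j \<in> borel_measurable (lebesgue_on U)" "\<And>j. integrable (lebesgue_on U) (\<lambda>x. (u j x)\<^sup>2)"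
     and C: "\<And>j. (\<integral>x. (u j x)\<^sup>2 \<partial>lebesgue_on U) \<le> C" and tv: "\<And>j. tv U (u j) \<le> ereal M"
  obtains r v where "strict_mono (r :: nat \<Rightarrow> nat)" "integrable (lebesgue_on U) v"
    "(\<lambda>j. \<integral>x. \<bar>u (r j) x - v x\<bar> \<partial>lebesgue_on U) \<longlonglongrightarrow> 0"
proof -
  let ?M = "lebesgue_on U"
  have meas: "U \<in> sets lebesgue" using U by auto
  interpret finite_measure ?M using U by (rule finite_measure_bounded_open)
  note [measurable] = u(1)
  have ui: "integrable ?M (u j)" for j by (rule L2_imp_integrable(1)[OF U u])
  have C1: "(\<integral>x. \<bar>u j x\<bar> \<partial>?M) \<le> measure lebesgue U + C" for j
    using L2_imp_integrable(2)[OF U u, of j] C[of j] by linarith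
  obtain r where r: "strict_mono (r :: nat \<Rightarrow> nat)"
      and weak: "\<And>g. continuous_on (closure U) g \<Longrightarrow> convergent (\<lambda>j. \<integral>x. u (r j) x * g x \<partial>?M)"
    by (rule weakly_convergent_subseq[where w=u, OF U(1) meas ui C1]) blast
  have C0: "C \<ge> 0" using order_trans[OF integral_nonneg_AE C[of 0]] by simp
  have "\<exists>N. \<forall>i\<ge>N. \<forall>j\<ge>N. (\<integral>x. \<bar>u (r i) x - u (r j) x\<bar> \<partial>?M) < e" if e: "e > 0" for e
  proof -
    \<comment> \<open>The weight in Young's inequality: the squared norm of a difference is at most
      \<open>4 * C\<close>, so the quadratic term costs at most \<open>e / 4\<close>.\<close>
    define s where "s = e / (8 * (C + 1))"
    have s: "s > 0" "s * (4 * C) \<le> e / 2" using e C0 by (auto simp: s_def field_simps)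
    have "s * e / 8 > 0" using s e by simp
    \<comment> \<open>The uncovered set is chosen after \<open>s\<close>, because its measure gets
      the weight \<open>1 / (2 * s)\<close>; it contributes at most \<open>e / 16\<close>.\<close>
    from sets_lebesgue_inner_closed[OF meas this] obtain K where K: "closed K" "K \<subseteq> U" "U - K \<in> lmeasurable"
      "emeasure lebesgue (U - K) < ennreal (s * e / 8)" by blast
    have cK: "compact K" using K U bounded_subset by (auto simp: compact_eq_bounded_closed)
    have Ks: "K \<in> sets ?M" "U - K \<in> sets ?M" using K meas by (auto simp: sets_restrict_space_iff)
    have mK: "measure ?M (U - K) < s * e / 8"
    proof -
      have "measure ?M (U - K) = measure lebesgue (U - K)" using meas by (simp add: measure_restrict_space)
      also have "\<dots> < s * e / 8" using K(3,4) s e by (simp add: emeasure_eq_measure2 ennreal_less_iff)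
      finally show ?thesis .
    qed
    obtain N where N: "\<And>i j. i \<ge> N \<Longrightarrow> j \<ge> N \<Longrightarrow> (\<integral>x. \<bar>u (r i) x - u (r j) x\<bar> * indicator K x \<partial>?M) < e / 4"
      using local_L1_Cauchy[where u="\<lambda>j. u (r j)" and e="e / 4", OF U ui C1 tv weak cK K(2)] e by auto
    have "(\<integral>x. \<bar>u (r i) x - u (r j) x\<bar> \<partial>?M) < e" if ij: "i \<ge> N" "j \<ge> N" for i j
    proof -
      let ?w = "\<lambda>x. u (r i) x - u (r j) x"
      have w2: "integrable ?M (\<lambda>x. (?w x)\<^sup>2)" "(\<integral>x. (?w x)\<^sup>2 \<partial>?M) \<le> 4 * C"
      proof -
        have le: "(?w x)\<^sup>2 \<le> 2 * (u (r i) x)\<^sup>2 + 2 * (u (r j) x)\<^sup>2" for x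
          using zero_le_power2[of "u (r i) x + u (r j) x"] by (simp add: power2_eq_square algebra_simps)
        have i2: "integrable ?M (\<lambda>x. 2 * (u (r i) x)\<^sup>2 + 2 * (u (r j) x)\<^sup>2)" using u(2) by auto
        show 1: "integrable ?M (\<lambda>x. (?w x)\<^sup>2)"
          by (rule Bochner_Integration.integrable_bound[OF i2]) (use le in auto)
        have "(\<integral>x. (?w x)\<^sup>2 \<partial>?M) \<le> (\<integral>x. 2 * (u (r i) x)\<^sup>2 + 2 * (u (r j) x)\<^sup>2 \<partial>?M)"
          using 1 i2 le by (intro integral_mono) auto
        thus "(\<integral>x. (?w x)\<^sup>2 \<partial>?M) \<le> 4 * C" using u(2) C[of "r i"] C[of "r j"] by simp
      qed
      \<comment> \<open>Off \<open>K\<close> this is the inequality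
        \<open>0 \<le> (s * \<bar>w\<bar> - 1)\<^sup>2\<close> divided by
        \<open>2 * s\<close>.\<close>
      have le: "\<bar>?w x\<bar> \<le> \<bar>?w x\<bar> * indicator K x + (s / 2 * (?w x)\<^sup>2 + 1 / (2 * s) * indicator (U - K) x)"
        if "x \<in> space ?M" for x
      proof (cases "x \<in> K")
        case True
        thus ?thesis using s by simp
      next
        case False
        have "0 \<le> (s * \<bar>?w x\<bar> - 1)\<^sup>2" by simp
        hence "2 * s * \<bar>?w x\<bar> \<le> s * s * (?w x)\<^sup>2 + 1" by (simp add: power2_diff power_mult_distrib power2_eq_square[of s])
        hence "\<bar>?w x\<bar> \<le> s / 2 * (?w x)\<^sup>2 + 1 / (2 * s)" using s by (simp add: field_simps)
        thus ?thesis using False that by (simp add: space_restrict_space)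
      qed
      have i: "integrable ?M (\<lambda>x. \<bar>?w x\<bar> * indicator K x)" using ui Ks by (intro integrable_real_mult_indicator) auto
      have i': "integrable ?M (\<lambda>x. s / 2 * (?w x)\<^sup>2)" using w2 by simp
      have i'': "integrable ?M (\<lambda>x. 1 / (2 * s) * indicator (U - K) x)"
        using Ks by (intro integrable_mult_right) (auto simp: integrable_indicator_iff less_top[symmetric])
      have "(\<integral>x. \<bar>?w x\<bar> \<partial>?M) \<le> (\<integral>x. \<bar>?w x\<bar> * indicator K x + (s / 2 * (?w x)\<^sup>2 + 1 / (2 * s) * indicator (U - K) x) \<partial>?M)"
        using ui le i i' i'' by (intro integral_mono) auto
      also have "\<dots> = (\<integral>x. \<bar>?w x\<bar> * indicator K x \<partial>?M) + (s / 2 * (\<integral>x. (?w x)\<^sup>2 \<partial>?M) + 1 / (2 * s) * measure ?M (U - K))"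
        unfolding Bochner_Integration.integral_add[OF i Bochner_Integration.integrable_add[OF i' i'']] Bochner_Integration.integral_add[OF i' i'']
        using Ks by (simp add: Int_absorb2[OF Diff_subset])
      also have "\<dots> < e / 4 + (s / 2 * (4 * C) + 1 / (2 * s) * (s * e / 8))"
        using N[OF ij] w2(2) mK s by (intro add_less_le_mono add_mono mult_left_mono) auto
      also have "\<dots> = e / 4 + (s * (4 * C) / 2 + e / 16)" using s by (simp add: field_simps)
      also have "\<dots> \<le> e" using s(2) e by linarith
      finally show ?thesis .
    qed
    thus ?thesis by blast
  qed
  from L1_Cauchy_limit[OF ui this] obtain v where "integrable ?M v" "(\<lambda>n. \<integral>x. \<bar>u (r n) x - v x\<bar> \<partial>?M) \<longlonglongrightarrow> 0" by blast
  thus ?thesis using that r by blast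
qed

section \<open>The derivative as a measure and weak-* convergence\<close>

lemma abs_le_all_eps_imp_0:
  fixes x :: real
  assumes "\<And>e. e > 0 \<Longrightarrow> \<bar>x\<bar> \<le> M * e"
  shows "x = 0"
proof (rule ccontr)
  assume "x \<noteq> 0"
  define e where "e = \<bar>x\<bar> / (2 * (\<bar>M\<bar> + 1))"
  have e: "e > 0" using \<open>x \<noteq> 0\<close> by (simp add: e_def)
  have "M * e \<le> (\<bar>M\<bar> + 1) * e" using e by (intro mult_right_mono) auto
  also have "\<dots> = \<bar>x\<bar> / 2" by (simp add: e_def field_simps)
  finally show False using assms[OF e] \<open>x \<noteq> 0\<close> by simp
qed

lemma Cc1_dense_C0:
  fixes U :: "(real^'n) set"
  assumes U: "bounded U" "open U" and \<phi>: "\<phi> \<in> C0 U" and e: "e > 0"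
  shows "\<exists>\<psi>\<in>Cc1 U. \<forall>x\<in>U. norm (\<psi> x - \<phi> x) \<le> e"
proof -
  define d where "d = e / CARD('n)"
  have d: "d > 0" using e by (simp add: d_def)
  have "\<exists>\<psi> K. C1 \<psi> \<and> compact K \<and> K \<subseteq> U \<and> (\<forall>x. x \<notin> K \<longrightarrow> \<psi> x = 0) \<and> (\<forall>x\<in>U. \<bar>\<psi> x - \<phi> x $ i\<bar> \<le> d)" for i
  proof -
    have "continuous_on U (\<lambda>x. \<phi> x $ i)" using \<phi> by (intro continuous_intros) (simp add: C0_def)
    moreover have "\<exists>K. compact K \<and> K \<subseteq> U \<and> (\<forall>x\<in>U - K. \<bar>\<phi> x $ i\<bar> < \<epsilon>)" if "\<epsilon> > 0" for \<epsilon>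
      using \<phi> that unfolding C0_def by (fastforce intro: order_le_less_trans[OF component_le_norm_cart])
    ultimately obtain \<psi> K where "C1 \<psi>" "compact K" "K \<subseteq> U" "\<And>x. x \<notin> K \<Longrightarrow> \<psi> x = 0" "\<And>x. x \<in> U \<Longrightarrow> \<bar>\<psi> x - \<phi> x $ i\<bar> \<le> d"
      using C1_compact_support_approx[OF U _ _ d, of "\<lambda>x. \<phi> x $ i"] by metis
    thus ?thesis by (intro exI[of _ \<psi>] exI[of _ K]) simp
  qed
  then obtain \<psi> K where \<psi>: "\<And>i. C1 (\<psi> i)" "\<And>i. compact (K i)" "\<And>i. K i \<subseteq> U" "\<And>i x. x \<notin> K i \<Longrightarrow> \<psi> i x = 0"
     "\<And>i x. x \<in> U \<Longrightarrow> \<bar>\<psi> i x - \<phi> x $ i\<bar> \<le> d" by metis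
  have "(\<lambda>x. \<chi> i. \<psi> i x) \<in> Cc1 U"
    by (rule Cc1_vec_lambdaI(1)[of \<psi> "\<Union>i. K i"]) (use \<psi> in \<open>auto intro: compact_UN\<close>)
  moreover have "norm ((\<chi> i. \<psi> i x) - \<phi> x) \<le> e" if "x \<in> U" for x
  proof -
    have "norm ((\<chi> i. \<psi> i x) - \<phi> x) \<le> (\<Sum>i\<in>UNIV. \<bar>((\<chi> i. \<psi> i x) - \<phi> x) $ i\<bar>)" by (rule norm_le_l1_cart)
    also have "\<dots> \<le> (\<Sum>i\<in>(UNIV::'n set). d)" using \<psi>(5)[OF that] by (intro sum_mono) simp
    finally show ?thesis by (simp add: d_def)
  qed
  ultimately show ?thesis by (intro bexI[of _ "\<lambda>x. \<chi> i. \<psi> i x"]) auto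
qed

text \<open>The supremum of an unbounded set of reals is unspecified, so boundedness comes first:
  the field is bounded on a compact set by continuity and below \<open>1\<close> off it.\<close>

lemma C0_norm_le_Sup:
  assumes \<phi>: "\<phi> \<in> C0 U" "x \<in> U"
  shows "norm (\<phi> x) \<le> (SUP x\<in>U. norm (\<phi> x))"
proof -
  obtain K where K: "compact K" "K \<subseteq> U" "\<forall>x\<in>U - K. norm (\<phi> x) < 1"
    using \<phi>(1) zero_less_one unfolding C0_def by blast
  have "compact (\<phi> ` K)" using \<phi> K by (intro compact_continuous_image) (auto simp: C0_def intro: continuous_on_subset)
  then obtain B where "\<And>x. x \<in> K \<Longrightarrow> norm (\<phi> x) \<le> B" by (metis bounded_iff compact_imp_bounded imageI)
  hence "norm (\<phi> x) \<le> max B 1" if "x \<in> U" for x using K that by (cases "x \<in> K") (auto simp: le_max_iff_disj less_imp_le)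
  hence "bdd_above ((\<lambda>x. norm (\<phi> x)) ` U)" by (intro bdd_aboveI[of _ "max B 1"]) auto
  thus ?thesis using \<phi>(2) by (rule cSUP_upper[rotated])
qed

lemma C0_add_scale:
  "\<phi> \<in> C0 U \<Longrightarrow> \<psi> \<in> C0 U \<Longrightarrow> (\<lambda>x. \<phi> x + \<psi> x) \<in> C0 U"
  "\<phi> \<in> C0 U \<Longrightarrow> (\<lambda>x. c *\<^sub>R \<phi> x) \<in> C0 U"
proof -
  assume \<phi>: "\<phi> \<in> C0 U"
  show "(\<lambda>x. \<phi> x + \<psi> x) \<in> C0 U" if \<psi>: "\<psi> \<in> C0 U"
    unfolding C0_def mem_Collect_eq
  proof (intro conjI allI impI)
    show "continuous_on U (\<lambda>x. \<phi> x + \<psi> x)" using \<phi> \<psi> by (auto simp: C0_def intro!: continuous_intros)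
    fix \<epsilon> :: real assume "\<epsilon> > 0"
    hence "\<epsilon> / 2 > 0" by simp
    then obtain K1 K2 where K: "compact K1" "K1 \<subseteq> U" "\<forall>x\<in>U - K1. norm (\<phi> x) < \<epsilon> / 2"
      "compact K2" "K2 \<subseteq> U" "\<forall>x\<in>U - K2. norm (\<psi> x) < \<epsilon> / 2" using \<phi> \<psi> unfolding C0_def by blast
    show "\<exists>K. compact K \<and> K \<subseteq> U \<and> (\<forall>x\<in>U - K. norm (\<phi> x + \<psi> x) < \<epsilon>)"
    proof (intro exI[of _ "K1 \<union> K2"] conjI ballI)
      fix x assume "x \<in> U - (K1 \<union> K2)"
      hence "norm (\<phi> x) < \<epsilon> / 2" "norm (\<psi> x) < \<epsilon> / 2" using K by auto
      thus "norm (\<phi> x + \<psi> x) < \<epsilon>" using norm_triangle_ineq[of "\<phi> x" "\<psi> x"] by linarith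
    qed (use K in auto)
  qed
  show "(\<lambda>x. c *\<^sub>R \<phi> x) \<in> C0 U"
    unfolding C0_def mem_Collect_eq
  proof (intro conjI allI impI)
    show "continuous_on U (\<lambda>x. c *\<^sub>R \<phi> x)" using \<phi> by (auto simp: C0_def intro!: continuous_intros)
    fix \<epsilon> :: real assume "\<epsilon> > 0"
    hence "\<epsilon> / (\<bar>c\<bar> + 1) > 0" by simp
    then obtain K where K: "compact K" "K \<subseteq> U" "\<forall>x\<in>U - K. norm (\<phi> x) < \<epsilon> / (\<bar>c\<bar> + 1)" using \<phi> unfolding C0_def by blast
    show "\<exists>K. compact K \<and> K \<subseteq> U \<and> (\<forall>x\<in>U - K. norm (c *\<^sub>R \<phi> x) < \<epsilon>)"
    proof (intro exI[of _ K] conjI ballI)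
      fix x assume "x \<in> U - K"
      hence "norm (\<phi> x) * (\<bar>c\<bar> + 1) < \<epsilon>" using K by (simp add: field_simps)
      thus "norm (c *\<^sub>R \<phi> x) < \<epsilon>" by (simp add: algebra_simps) (smt (verit) norm_ge_zero)
    qed (use K in auto)
  qed
qed

lemma Cc1_subset_C0: "Cc1 U \<subseteq> C0 U"
proof
  fix \<phi> assume \<phi>: "\<phi> \<in> Cc1 U"
  obtain K where K: "compact K" "K \<subseteq> U" "\<forall>x. x \<notin> K \<longrightarrow> \<phi> x = 0" using \<phi> unfolding Cc1_def by blast
  have "continuous_on U \<phi>" using \<phi> unfolding Cc1_def
    by (auto intro!: continuous_at_imp_continuous_on differentiable_imp_continuous_within)
  thus "\<phi> \<in> C0 U" unfolding C0_def using K by (auto intro!: exI[of _ K])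
qed

text \<open>The distributional derivative of \<open>u\<close> as a functional on test fields, with
  the sign from integration by parts.\<close>

definition div_pairing :: "(real^'n) set \<Rightarrow> (real^'n \<Rightarrow> real) \<Rightarrow> (real^'n \<Rightarrow> real^'n) \<Rightarrow> real" where
  "div_pairing U u \<phi> = - (\<integral>x. u x * divergence \<phi> x \<partial>lebesgue_on U)"

lemma div_pairing_lincomb:
  fixes U :: "(real^'n) set"
  assumes U: "bounded U" "open U" and u: "integrable (lebesgue_on U) u" and \<phi>: "\<phi> \<in> Cc1 U" "\<psi> \<in> Cc1 U"
  shows "div_pairing U u (\<lambda>x. a *\<^sub>R \<phi> x + b *\<^sub>R \<psi> x) = a * div_pairing U u \<phi> + b * div_pairing U u \<psi>"
proof -
  have i: "integrable (lebesgue_on U) (\<lambda>x. c * (u x * divergence \<phi> x))" if "\<phi> \<in> Cc1 U" for \<phi> c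
    using U by (intro integrable_mult_right integrable_mult_continuous u continuous_on_divergence[OF that]) auto
  have "(\<integral>x. u x * divergence (\<lambda>x. a *\<^sub>R \<phi> x + b *\<^sub>R \<psi> x) x \<partial>lebesgue_on U) =
     (\<integral>x. a * (u x * divergence \<phi> x) + b * (u x * divergence \<psi> x) \<partial>lebesgue_on U)"
    unfolding divergence_lincomb(2)[OF \<phi>] by (simp add: algebra_simps)
  thus ?thesis unfolding div_pairing_def
    by (simp add: Bochner_Integration.integral_add[OF i[OF \<phi>(1)] i[OF \<phi>(2)]])
qed

lemma div_pairing_diff_bound:
  fixes U :: "(real^'n) set"
  assumes U: "bounded U" "open U" "U \<noteq> {}" and u: "integrable (lebesgue_on U) u" "tv U u \<le> ereal M"
    and \<phi>: "\<phi> \<in> Cc1 U" "\<psi> \<in> Cc1 U" and e: "\<And>x. x \<in> U \<Longrightarrow> norm (\<phi> x - \<psi> x) \<le> e"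
  shows "\<bar>div_pairing U u \<phi> - div_pairing U u \<psi>\<bar> \<le> M * e"
proof -
  \<comment> \<open>The total variation estimate needs a bound on the whole space. Outside
    \<open>U\<close> both fields vanish, so it remains to know that \<open>e\<close> is nonnegative,
    and a point of \<open>U\<close> shows this.\<close>
  have e0: "e \<ge> 0" using U(3) e norm_ge_zero order_trans by blast
  have eq: "\<phi> x - \<psi> x = 1 *\<^sub>R \<phi> x + (- 1) *\<^sub>R \<psi> x" for x by simp
  have "norm (1 *\<^sub>R \<phi> x + (- 1) *\<^sub>R \<psi> x) \<le> e" for x
  proof (cases "x \<in> U")
    case False
    hence "\<phi> x = 0" "\<psi> x = 0" using \<phi> by (auto simp: Cc1_def)
    thus ?thesis using e0 by simp
  qed (use e in \<open>simp add: eq[symmetric]\<close>)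
  from tv_bound[OF u(2) divergence_lincomb(1)[OF \<phi>] this]
  have "\<bar>div_pairing U u (\<lambda>x. 1 *\<^sub>R \<phi> x + (- 1) *\<^sub>R \<psi> x)\<bar> \<le> M * e" by (simp add: div_pairing_def)
  thus ?thesis unfolding div_pairing_lincomb[OF U(1,2) u(1) \<phi>] by simp
qed

text \<open>The pairing with the divergence extends from \<open>Cc1\<close> to \<open>C0\<close> by density. The bound holds for every
  majorant \<open>M\<close> of the total variation, so that it can be used uniformly along a sequence.\<close>

lemma deriv_measure_exists:
  fixes U :: "(real^'n) set"
  assumes U: "bounded U" "open U" "U \<noteq> {}" and u: "u \<in> BV U"
  obtains T where "deriv_measure U u T"
    "\<And>M \<phi> \<psi> e. tv U u \<le> ereal M \<Longrightarrow> \<phi> \<in> C0 U \<Longrightarrow> \<psi> \<in> Cc1 U \<Longrightarrow> (\<And>x. x \<in> U \<Longrightarrow> norm (\<psi> x - \<phi> x) \<le> e) \<Longrightarrow>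
       \<bar>div_pairing U u \<psi> - T \<phi>\<bar> \<le> M * e"
proof -
  have ui: "integrable (lebesgue_on U) u" using u by (simp add: BV_def)
  obtain M0 where M0: "tv U u \<le> ereal M0" using u tv_nonneg[of U u] by (cases "tv U u") (auto simp: BV_def)
  have M00: "M0 \<ge> 0" using order_trans[OF tv_nonneg M0] by simp
  let ?I = "div_pairing U u"
  have "\<exists>\<psi>\<in>Cc1 U. \<forall>x\<in>U. norm (\<psi> x - \<phi> x) \<le> inverse (Suc k)" if "\<phi> \<in> C0 U" for \<phi> k
    by (rule Cc1_dense_C0[OF U(1,2) that]) simp
  then obtain A where A: "\<And>\<phi> k. \<phi> \<in> C0 U \<Longrightarrow> A \<phi> k \<in> Cc1 U"
    "\<And>\<phi> k x. \<phi> \<in> C0 U \<Longrightarrow> x \<in> U \<Longrightarrow> norm (A \<phi> k x - \<phi> x) \<le> inverse (Suc k)" by metis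
  define T where "T \<phi> = lim (\<lambda>k. ?I (A \<phi> k))" for \<phi>
  have near: "\<bar>?I \<psi> - ?I (A \<phi> k)\<bar> \<le> M * (e + inverse (Suc k))"
    if "tv U u \<le> ereal M" "\<phi> \<in> C0 U" "\<psi> \<in> Cc1 U" "\<And>x. x \<in> U \<Longrightarrow> norm (\<psi> x - \<phi> x) \<le> e" for M \<phi> \<psi> e k
  proof (rule div_pairing_diff_bound[OF U ui that(1) that(3) A(1)[OF that(2)]])
    fix x assume "x \<in> U"
    thus "norm (\<psi> x - A \<phi> k x) \<le> e + inverse (Suc k)"
      using that(4)[of x] A(2)[OF that(2), of x k] norm_triangle_ineq4[of "\<psi> x - \<phi> x" "A \<phi> k x - \<phi> x"] by simp
  qed
  have lim: "(\<lambda>k. ?I (A \<phi> k)) \<longlonglongrightarrow> T \<phi>" if \<phi>: "\<phi> \<in> C0 U" for \<phi>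
  proof -
    have "Cauchy (\<lambda>k. ?I (A \<phi> k))"
    proof (rule metric_CauchyI)
      fix e :: real assume e: "e > 0"
      have "(\<lambda>k. M0 * (inverse (Suc k) + inverse (Suc k))) \<longlonglongrightarrow> M0 * (0 + 0)"
        by (intro tendsto_intros LIMSEQ_inverse_real_of_nat)
      from order_tendstoD(2)[OF this, of e] e obtain N where N: "M0 * (inverse (Suc N) + inverse (Suc N)) < e"
        by (auto simp: eventually_sequentially)
      have "dist (?I (A \<phi> m)) (?I (A \<phi> n)) < e" if "m \<ge> N" "n \<ge> N" for m n
      proof -
        have "\<bar>?I (A \<phi> m) - ?I (A \<phi> n)\<bar> \<le> M0 * (inverse (Suc m) + inverse (Suc n))"
          by (rule near[OF M0 \<phi> A(1)[OF \<phi>] A(2)[OF \<phi>]])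
        also have "\<dots> \<le> M0 * (inverse (Suc N) + inverse (Suc N))"
          using that M00 by (intro mult_left_mono add_mono le_imp_inverse_le) auto
        finally show ?thesis using N by (simp add: dist_real_def)
      qed
      thus "\<exists>N. \<forall>m\<ge>N. \<forall>n\<ge>N. dist (?I (A \<phi> m)) (?I (A \<phi> n)) < e" by blast
    qed
    thus ?thesis unfolding T_def using Cauchy_convergent convergent_LIMSEQ_iff by blast
  qed
  have est: "\<bar>?I \<psi> - T \<phi>\<bar> \<le> M * e"
    if "tv U u \<le> ereal M" "\<phi> \<in> C0 U" "\<psi> \<in> Cc1 U" "\<And>x. x \<in> U \<Longrightarrow> norm (\<psi> x - \<phi> x) \<le> e" for M \<phi> \<psi> e
  proof (rule LIMSEQ_le)
    show "(\<lambda>k. \<bar>?I \<psi> - ?I (A \<phi> k)\<bar>) \<longlonglongrightarrow> \<bar>?I \<psi> - T \<phi>\<bar>" by (intro tendsto_intros lim that)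
    have "(\<lambda>k. M * (e + inverse (Suc k))) \<longlonglongrightarrow> M * (e + 0)" by (intro tendsto_intros LIMSEQ_inverse_real_of_nat)
    thus "(\<lambda>k. M * (e + inverse (Suc k))) \<longlonglongrightarrow> M * e" by simp
  qed (use near[OF that] in auto)
  \<comment> \<open>A test field approximates itself with error \<open>0\<close>, and
    \<open>est\<close> then forces equality.\<close>
  have ext: "T \<phi> = ?I \<phi>" if "\<phi> \<in> Cc1 U" for \<phi>
  proof -
    have "\<phi> \<in> C0 U" using that Cc1_subset_C0 by blast
    from est[OF M0 this that, of 0] show ?thesis by simp
  qed
  have add: "T (\<lambda>x. \<phi> x + \<psi> x) = T \<phi> + T \<psi>" if \<phi>: "\<phi> \<in> C0 U" and \<psi>: "\<psi> \<in> C0 U" for \<phi> \<psi>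
  proof -
    have "T (\<lambda>x. \<phi> x + \<psi> x) - (T \<phi> + T \<psi>) = 0"
    proof (rule abs_le_all_eps_imp_0[where M="4 * M0"])
      fix e :: real assume "e > 0"
      then obtain p q where p: "p \<in> Cc1 U" "\<And>x. x \<in> U \<Longrightarrow> norm (p x - \<phi> x) \<le> e"
         and q: "q \<in> Cc1 U" "\<And>x. x \<in> U \<Longrightarrow> norm (q x - \<psi> x) \<le> e"
        using Cc1_dense_C0[OF U(1,2)] \<phi> \<psi> by metis
      have "\<bar>?I (\<lambda>x. 1 *\<^sub>R p x + 1 *\<^sub>R q x) - T (\<lambda>x. \<phi> x + \<psi> x)\<bar> \<le> M0 * (e + e)"
      proof (rule est[OF M0 C0_add_scale(1)[OF \<phi> \<psi>] divergence_lincomb(1)[OF p(1) q(1)]])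
        fix x assume "x \<in> U"
        thus "norm (1 *\<^sub>R p x + 1 *\<^sub>R q x - (\<phi> x + \<psi> x)) \<le> e + e"
          using p(2)[of x] q(2)[of x] norm_triangle_ineq[of "p x - \<phi> x" "q x - \<psi> x"] by (simp add: algebra_simps)
      qed
      thus "\<bar>T (\<lambda>x. \<phi> x + \<psi> x) - (T \<phi> + T \<psi>)\<bar> \<le> 4 * M0 * e"
        using est[OF M0 \<phi> p] est[OF M0 \<psi> q] unfolding div_pairing_lincomb[OF U(1,2) ui p(1) q(1)]
        by (simp add: algebra_simps abs_le_iff)
    qed
    thus ?thesis by simp
  qed
  have scale: "T (\<lambda>x. c *\<^sub>R \<phi> x) = c * T \<phi>" if \<phi>: "\<phi> \<in> C0 U" for c \<phi>
  proof -
    have "T (\<lambda>x. c *\<^sub>R \<phi> x) - c * T \<phi> = 0"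
    proof (rule abs_le_all_eps_imp_0[where M="2 * \<bar>c\<bar> * M0"])
      fix e :: real assume "e > 0"
      then obtain p where p: "p \<in> Cc1 U" "\<And>x. x \<in> U \<Longrightarrow> norm (p x - \<phi> x) \<le> e"
        using Cc1_dense_C0[OF U(1,2)] \<phi> by metis
      have "\<bar>?I (\<lambda>x. c *\<^sub>R p x + 0 *\<^sub>R p x) - T (\<lambda>x. c *\<^sub>R \<phi> x)\<bar> \<le> M0 * (\<bar>c\<bar> * e)"
      proof (rule est[OF M0 C0_add_scale(2)[OF \<phi>] divergence_lincomb(1)[OF p(1) p(1)]])
        fix x assume "x \<in> U"
        thus "norm (c *\<^sub>R p x + 0 *\<^sub>R p x - c *\<^sub>R \<phi> x) \<le> \<bar>c\<bar> * e"
          using mult_left_mono[OF p(2)[of x], of "\<bar>c\<bar>"] by (simp add: scaleR_diff_right[symmetric])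
      qed
      hence 1: "\<bar>c * ?I p - T (\<lambda>x. c *\<^sub>R \<phi> x)\<bar> \<le> M0 * (\<bar>c\<bar> * e)"
        unfolding div_pairing_lincomb[OF U(1,2) ui p(1) p(1)] by simp
      have "\<bar>c * ?I p - c * T \<phi>\<bar> = \<bar>c\<bar> * \<bar>?I p - T \<phi>\<bar>" by (simp add: right_diff_distrib[symmetric] abs_mult)
      also have "\<dots> \<le> \<bar>c\<bar> * (M0 * e)" by (intro mult_left_mono est[OF M0 \<phi> p]) auto
      finally have 2: "\<bar>c * ?I p - c * T \<phi>\<bar> \<le> M0 * (\<bar>c\<bar> * e)" by (simp add: mult_ac)
      from 1 2 have "\<bar>T (\<lambda>x. c *\<^sub>R \<phi> x) - c * T \<phi>\<bar> \<le> 2 * (M0 * (\<bar>c\<bar> * e))" by linarith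
      thus "\<bar>T (\<lambda>x. c *\<^sub>R \<phi> x) - c * T \<phi>\<bar> \<le> 2 * \<bar>c\<bar> * M0 * e" by (simp add: mult_ac)
    qed
    thus ?thesis by simp
  qed
  have bound: "\<bar>T \<phi>\<bar> \<le> M0 * (SUP x\<in>U. norm (\<phi> x))" if \<phi>: "\<phi> \<in> C0 U" for \<phi>
  proof -
    \<comment> \<open>Comparison with the zero field, whose distance to \<open>\<phi>\<close> is the
      sup norm.\<close>
    have "\<bar>?I (\<lambda>x. 0) - T \<phi>\<bar> \<le> M0 * (SUP x\<in>U. norm (\<phi> x))"
      by (rule est[OF M0 \<phi> zero_in_Cc1]) (simp add: C0_norm_le_Sup[OF \<phi>])
    moreover have "?I (\<lambda>x. 0) = 0" by (simp add: div_pairing_def divergence_def)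
    ultimately show ?thesis by simp
  qed
  have "deriv_measure U u T"
    unfolding deriv_measure_def dual_C0_def
  proof (intro conjI ballI allI exI[of _ M0])
    show "T \<phi> = - (\<integral>x. u x * divergence \<phi> x \<partial>lebesgue_on U)" if "\<phi> \<in> Cc1 U" for \<phi>
      using ext[OF that] by (simp add: div_pairing_def)
  qed (use add scale bound in auto)
  thus ?thesis by (rule that) (rule est)
qed

text \<open>On \<open>Cc1\<close> fields, convergence of the derivatives is convergence of integrals
  against a continuous function. A \<open>C0\<close> field is replaced by a nearby
  \<open>Cc1\<close> field with an error controlled by the common bound \<open>M\<close>, which is
  required only from some index on.\<close>

lemma weakstar_BV_I:
  fixes U :: "(real^'n) set"
  assumes U: "bounded U" "open U" "U \<noteq> {}" and v: "\<And>j. v j \<in> BV U" and u: "integrable (lebesgue_on U) u"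
    and lim: "(\<lambda>j. \<integral>x. \<bar>v j x - u x\<bar> \<partial>lebesgue_on U) \<longlonglongrightarrow> 0"
    and M: "\<forall>\<^sub>F j in sequentially. tv U (v j) \<le> ereal M"
  shows "weakstar_BV U v u"
proof -
  have vi: "integrable (lebesgue_on U) (v j)" for j using v by (simp add: BV_def)
  have tvu: "tv U u \<le> ereal M" by (rule tv_lower_semicontinuous[OF U(1,2) vi u lim M])
  have uBV: "u \<in> BV U" using u tvu by (auto simp: BV_def)
  have "\<exists>T. deriv_measure U u T \<and> (\<forall>M \<phi> \<psi> e. tv U u \<le> ereal M \<longrightarrow> \<phi> \<in> C0 U \<longrightarrow> \<psi> \<in> Cc1 U \<longrightarrow>
      (\<forall>x\<in>U. norm (\<psi> x - \<phi> x) \<le> e) \<longrightarrow> \<bar>div_pairing U u \<psi> - T \<phi>\<bar> \<le> M * e)" if "u \<in> BV U" for u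
    by (rule deriv_measure_exists[OF U that]) blast
  note ex = this
  obtain Du where Du: "deriv_measure U u Du" "\<And>\<phi> \<psi> e. \<phi> \<in> C0 U \<Longrightarrow> \<psi> \<in> Cc1 U \<Longrightarrow> (\<forall>x\<in>U. norm (\<psi> x - \<phi> x) \<le> e) \<Longrightarrow>
       \<bar>div_pairing U u \<psi> - Du \<phi>\<bar> \<le> M * e" using ex[OF uBV] tvu by blast
  have "\<forall>j. \<exists>T. deriv_measure U (v j) T \<and> (\<forall>M \<phi> \<psi> e. tv U (v j) \<le> ereal M \<longrightarrow> \<phi> \<in> C0 U \<longrightarrow> \<psi> \<in> Cc1 U \<longrightarrow>
      (\<forall>x\<in>U. norm (\<psi> x - \<phi> x) \<le> e) \<longrightarrow> \<bar>div_pairing U (v j) \<psi> - T \<phi>\<bar> \<le> M * e)" using ex v by blast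
  from choice[OF this] obtain Dv where Dv: "\<And>j. deriv_measure U (v j) (Dv j)"
    "\<And>j M \<phi> \<psi> e. tv U (v j) \<le> ereal M \<Longrightarrow> \<phi> \<in> C0 U \<Longrightarrow> \<psi> \<in> Cc1 U \<Longrightarrow> (\<forall>x\<in>U. norm (\<psi> x - \<phi> x) \<le> e) \<Longrightarrow>
       \<bar>div_pairing U (v j) \<psi> - Dv j \<phi>\<bar> \<le> M * e" by blast
  have M0: "M \<ge> 0" using order_trans[OF tv_nonneg tvu] by simp
  have "(\<lambda>j. Dv j \<phi>) \<longlonglongrightarrow> Du \<phi>" if \<phi>: "\<phi> \<in> C0 U" for \<phi>
  proof (rule tendstoI)
    fix e :: real assume e: "e > 0"
    define d where "d = e / (3 * (M + 1))"
    have d: "d > 0" "M * d \<le> e / 3" using e M0 by (auto simp: d_def field_simps)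
    obtain \<psi> where \<psi>: "\<psi> \<in> Cc1 U" "\<forall>x\<in>U. norm (\<psi> x - \<phi> x) \<le> d" using Cc1_dense_C0[OF U(1,2) \<phi> d(1)] by blast
    have "(\<lambda>j. div_pairing U (v j) \<psi>) \<longlonglongrightarrow> div_pairing U u \<psi>"
      unfolding div_pairing_def using U
      by (intro tendsto_minus L1_limit_test vi u lim continuous_on_divergence[OF \<psi>(1)]) auto
    from tendstoD[OF this, of "e / 3"] e have "\<forall>\<^sub>F j in sequentially. dist (div_pairing U (v j) \<psi>) (div_pairing U u \<psi>) < e / 3" by simp
    with M show "\<forall>\<^sub>F j in sequentially. dist (Dv j \<phi>) (Du \<phi>) < e"
    proof eventually_elim
      case (elim j)
      show ?case using elim(2) Dv(2)[OF elim(1) \<phi> \<psi>] Du(2)[OF \<phi> \<psi>] d(2) unfolding dist_real_def by linarith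
    qed
  qed
  thus ?thesis unfolding weakstar_BV_def using v uBV lim Dv(1) Du(1) by blast
qed

section \<open>The Hilbert space structure and strong convexity\<close>

lemma L2_measurable: "u \<in> L2 U \<Longrightarrow> u \<in> borel_measurable (lebesgue_on U)"
  by (simp add: L2_def)

lemma L2_integrable: "bounded U \<Longrightarrow> open U \<Longrightarrow> u \<in> L2 U \<Longrightarrow> integrable (lebesgue_on U) u"
  by (rule L2_imp_integrable(1)) (simp_all add: L2_def)

lemma L2_mult_integrable:
  assumes "u \<in> L2 U" "v \<in> L2 U"
  shows "integrable (lebesgue_on U) (\<lambda>x. u x * v x)"
proof (rule Bochner_Integration.integrable_bound)
  note [measurable] = L2_measurable[OF assms(1)] L2_measurable[OF assms(2)]
  show "integrable (lebesgue_on U) (\<lambda>x. (u x)\<^sup>2 + (v x)\<^sup>2)" using assms by (simp add: L2_def)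
  show "(\<lambda>x. u x * v x) \<in> borel_measurable (lebesgue_on U)" by measurable
  have "\<bar>a * b\<bar> \<le> a\<^sup>2 + b\<^sup>2" for a b :: real
  proof -
    have "2 * \<bar>a * b\<bar> \<le> a\<^sup>2 + b\<^sup>2" using sum_squares_bound[of "\<bar>a\<bar>" "\<bar>b\<bar>"] by (simp add: abs_mult)
    thus ?thesis using abs_ge_zero[of "a * b"] by linarith
  qed
  thus "AE x in lebesgue_on U. norm (u x * v x) \<le> norm ((u x)\<^sup>2 + (v x)\<^sup>2)" by simp
qed

lemma L2_lincomb:
  assumes "u \<in> L2 U" "v \<in> L2 U"
  shows "(\<lambda>x. a * u x + b * v x) \<in> L2 U"
proof -
  note [measurable] = L2_measurable[OF assms(1)] L2_measurable[OF assms(2)]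
  have "(\<lambda>x. (a * u x + b * v x)\<^sup>2) = (\<lambda>x. a\<^sup>2 * (u x)\<^sup>2 + (2 * a * b) * (u x * v x) + b\<^sup>2 * (v x)\<^sup>2)"
    by (auto simp: power2_eq_square algebra_simps)
  moreover have "integrable (lebesgue_on U) (\<lambda>x. a\<^sup>2 * (u x)\<^sup>2 + (2 * a * b) * (u x * v x) + b\<^sup>2 * (v x)\<^sup>2)"
    using assms L2_mult_integrable[OF assms]
    by (intro Bochner_Integration.integrable_add integrable_mult_right) (auto simp: L2_def)
  ultimately show ?thesis by (simp add: L2_def)
qed

lemma L2_diff: "u \<in> L2 U \<Longrightarrow> v \<in> L2 U \<Longrightarrow> (\<lambda>x. u x - v x) \<in> L2 U"
  using L2_lincomb[of u U v 1 "-1"] by simp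

lemma inner_L2_lincomb:
  assumes "u \<in> L2 U" "v \<in> L2 U" "w \<in> L2 U"
  shows "inner_L2 U (\<lambda>x. a * u x + b * v x) w = a * inner_L2 U u w + b * inner_L2 U v w"
proof -
  have "inner_L2 U (\<lambda>x. a * u x + b * v x) w = (\<integral>x. a * (u x * w x) + b * (v x * w x) \<partial>lebesgue_on U)"
    unfolding inner_L2_def by (simp add: algebra_simps)
  also have "\<dots> = a * inner_L2 U u w + b * inner_L2 U v w"
    using L2_mult_integrable[OF assms(1,3)] L2_mult_integrable[OF assms(2,3)]
    unfolding inner_L2_def by (subst Bochner_Integration.integral_add) auto
  finally show ?thesis .
qed

lemma inner_L2_commute: "inner_L2 U u v = inner_L2 U v u"
  by (simp add: inner_L2_def mult.commute)

lemma inner_L2_diff_left: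
  "u \<in> L2 U \<Longrightarrow> v \<in> L2 U \<Longrightarrow> w \<in> L2 U \<Longrightarrow> inner_L2 U (\<lambda>x. u x - v x) w = inner_L2 U u w - inner_L2 U v w"
  using inner_L2_lincomb[of u U v w 1 "-1"] by simp

lemma inner_L2_diff_right:
  "u \<in> L2 U \<Longrightarrow> v \<in> L2 U \<Longrightarrow> w \<in> L2 U \<Longrightarrow> inner_L2 U w (\<lambda>x. u x - v x) = inner_L2 U w u - inner_L2 U w v"
  using inner_L2_diff_left[of u U v w] by (simp add: inner_L2_commute)

lemma inner_L2_nonneg: "inner_L2 U u u \<ge> 0"
  unfolding inner_L2_def by (intro integral_nonneg_AE) auto

lemma norm_L2_nonneg: "norm_L2 U u \<ge> 0"
  by (simp add: norm_L2_def inner_L2_nonneg)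

lemma norm_L2_sq: "(norm_L2 U u)\<^sup>2 = inner_L2 U u u"
  by (simp add: norm_L2_def inner_L2_nonneg)

lemma norm_L2_lincomb_sq:
  assumes "u \<in> L2 U" "v \<in> L2 U"
  shows "(norm_L2 U (\<lambda>x. a * u x + b * v x))\<^sup>2 = a\<^sup>2 * (norm_L2 U u)\<^sup>2 + 2 * a * b * inner_L2 U u v + b\<^sup>2 * (norm_L2 U v)\<^sup>2"
proof -
  let ?w = "\<lambda>x. a * u x + b * v x"
  have w: "?w \<in> L2 U" by (rule L2_lincomb[OF assms])
  have "inner_L2 U ?w ?w = a * inner_L2 U ?w u + b * inner_L2 U ?w v"
    by (simp add: inner_L2_lincomb[OF assms w] inner_L2_commute[of U _ ?w])
  also have "inner_L2 U ?w u = a * inner_L2 U u u + b * inner_L2 U u v"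
    by (simp add: inner_L2_lincomb[OF assms assms(1)] inner_L2_commute[of U v u])
  also have "inner_L2 U ?w v = a * inner_L2 U u v + b * inner_L2 U v v"
    by (simp add: inner_L2_lincomb[OF assms assms(2)])
  finally show ?thesis unfolding norm_L2_sq by (simp add: algebra_simps power2_eq_square)
qed

lemma Cauchy_Schwarz_L2:
  assumes "u \<in> L2 U" "v \<in> L2 U"
  shows "\<bar>inner_L2 U u v\<bar> \<le> norm_L2 U u * norm_L2 U v"
proof -
  let ?a = "norm_L2 U u" and ?b = "norm_L2 U v" and ?i = "inner_L2 U u v"
  have q: "0 \<le> s\<^sup>2 * ?a\<^sup>2 + 2 * s * t * ?i + t\<^sup>2 * ?b\<^sup>2" for s t
    using norm_L2_lincomb_sq[OF assms, of s t] zero_le_power2 by metis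
  have le: "?i\<^sup>2 \<le> (?a * ?b)\<^sup>2"
  proof (cases "?b = 0")
    case True
    \<comment> \<open>On functions \<open>norm_L2\<close> is only a seminorm, so
      \<open>?b = 0\<close> does not give \<open>v = 0\<close>. The quadratic form is then affine in
      \<open>t\<close> and can stay nonnegative only if its slope vanishes.\<close>
    have "?i = 0"
    proof (rule ccontr)
      assume i: "?i \<noteq> 0"
      have "0 \<le> ?a\<^sup>2 + 2 * (- (?a\<^sup>2 + 1) / (2 * ?i)) * ?i" using q[of 1 "- (?a\<^sup>2 + 1) / (2 * ?i)"] True by simp
      also have "\<dots> = - 1" using i by (simp add: field_simps)
      finally show False by simp
    qed
    thus ?thesis by simp
  next
    case False
    have "0 \<le> (?b\<^sup>2)\<^sup>2 * ?a\<^sup>2 + 2 * ?b\<^sup>2 * (- ?i) * ?i + (- ?i)\<^sup>2 * ?b\<^sup>2" by (rule q)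
    hence "0 \<le> ?b\<^sup>2 * (?b\<^sup>2 * ?a\<^sup>2 - ?i\<^sup>2)" by (simp add: algebra_simps power2_eq_square)
    moreover have "?b\<^sup>2 > 0" using False by simp
    ultimately have "0 \<le> ?b\<^sup>2 * ?a\<^sup>2 - ?i\<^sup>2" by (simp add: zero_le_mult_iff)
    thus ?thesis by (simp add: power_mult_distrib mult.commute)
  qed
  have "0 \<le> ?a * ?b" by (intro mult_nonneg_nonneg norm_L2_nonneg)
  with le show ?thesis by (metis abs_le_square_iff abs_of_nonneg)
qed

lemma norm_L2_triangle:
  assumes "u \<in> L2 U" "v \<in> L2 U"
  shows "norm_L2 U (\<lambda>x. u x + v x) \<le> norm_L2 U u + norm_L2 U v"
proof (rule power2_le_imp_le)
  have "(norm_L2 U (\<lambda>x. u x + v x))\<^sup>2 = (norm_L2 U u)\<^sup>2 + 2 * inner_L2 U u v + (norm_L2 U v)\<^sup>2"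
    using norm_L2_lincomb_sq[OF assms, of 1 1] by simp
  also have "\<dots> \<le> (norm_L2 U u)\<^sup>2 + 2 * (norm_L2 U u * norm_L2 U v) + (norm_L2 U v)\<^sup>2"
    using Cauchy_Schwarz_L2[OF assms] by auto
  finally show "(norm_L2 U (\<lambda>x. u x + v x))\<^sup>2 \<le> (norm_L2 U u + norm_L2 U v)\<^sup>2" by (simp add: power2_sum algebra_simps)
qed (auto intro: add_nonneg_nonneg norm_L2_nonneg)

lemma dist_L2_nonneg: "dist_L2 U u v \<ge> 0"
  by (simp add: dist_L2_def norm_L2_nonneg)

lemma dist_L2_commute: "dist_L2 U u v = dist_L2 U v u"
  by (simp add: dist_L2_def norm_L2_def inner_L2_def algebra_simps)

lemma dist_L2_triangle:
  assumes "u \<in> L2 U" "v \<in> L2 U" "w \<in> L2 U"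
  shows "dist_L2 U u w \<le> dist_L2 U u v + dist_L2 U v w"
  using norm_L2_triangle[OF L2_diff[OF assms(1,2)] L2_diff[OF assms(2,3)]] by (simp add: dist_L2_def)

lemma inner_L2_ae_cong:
  assumes "ae_eq U u u'" "u \<in> L2 U" "u' \<in> L2 U" "v \<in> L2 U"
  shows "inner_L2 U u v = inner_L2 U u' v"
proof -
  note [measurable] = L2_measurable[OF assms(2)] L2_measurable[OF assms(3)] L2_measurable[OF assms(4)]
  show ?thesis unfolding inner_L2_def using assms(1) unfolding ae_eq_def
    by (intro integral_cong_AE) (auto elim: eventually_mono)
qed

text \<open>Needed because the first iterate represents the prescribed starting value only up to a
  null set.\<close>

lemma tv_ae_cong:
  fixes U :: "(real^'n) set"
  assumes "open U" "ae_eq U u u'" "u \<in> L2 U" "u' \<in> L2 U"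
  shows "tv U u = tv U u'"
proof -
  note [measurable] = L2_measurable[OF assms(3)] L2_measurable[OF assms(4)]
  have "(\<integral>x. u x * divergence \<phi> x \<partial>lebesgue_on U) = (\<integral>x. u' x * divergence \<phi> x \<partial>lebesgue_on U)" if "\<phi> \<in> Cc1 U" for \<phi>
  proof -
    have [measurable]: "divergence \<phi> \<in> borel_measurable (lebesgue_on U)"
      using assms(1) by (intro continuous_imp_measurable_on_sets_lebesgue continuous_on_divergence[OF that]) auto
    show ?thesis using assms(2) unfolding ae_eq_def
      by (intro integral_cong_AE) (auto elim: eventually_mono)
  qed
  thus ?thesis unfolding tv_def by (intro SUP_cong) auto
qed

lemma tv_convex:
  fixes U :: "(real^'n) set"
  assumes U: "bounded U" "open U" and u: "u \<in> L2 U" "v \<in> L2 U" and ab: "tv U u \<le> ereal a" "tv U v \<le> ereal b" and t: "0 \<le> t" "t \<le> 1"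
  shows "tv U (\<lambda>x. (1 - t) * u x + t * v x) \<le> ereal ((1 - t) * a + t * b)"
proof (rule tv_leI)
  fix \<phi> assume \<phi>: "\<phi> \<in> Cc1 U" "\<And>x. norm (\<phi> x) \<le> 1"
  let ?I = "\<lambda>u. \<integral>x. u x * divergence \<phi> x \<partial>lebesgue_on U"
  have i: "integrable (lebesgue_on U) (\<lambda>x. c * (u x * divergence \<phi> x))" if "u \<in> L2 U" for u c
  proof -
    have "integrable (lebesgue_on U) u" by (rule L2_integrable[OF U that])
    moreover have "U \<in> sets lebesgue" using U by simp
    ultimately show ?thesis
      by (intro integrable_mult_right integrable_mult_continuous[OF U(1)] continuous_on_divergence[OF \<phi>(1)])
  qed
  have "?I (\<lambda>x. (1 - t) * u x + t * v x) = (\<integral>x. (1 - t) * (u x * divergence \<phi> x) + t * (v x * divergence \<phi> x) \<partial>lebesgue_on U)"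
    by (simp add: algebra_simps)
  also have "\<dots> = (1 - t) * ?I u + t * ?I v"
    unfolding Bochner_Integration.integral_add[OF i[OF u(1)] i[OF u(2)]] by simp
  also have "\<dots> \<le> (1 - t) * a + t * b"
    using tv_bound[OF ab(1) \<phi>] tv_bound[OF ab(2) \<phi>] t by (intro add_mono mult_left_mono) auto
  finally show "?I (\<lambda>x. (1 - t) * u x + t * v x) \<le> (1 - t) * a + t * b" .
qed

lemma dom_hTV_E:
  assumes "u \<in> dom_L2 U (hTV U)"
  obtains a where "u \<in> L2 U" "a \<ge> 0" "tv U u = ereal a" "hTV U u = ereal (1/2 * (norm_L2 U u)\<^sup>2 + a)"
proof -
  have u: "u \<in> L2 U" "hTV U u < \<infinity>" using assms by (auto simp: dom_L2_def)
  then obtain a where a: "tv U u = ereal a" using tv_nonneg[of U u] by (cases "tv U u") (auto simp: hTV_def)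
  have "a \<ge> 0" using tv_nonneg[of U u] a by simp
  thus ?thesis using that u a by (simp add: hTV_def)
qed

text \<open>\<open>h\<close> inherits the strong convexity of its quadratic part: the subgradient inequality along the segment
  from \<open>u\<close> to \<open>v\<close>, divided by \<open>t\<close> and with \<open>t \<rightarrow> 0\<close>, isolates the total variation part.\<close>

lemma bregman_hTV_ge:
  fixes U :: "(real^'n) set"
  assumes U: "bounded U" "open U" and \<xi>: "\<xi> \<in> subdiff_L2 U (hTV U) u" and v: "v \<in> dom_L2 U (hTV U)"
  obtains d where "bregman U (hTV U) \<xi> v u = ereal d" "d \<ge> 1/2 * (dist_L2 U v u)\<^sup>2"
    "d = real_of_ereal (hTV U v) - real_of_ereal (hTV U u) - inner_L2 U \<xi> (\<lambda>x. v x - u x)"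
proof -
  have u: "u \<in> dom_L2 U (hTV U)" and \<xi>2: "\<xi> \<in> L2 U"
    and sub: "\<And>v. v \<in> L2 U \<Longrightarrow> hTV U u + ereal (inner_L2 U \<xi> (\<lambda>x. v x - u x)) \<le> hTV U v"
    using \<xi> by (auto simp: subdiff_L2_def)
  obtain a where a: "u \<in> L2 U" "tv U u = ereal a" "hTV U u = ereal (1/2 * (norm_L2 U u)\<^sup>2 + a)" using dom_hTV_E[OF u] .
  obtain b where b: "v \<in> L2 U" "tv U v = ereal b" "hTV U v = ereal (1/2 * (norm_L2 U v)\<^sup>2 + b)" using dom_hTV_E[OF v] .
  let ?d = "\<lambda>x. v x - u x"
  let ?N = "norm_L2 U ?d"
  have d2: "?d \<in> L2 U" by (rule L2_diff[OF b(1) a(1)])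
  have ineq: "inner_L2 U \<xi> ?d \<le> inner_L2 U u ?d + (b - a) + t / 2 * ?N\<^sup>2" if t: "0 < t" "t \<le> 1" for t
  proof -
    let ?v = "\<lambda>x. (1 - t) * u x + t * v x"
    have eq: "?v x = 1 * u x + t * ?d x" for x by (simp add: algebra_simps)
    have n: "(norm_L2 U ?v)\<^sup>2 = (norm_L2 U u)\<^sup>2 + 2 * t * inner_L2 U u ?d + t\<^sup>2 * ?N\<^sup>2"
      unfolding eq norm_L2_lincomb_sq[OF a(1) d2] by simp
    have v2: "?v \<in> L2 U" using L2_lincomb[OF a(1) b(1)] .
    have "inner_L2 U \<xi> (\<lambda>x. ?v x - u x) = t * inner_L2 U \<xi> ?d"
      unfolding inner_L2_def by (subst integral_mult_right_zero[symmetric]) (simp add: algebra_simps)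
    with sub[OF v2] have "ereal (1/2 * (norm_L2 U u)\<^sup>2 + a + t * inner_L2 U \<xi> ?d) \<le> hTV U ?v" using a by simp
    also have "\<dots> \<le> ereal (1/2 * (norm_L2 U ?v)\<^sup>2) + ereal ((1 - t) * a + t * b)"
      unfolding hTV_def using t a b by (intro add_left_mono tv_convex U) auto
    finally have "1/2 * (norm_L2 U u)\<^sup>2 + a + t * inner_L2 U \<xi> ?d \<le> 1/2 * (norm_L2 U ?v)\<^sup>2 + ((1 - t) * a + t * b)"
      by (simp only: plus_ereal.simps ereal_less_eq)
    hence "a + t * inner_L2 U \<xi> ?d \<le> t * inner_L2 U u ?d + t\<^sup>2 / 2 * ?N\<^sup>2 + (1 - t) * a + t * b"
      unfolding n by (simp add: add_divide_distrib)
    hence "t * inner_L2 U \<xi> ?d \<le> t * (inner_L2 U u ?d + (b - a) + t / 2 * ?N\<^sup>2)"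
      by (simp add: algebra_simps power2_eq_square)
    thus ?thesis using t by simp
  qed
  have lim: "inner_L2 U \<xi> ?d \<le> inner_L2 U u ?d + (b - a)"
  proof (rule field_le_epsilon)
    fix e :: real assume e: "e > 0"
    define t where "t = min 1 (e / (?N\<^sup>2 + 1))"
    have pos: "?N\<^sup>2 + 1 > 0" by (intro add_nonneg_pos) auto
    have t: "0 < t" "t \<le> 1" using e pos by (auto simp: t_def)
    have "t * (?N\<^sup>2 + 1) \<le> e" using pos by (simp add: t_def pos_le_divide_eq[symmetric])
    hence "t / 2 * ?N\<^sup>2 \<le> e" using t e by (simp add: algebra_simps)
    with ineq[OF t] show "inner_L2 U \<xi> ?d \<le> inner_L2 U u ?d + (b - a) + e" by linarith
  qed
  let ?D = "real_of_ereal (hTV U v) - real_of_ereal (hTV U u) - inner_L2 U \<xi> ?d"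
  \<comment> \<open>Expanding the norm of \<open>v\<close> around \<open>u\<close> leaves exactly
    half the squared distance; \<open>lim\<close> says that the remaining terms of the Bregman
    distance are nonnegative.\<close>
  have "v = (\<lambda>x. 1 * u x + 1 * ?d x)" by simp
  hence nv: "(norm_L2 U v)\<^sup>2 = (norm_L2 U u)\<^sup>2 + 2 * inner_L2 U u ?d + ?N\<^sup>2"
    using norm_L2_lincomb_sq[OF a(1) d2, of 1 1] by simp
  have "?D = (1/2 * (norm_L2 U v)\<^sup>2 + b) - (1/2 * (norm_L2 U u)\<^sup>2 + a) - inner_L2 U \<xi> ?d"
    by (simp only: a b real_of_ereal.simps)
  hence "?D \<ge> 1/2 * (dist_L2 U v u)\<^sup>2" using lim nv unfolding dist_L2_def by linarith
  moreover have "bregman U (hTV U) \<xi> v u = ereal ?D" unfolding bregman_def by (simp add: a b)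
  ultimately show ?thesis using that by blast
qed

section \<open>The Bregman iteration\<close>

text \<open>A single run at a fixed noise level. Conclusions that mention neither the noise nor the
  iterates become uniform once every noise level is instantiated.\<close>

locale bregman_landweber =
  fixes \<Omega> :: "(real^'n) set"
    and D :: "(real^'n \<Rightarrow> real) set"
    and F :: "(real^'n \<Rightarrow> real) \<Rightarrow> 'h::real_inner"
    and F' :: "(real^'n \<Rightarrow> real) \<Rightarrow> (real^'n \<Rightarrow> real) \<Rightarrow> 'h"
    and F'adj :: "(real^'n \<Rightarrow> real) \<Rightarrow> 'h \<Rightarrow> real^'n \<Rightarrow> real"
    and y yd :: 'h
    and ubar u0 \<xi>0 :: "real^'n \<Rightarrow> real"
    and \<eta> \<rho> \<gamma> \<tau> \<alpha>lo \<alpha>hi \<delta> :: real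
    and \<alpha> :: "nat \<Rightarrow> real"
    and u \<xi> :: "nat \<Rightarrow> real^'n \<Rightarrow> real"
  assumes bdd: "bounded \<Omega>" and opn: "open \<Omega>"
    and DL2: "D \<subseteq> L2 \<Omega>"
    and adj: "\<And>v. v \<in> D \<Longrightarrow> adjoint_L2 \<Omega> (F' v) (F'adj v)"
    and ubar: "ubar \<in> D" "F ubar = y" "ubar \<in> dom_L2 \<Omega> (hTV \<Omega>)"
    and pos: "\<eta> > 0" "\<rho> > 0" "\<gamma> > 0" "\<gamma> < 1 / \<eta>" "\<gamma> < \<rho> / 2" "\<alpha>lo > 0" "\<delta> > 0"
    and cone: "\<And>u v. u \<in> D \<Longrightarrow> v \<in> D \<Longrightarrow> dist_L2 \<Omega> u ubar < \<rho> \<Longrightarrow> dist_L2 \<Omega> v ubar < \<rho> \<Longrightarrow>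
        norm (F v - F u - F' u (\<lambda>x. v x - u x)) \<le> \<eta> * dist_L2 \<Omega> u v * norm (F u - F v)"
    and \<alpha>: "\<And>k. \<alpha>lo \<le> \<alpha> k" "\<And>k. \<alpha> k \<le> \<alpha>hi"
    and \<xi>0: "\<xi>0 \<in> subdiff_L2 \<Omega> (hTV \<Omega>) u0"
    and start: "bregman \<Omega> (hTV \<Omega>) \<xi>0 ubar u0 < ereal (\<gamma>\<^sup>2 / 8)"
    and noise: "norm (y - yd) < \<delta>"
    and iter: "bregman_iterates \<Omega> D F F'adj (hTV \<Omega>) \<alpha> u0 \<xi>0 yd u \<xi>"
    and \<tau>: "\<tau> > (1 + \<eta> * \<gamma>) / (1 - \<eta> * \<gamma>)"
begin

abbreviation "e k \<equiv> F (u k) - yd"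
abbreviation "gap k \<equiv> dist_L2 \<Omega> (u k) ubar"
abbreviation "hr v \<equiv> real_of_ereal (hTV \<Omega> v)"

definition "breg k = real_of_ereal (bregman \<Omega> (hTV \<Omega>) (\<xi> k) ubar (u k))"
definition "step k = real_of_ereal (bregman \<Omega> (hTV \<Omega>) (\<xi> k) (u (Suc k)) (u k))"
text \<open>The coefficient that survives in the descent estimate after \<open>\<delta>\<close> is
  replaced by the residual over \<open>\<tau>\<close>; the condition on \<open>\<tau>\<close> says
  that it is positive.\<close>

definition "decay = (1 - \<eta> * \<gamma>) - (1 + \<eta> * \<gamma>) / \<tau>"

lemma \<eta>\<gamma>: "\<eta> * \<gamma> < 1" "0 < \<eta> * \<gamma>"
  using pos by (auto simp: field_simps)

lemma \<tau>_gt_1: "\<tau> > 1"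
proof -
  have "(1 + \<eta> * \<gamma>) / (1 - \<eta> * \<gamma>) \<ge> 1" using \<eta>\<gamma> by (simp add: field_simps)
  thus ?thesis using \<tau> by linarith
qed

lemma decay_pos: "decay > 0"
proof -
  have "1 + \<eta> * \<gamma> < \<tau> * (1 - \<eta> * \<gamma>)" using \<tau> \<eta>\<gamma> by (simp add: pos_divide_less_eq)
  hence "(1 + \<eta> * \<gamma>) / \<tau> < 1 - \<eta> * \<gamma>" using \<tau>_gt_1 by (simp add: field_simps)
  thus ?thesis by (simp add: decay_def)
qed

lemma \<alpha>_pos: "\<alpha> k > 0"
  using \<alpha>(1)[of k] pos by linarith

lemma subgradient: "\<xi> k \<in> subdiff_L2 \<Omega> (hTV \<Omega>) (u k)"
  using iter by (simp add: bregman_iterates_def)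

lemma u_dom: "u k \<in> dom_L2 \<Omega> (hTV \<Omega>)"
  using subgradient by (simp add: subdiff_L2_def)

lemma u_D: "u k \<in> D"
proof (cases k)
  case 0
  thus ?thesis using iter by (simp add: bregman_iterates_def)
next
  case (Suc j)
  thus ?thesis using iter by (simp add: bregman_iterates_def is_arg_min_def)
qed

lemma L2s: "u k \<in> L2 \<Omega>" "\<xi> k \<in> L2 \<Omega>" "ubar \<in> L2 \<Omega>"
  using u_D DL2 subgradient ubar by (auto simp: subdiff_L2_def)

lemma breg:
  "bregman \<Omega> (hTV \<Omega>) (\<xi> k) ubar (u k) = ereal (breg k)"
  "breg k \<ge> 1/2 * (dist_L2 \<Omega> ubar (u k))\<^sup>2"
  "breg k = hr ubar - hr (u k) - inner_L2 \<Omega> (\<xi> k) (\<lambda>x. ubar x - u k x)"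
proof -
  obtain d where "bregman \<Omega> (hTV \<Omega>) (\<xi> k) ubar (u k) = ereal d" "d \<ge> 1/2 * (dist_L2 \<Omega> ubar (u k))\<^sup>2"
    "d = hr ubar - hr (u k) - inner_L2 \<Omega> (\<xi> k) (\<lambda>x. ubar x - u k x)"
    by (rule bregman_hTV_ge[OF bdd opn subgradient ubar(3)])
  moreover from this(1) have "breg k = d" by (simp add: breg_def)
  ultimately show "bregman \<Omega> (hTV \<Omega>) (\<xi> k) ubar (u k) = ereal (breg k)"
    "breg k \<ge> 1/2 * (dist_L2 \<Omega> ubar (u k))\<^sup>2"
    "breg k = hr ubar - hr (u k) - inner_L2 \<Omega> (\<xi> k) (\<lambda>x. ubar x - u k x)" by simp_all
qed

lemma step:
  "bregman \<Omega> (hTV \<Omega>) (\<xi> k) (u (Suc k)) (u k) = ereal (step k)"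
  "step k \<ge> 1/2 * (dist_L2 \<Omega> (u (Suc k)) (u k))\<^sup>2"
  "step k = hr (u (Suc k)) - hr (u k) - inner_L2 \<Omega> (\<xi> k) (\<lambda>x. u (Suc k) x - u k x)"
proof -
  obtain d where "bregman \<Omega> (hTV \<Omega>) (\<xi> k) (u (Suc k)) (u k) = ereal d" "d \<ge> 1/2 * (dist_L2 \<Omega> (u (Suc k)) (u k))\<^sup>2"
    "d = hr (u (Suc k)) - hr (u k) - inner_L2 \<Omega> (\<xi> k) (\<lambda>x. u (Suc k) x - u k x)"
    by (rule bregman_hTV_ge[OF bdd opn subgradient u_dom])
  moreover from this(1) have "step k = d" by (simp add: step_def)
  ultimately show "bregman \<Omega> (hTV \<Omega>) (\<xi> k) (u (Suc k)) (u k) = ereal (step k)"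
    "step k \<ge> 1/2 * (dist_L2 \<Omega> (u (Suc k)) (u k))\<^sup>2"
    "step k = hr (u (Suc k)) - hr (u k) - inner_L2 \<Omega> (\<xi> k) (\<lambda>x. u (Suc k) x - u k x)" by simp_all
qed

lemma step_nonneg: "step k \<ge> 0"
  using step(2)[of k] zero_le_power2[of "dist_L2 \<Omega> (u (Suc k)) (u k)"] by linarith

lemma argmin:
  assumes "v \<in> D"
  shows "ereal (1/2 * (norm (e (Suc k)))\<^sup>2) + ereal (\<alpha> k) * ereal (step k)
     \<le> ereal (1/2 * (norm (F v - yd))\<^sup>2) + ereal (\<alpha> k) * bregman \<Omega> (hTV \<Omega>) (\<xi> k) v (u k)"
proof -
  have "is_arg_min (\<lambda>v. ereal (1/2 * (norm (F v - yd))\<^sup>2) + ereal (\<alpha> k) * bregman \<Omega> (hTV \<Omega>) (\<xi> k) v (u k))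
      (\<lambda>v. v \<in> D) (u (Suc k))" using iter by (simp add: bregman_iterates_def)
  thus ?thesis using assms unfolding is_arg_min_def step(1) by (auto simp: not_less)
qed

section \<open>Monotone residuals and descent of the Bregman distance\<close>

text \<open>The previous iterate is an admissible competitor with Bregman penalty zero.\<close>

lemma residual_antimono: "j \<le> k \<Longrightarrow> norm (e k) \<le> norm (e j)"
proof (rule lift_Suc_antimono_le[of "\<lambda>k. norm (e k)"])
  fix k
  obtain d where "bregman \<Omega> (hTV \<Omega>) (\<xi> k) (u k) (u k) = ereal d"
    "d = hr (u k) - hr (u k) - inner_L2 \<Omega> (\<xi> k) (\<lambda>x. u k x - u k x)"
    by (rule bregman_hTV_ge[OF bdd opn subgradient u_dom])
  hence "bregman \<Omega> (hTV \<Omega>) (\<xi> k) (u k) (u k) = ereal 0" by (simp add: inner_L2_def)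
  with argmin[OF u_D[of k], of k]
  have "1/2 * (norm (e (Suc k)))\<^sup>2 + \<alpha> k * step k \<le> 1/2 * (norm (e k))\<^sup>2" by simp
  moreover have "\<alpha> k * step k \<ge> 0" using \<alpha>_pos[of k] step_nonneg by (intro mult_nonneg_nonneg) auto
  ultimately have "(norm (e (Suc k)))\<^sup>2 \<le> (norm (e k))\<^sup>2" by linarith
  thus "norm (e (Suc k)) \<le> norm (e k)" by (rule power2_le_imp_le) simp
qed

text \<open>The competitor is \<open>ubar\<close>, whose residual is just the noise.\<close>

lemma step_le: "1/2 * (norm (e (Suc k)))\<^sup>2 + \<alpha> k * step k \<le> 1/2 * \<delta>\<^sup>2 + \<alpha> k * breg k"
proof -
  have "1/2 * (norm (e (Suc k)))\<^sup>2 + \<alpha> k * step k \<le> 1/2 * (norm (y - yd))\<^sup>2 + \<alpha> k * breg k"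
    using argmin[OF ubar(1), of k] by (simp add: breg(1) ubar(2))
  moreover have "(norm (y - yd))\<^sup>2 \<le> \<delta>\<^sup>2" using noise by (intro power_mono) auto
  ultimately show ?thesis by linarith
qed

text \<open>The update is prescribed only almost everywhere, so it is used through pairings; the
  adjoint relation turns the correction into an inner product in \<open>'h\<close>.\<close>

lemma xi_step:
  assumes "v \<in> L2 \<Omega>"
  shows "inner_L2 \<Omega> (\<xi> (Suc k)) v = inner_L2 \<Omega> (\<xi> k) v - 1 / \<alpha> k * (F' (u (Suc k)) v \<bullet> e (Suc k))"
proof -
  let ?B = "F'adj (u (Suc k)) (e (Suc k))"
  have B: "?B \<in> L2 \<Omega>" "F' (u (Suc k)) v \<bullet> e (Suc k) = inner_L2 \<Omega> v ?B"
    using adj[OF u_D[of "Suc k"]] assms by (auto simp: adjoint_L2_def)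
  have ae: "ae_eq \<Omega> (\<xi> (Suc k)) (\<lambda>x. \<xi> k x - 1 / \<alpha> k * ?B x)" using iter by (simp add: bregman_iterates_def)
  have eq: "(\<lambda>x. \<xi> k x - 1 / \<alpha> k * ?B x) = (\<lambda>x. 1 * \<xi> k x + (- 1 / \<alpha> k) * ?B x)" by simp
  have "inner_L2 \<Omega> (\<xi> (Suc k)) v = inner_L2 \<Omega> (\<lambda>x. 1 * \<xi> k x + (- 1 / \<alpha> k) * ?B x) v"
    using ae unfolding eq by (rule inner_L2_ae_cong[OF _ L2s(2) L2_lincomb[OF L2s(2) B(1)] assms])
  also have "\<dots> = 1 * inner_L2 \<Omega> (\<xi> k) v + (- 1 / \<alpha> k) * inner_L2 \<Omega> ?B v"
    by (rule inner_L2_lincomb[OF L2s(2) B(1) assms])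
  finally show ?thesis using B(2) by (simp add: inner_L2_commute)
qed

lemma xi_sum:
  assumes "v \<in> L2 \<Omega>"
  shows "inner_L2 \<Omega> (\<xi> k) v = inner_L2 \<Omega> (\<xi> 0) v - (\<Sum>j<k. 1 / \<alpha> j * (F' (u (Suc j)) v \<bullet> e (Suc j)))"
  by (induction k) (auto simp: xi_step[OF assms])

text \<open>The three-point identity for Bregman distances: the correction is the pairing of the
  difference of consecutive subgradients with \<open>ubar - u (Suc k)\<close>.\<close>

lemma three_point:
  "breg (Suc k) = breg k - step k + 1 / \<alpha> k * (F' (u (Suc k)) (\<lambda>x. ubar x - u (Suc k) x) \<bullet> e (Suc k))"
proof -
  let ?d = "\<lambda>x. ubar x - u (Suc k) x"
  have d: "?d \<in> L2 \<Omega>" by (intro L2_diff L2s)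
  have "inner_L2 \<Omega> (\<xi> k) (\<lambda>x. ubar x - u k x) - inner_L2 \<Omega> (\<xi> k) (\<lambda>x. u (Suc k) x - u k x) = inner_L2 \<Omega> (\<xi> k) ?d"
    by (simp add: inner_L2_diff_right L2s)
  thus ?thesis using breg(3)[of k] breg(3)[of "Suc k"] step(3)[of k] xi_step[OF d, of k] by linarith
qed

text \<open>The linearised difference is \<open>F ubar - F (u k)\<close> up to an error that the
  cone condition bounds by \<open>\<eta> * gap k\<close> times the residual with respect to exact
  data. The first part contributes minus the squared residual, up to noise.\<close>

lemma descent_direction:
  assumes r: "gap k < \<rho>"
  shows "F' (u k) (\<lambda>x. ubar x - u k x) \<bullet> e k
    \<le> norm (e k) * ((1 + \<eta> * gap k) * \<delta> - (1 - \<eta> * gap k) * norm (e k))"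
proof -
  let ?r = "gap k"
  define A where "A = F' (u k) (\<lambda>x. ubar x - u k x)"
  define err where "err = F ubar - F (u k) - A"
  have "dist_L2 \<Omega> ubar ubar = 0" by (simp add: dist_L2_def norm_L2_def inner_L2_def)
  hence "norm err \<le> \<eta> * ?r * norm (F (u k) - y)"
    using cone[OF u_D ubar(1) r] pos by (simp add: err_def A_def ubar(2))
  also have "norm (F (u k) - y) \<le> norm (e k) + \<delta>"
    using norm_triangle_ineq[of "e k" "yd - y"] noise by (simp add: norm_minus_commute)
  finally have err: "norm err \<le> \<eta> * ?r * (norm (e k) + \<delta>)"
    using pos dist_L2_nonneg[of \<Omega> "u k" ubar] by (simp add: mult_left_mono)
  have "A \<bullet> e k = (y - yd) \<bullet> e k - e k \<bullet> e k - err \<bullet> e k"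
    by (simp add: err_def ubar(2) inner_diff_left)
  also have "\<dots> \<le> \<delta> * norm (e k) - (norm (e k))\<^sup>2 + \<eta> * ?r * (norm (e k) + \<delta>) * norm (e k)"
  proof -
    have "(y - yd) \<bullet> e k \<le> norm (y - yd) * norm (e k)" by (rule norm_cauchy_schwarz)
    also have "\<dots> \<le> \<delta> * norm (e k)" using noise by (intro mult_right_mono) auto
    finally have 1: "(y - yd) \<bullet> e k \<le> \<delta> * norm (e k)" .
    have "- (err \<bullet> e k) \<le> norm err * norm (e k)" using norm_cauchy_schwarz[of "- err" "e k"] by simp
    also have "\<dots> \<le> \<eta> * ?r * (norm (e k) + \<delta>) * norm (e k)" using err by (intro mult_right_mono) auto
    finally show ?thesis using 1 by (simp add: power2_norm_eq_inner)
  qed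
  finally show ?thesis by (simp add: A_def algebra_simps power2_eq_square)
qed

lemma breg_0: "breg 0 < \<gamma>\<^sup>2 / 8"
proof -
  have ae: "ae_eq \<Omega> (u 0) u0" "ae_eq \<Omega> (\<xi> 0) \<xi>0" using iter by (auto simp: bregman_iterates_def)
  have L: "u0 \<in> L2 \<Omega>" "\<xi>0 \<in> L2 \<Omega>" using \<xi>0 by (auto simp: subdiff_L2_def dom_L2_def)
  have n: "inner_L2 \<Omega> (u 0) (u 0) = inner_L2 \<Omega> u0 u0"
    using inner_L2_ae_cong[OF ae(1) L2s(1) L(1)] L2s(1) L(1) by (metis inner_L2_commute)
  have "hTV \<Omega> (u 0) = hTV \<Omega> u0"
    unfolding hTV_def norm_L2_def by (simp add: n tv_ae_cong[OF opn ae(1) L2s(1) L(1)])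
  moreover have "inner_L2 \<Omega> (\<xi> 0) (\<lambda>x. ubar x - u 0 x) = inner_L2 \<Omega> \<xi>0 (\<lambda>x. ubar x - u0 x)"
  proof -
    have "inner_L2 \<Omega> \<xi>0 (u 0) = inner_L2 \<Omega> \<xi>0 u0"
      using inner_L2_ae_cong[OF ae(1) L2s(1) L(1) L(2)] by (metis inner_L2_commute)
    thus ?thesis unfolding inner_L2_ae_cong[OF ae(2) L2s(2) L(2) L2_diff[OF L2s(3) L2s(1)]]
      by (simp only: inner_L2_diff_right[OF L2s(3) L2s(1) L(2)] inner_L2_diff_right[OF L2s(3) L(1) L(2)])
  qed
  ultimately have "bregman \<Omega> (hTV \<Omega>) (\<xi> 0) ubar (u 0) = bregman \<Omega> (hTV \<Omega>) \<xi>0 ubar u0"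
    by (simp add: bregman_def)
  hence "ereal (breg 0) < ereal (\<gamma>\<^sup>2 / 8)" using start breg(1)[of 0] by simp
  thus ?thesis by (simp only: ereal_less_eq less_ereal.simps)
qed

lemma dist_le_of_breg: "breg k \<le> s\<^sup>2 / 2 \<Longrightarrow> s \<ge> 0 \<Longrightarrow> gap k \<le> s"
  using breg(2)[of k] dist_L2_commute[of \<Omega> "u k" ubar] power2_le_imp_le[of "gap k" s] by simp

lemma dist_le_of_step: "step k \<le> s\<^sup>2 / 2 \<Longrightarrow> s \<ge> 0 \<Longrightarrow> dist_L2 \<Omega> (u (Suc k)) (u k) \<le> s"
  using step(2)[of k] power2_le_imp_le[of "dist_L2 \<Omega> (u (Suc k)) (u k)" s] by simp

lemma dist_Suc_le:
  assumes "breg k \<le> \<gamma>\<^sup>2 / 8" "step k \<le> s\<^sup>2 / 2" "s \<ge> 0"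
  shows "gap (Suc k) \<le> s + \<gamma> / 2"
proof -
  have "gap k \<le> \<gamma> / 2" using assms(1) pos by (intro dist_le_of_breg) (auto simp: power_divide)
  moreover have "dist_L2 \<Omega> (u (Suc k)) (u k) \<le> s" using assms by (intro dist_le_of_step)
  ultimately show ?thesis using dist_L2_triangle[OF L2s(1)[of "Suc k"] L2s(1)[of k] L2s(3)] by linarith
qed

text \<open>A residual above \<open>\<delta>\<close> and minimality against \<open>ubar\<close> make
  the step no larger than the current Bregman distance, so the new iterate stays within
  \<open>\<gamma>\<close>. There the noise, at most the residual over \<open>\<tau>\<close>, leaves
  the coefficient \<open>decay\<close>.\<close>

lemma descent:
  assumes small: "breg k \<le> \<gamma>\<^sup>2 / 8" and big: "norm (e (Suc k)) > \<tau> * \<delta>"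
  shows "breg (Suc k) + decay / \<alpha> k * (norm (e (Suc k)))\<^sup>2 \<le> breg k"
    and "gap (Suc k) \<le> \<gamma>"
proof -
  have \<delta>e: "\<delta> < norm (e (Suc k))" using big mult_strict_right_mono[OF \<tau>_gt_1 pos(7)] by simp
  hence "\<delta>\<^sup>2 \<le> (norm (e (Suc k)))\<^sup>2" using pos by (intro power_mono) auto
  hence "\<alpha> k * step k \<le> \<alpha> k * breg k" using step_le[of k] by linarith
  hence sb: "step k \<le> breg k" using \<alpha>_pos by simp
  hence "step k \<le> (\<gamma> / 2)\<^sup>2 / 2" using small by (simp add: power_divide)
  from dist_Suc_le[OF small this] pos show r: "gap (Suc k) \<le> \<gamma>" by simp
  let ?r = "gap (Suc k)" and ?n = "norm (e (Suc k))"
  have "\<eta> * ?r \<le> \<eta> * \<gamma>" using r pos by (intro mult_left_mono) auto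
  moreover have "\<delta> \<le> ?n / \<tau>" using big \<tau>_gt_1 by (simp add: field_simps)
  ultimately have "(1 + \<eta> * ?r) * \<delta> \<le> (1 + \<eta> * \<gamma>) * (?n / \<tau>)"
    using pos(7) \<eta>\<gamma>(2) by (intro mult_mono) linarith+
  moreover have "(1 - \<eta> * \<gamma>) * ?n \<le> (1 - \<eta> * ?r) * ?n"
    using \<open>\<eta> * ?r \<le> \<eta> * \<gamma>\<close> by (intro mult_right_mono) auto
  moreover have "decay * ?n = (1 - \<eta> * \<gamma>) * ?n - (1 + \<eta> * \<gamma>) * (?n / \<tau>)" by (simp add: decay_def algebra_simps)
  ultimately have "(1 + \<eta> * ?r) * \<delta> - (1 - \<eta> * ?r) * ?n \<le> - decay * ?n" by simp
  hence "?n * ((1 + \<eta> * ?r) * \<delta> - (1 - \<eta> * ?r) * ?n) \<le> ?n * (- decay * ?n)" by (intro mult_left_mono) auto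
  moreover have "?r < \<rho>" using r pos by linarith
  ultimately have "F' (u (Suc k)) (\<lambda>x. ubar x - u (Suc k) x) \<bullet> e (Suc k) \<le> - decay * ?n\<^sup>2"
    using descent_direction[of "Suc k"] by (simp add: power2_eq_square mult_ac)
  hence "1 / \<alpha> k * (F' (u (Suc k)) (\<lambda>x. ubar x - u (Suc k) x) \<bullet> e (Suc k)) \<le> 1 / \<alpha> k * (- decay * ?n\<^sup>2)"
    using \<alpha>_pos[of k] by (intro mult_left_mono) auto
  thus "breg (Suc k) + decay / \<alpha> k * ?n\<^sup>2 \<le> breg k" using three_point[of k] step_nonneg[of k] by simp
qed

text \<open>The range starts at \<open>1\<close> because each descent is governed by the residual of
  the new iterate. The smallness required for the next descent is recovered from the sum at every
  step of the induction.\<close>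

lemma breg_sum:
  assumes "\<And>j. 1 \<le> j \<Longrightarrow> j \<le> k \<Longrightarrow> norm (e j) > \<tau> * \<delta>"
  shows "breg k + (\<Sum>j<k. decay / \<alpha> j * (norm (e (Suc j)))\<^sup>2) \<le> breg 0"
  using assms
proof (induction k)
  case (Suc k)
  have IH: "breg k + (\<Sum>j<k. decay / \<alpha> j * (norm (e (Suc j)))\<^sup>2) \<le> breg 0" using Suc by simp
  moreover have "(\<Sum>j<k. decay / \<alpha> j * (norm (e (Suc j)))\<^sup>2) \<ge> 0"
    using decay_pos \<alpha>_pos by (intro sum_nonneg mult_nonneg_nonneg divide_nonneg_nonneg) (auto intro: less_imp_le)
  ultimately have "breg k \<le> \<gamma>\<^sup>2 / 8" using breg_0 by linarith
  from descent(1)[OF this Suc.prems] IH show ?case by simp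
qed simp

lemma breg_sum_small:
  assumes "\<And>j. 1 \<le> j \<Longrightarrow> j \<le> k \<Longrightarrow> norm (e j) > \<tau> * \<delta>"
  shows "breg k \<le> \<gamma>\<^sup>2 / 8" "(\<Sum>j<k. 1 / \<alpha> j * (norm (e (Suc j)))\<^sup>2) \<le> \<gamma>\<^sup>2 / 8 / decay"
proof -
  have s: "breg k + decay * (\<Sum>j<k. 1 / \<alpha> j * (norm (e (Suc j)))\<^sup>2) \<le> breg 0"
    using breg_sum[OF assms] by (simp add: sum_distrib_left)
  have "(\<Sum>j<k. 1 / \<alpha> j * (norm (e (Suc j)))\<^sup>2) \<ge> 0"
    using \<alpha>_pos by (intro sum_nonneg mult_nonneg_nonneg divide_nonneg_nonneg) (auto intro: less_imp_le)
  hence "decay * (\<Sum>j<k. 1 / \<alpha> j * (norm (e (Suc j)))\<^sup>2) \<ge> 0" using decay_pos by simp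
  thus "breg k \<le> \<gamma>\<^sup>2 / 8" using s breg_0 by linarith
  have "1/2 * (dist_L2 \<Omega> ubar (u k))\<^sup>2 \<ge> 0" by simp
  hence "breg k \<ge> 0" using breg(2)[of k] by linarith
  hence "(\<Sum>j<k. 1 / \<alpha> j * (norm (e (Suc j)))\<^sup>2) * decay \<le> \<gamma>\<^sup>2 / 8" using s breg_0 by (simp add: mult.commute)
  thus "(\<Sum>j<k. 1 / \<alpha> j * (norm (e (Suc j)))\<^sup>2) \<le> \<gamma>\<^sup>2 / 8 / decay" using decay_pos by (simp add: pos_le_divide_eq)
qed

section \<open>The stopping index and the location of the stopped iterate\<close>

text \<open>Without stopping, every summand would be at least
  \<open>(\<tau> * \<delta>)\<^sup>2 / \<alpha>hi\<close>, while the partial sums have a bound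
  independent of \<open>k\<close>.\<close>

lemma stopping_finite: "\<exists>k. norm (e k) \<le> \<tau> * \<delta>"
proof (rule ccontr)
  assume "\<not> ?thesis"
  hence big: "norm (e k) > \<tau> * \<delta>" for k by (simp add: not_le)
  have \<tau>\<delta>: "\<tau> * \<delta> > 0" using \<tau>_gt_1 pos by simp
  have ahi: "\<alpha>hi > 0" using \<alpha>_pos[of 0] \<alpha>(2)[of 0] by linarith
  define c where "c = (\<tau> * \<delta>)\<^sup>2 / \<alpha>hi"
  have c: "c > 0" using \<tau>\<delta> ahi unfolding c_def by (intro divide_pos_pos zero_less_power)
  have "real k * c \<le> \<gamma>\<^sup>2 / 8 / decay" for k
  proof -
    have "c \<le> 1 / \<alpha> j * (norm (e (Suc j)))\<^sup>2" for j
    proof -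
      have "(\<tau> * \<delta>)\<^sup>2 \<le> (norm (e (Suc j)))\<^sup>2" using big[of "Suc j"] \<tau>\<delta> by (intro power_mono) auto
      thus ?thesis unfolding c_def using \<alpha>_pos[of j] \<alpha>(2)[of j] by (simp add: frac_le)
    qed
    hence "(\<Sum>j<k. c) \<le> (\<Sum>j<k. 1 / \<alpha> j * (norm (e (Suc j)))\<^sup>2)" by (intro sum_mono)
    also have "\<dots> \<le> \<gamma>\<^sup>2 / 8 / decay" by (rule breg_sum_small(2)) (rule big)
    finally show ?thesis by simp
  qed
  moreover obtain k where "real k * c > \<gamma>\<^sup>2 / 8 / decay" using c ex_less_of_nat_mult by blast
  ultimately show False by (meson not_less)
qed

abbreviation "K \<equiv> stop_index F yd \<tau> \<delta> u"

lemma stop_residual: "norm (e K) \<le> \<tau> * \<delta>"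
  unfolding stop_index_def by (rule LeastI_ex[OF stopping_finite])

lemma before_stop: "j < K \<Longrightarrow> norm (e j) > \<tau> * \<delta>"
  unfolding stop_index_def using not_less_Least by (metis not_le)

lemma u_BV: "u k \<in> BV \<Omega>"
  using u_dom[of k] L2_integrable[OF bdd opn L2s(1)] by (auto simp: BV_def elim: dom_hTV_E)

text \<open>The final step is not covered by \<open>descent\<close>, since its residual may lie
  below \<open>\<delta>\<close>. The noise term in \<open>step_le\<close> then has to be absorbed by
  the assumed smallness of \<open>\<delta>\<close>.\<close>

lemma dist_stop:
  assumes "\<delta>\<^sup>2 \<le> \<alpha>lo * \<gamma>\<^sup>2"
  shows "gap K < \<rho>"
proof (cases K)
  case 0
  have "gap 0 \<le> \<gamma> / 2" using breg_0 pos by (intro dist_le_of_breg) (auto simp: power_divide)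
  thus ?thesis using 0 pos by simp
next
  case (Suc k)
  have small: "breg k \<le> \<gamma>\<^sup>2 / 8" by (rule breg_sum_small(1)) (use Suc before_stop in auto)
  have "\<alpha> k * step k \<le> 1/2 * \<delta>\<^sup>2 + \<alpha> k * breg k" using step_le[of k] zero_le_power2[of "norm (e (Suc k))"] by linarith
  also have "\<dots> \<le> 1/2 * (\<alpha> k * \<gamma>\<^sup>2) + \<alpha> k * (\<gamma>\<^sup>2 / 8)"
  proof -
    have "\<alpha>lo * \<gamma>\<^sup>2 \<le> \<alpha> k * \<gamma>\<^sup>2" using \<alpha>(1)[of k] by (intro mult_right_mono) auto
    moreover have "\<alpha> k * breg k \<le> \<alpha> k * (\<gamma>\<^sup>2 / 8)" using small \<alpha>_pos[of k] by (intro mult_left_mono) auto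
    ultimately show ?thesis using assms by linarith
  qed
  \<comment> \<open>The factor \<open>1/2 + 1/8\<close> is rounded up to \<open>9/8\<close>, the
    half square of \<open>3/2\<close>; adding the \<open>\<gamma> / 2\<close> of the previous
    iterate gives \<open>2 * \<gamma> < \<rho>\<close>.\<close>
  also have "\<dots> \<le> \<alpha> k * ((3/2 * \<gamma>)\<^sup>2 / 2)"
    using \<alpha>_pos[of k] by (simp add: power_mult_distrib power2_eq_square[of "3::real"] algebra_simps power_divide)
  finally have "step k \<le> (3/2 * \<gamma>)\<^sup>2 / 2" using \<alpha>_pos[of k] by simp
  from dist_Suc_le[OF small this] have "gap (Suc k) \<le> 3/2 * \<gamma> + \<gamma> / 2" using pos by simp
  thus ?thesis using Suc pos by simp
qed

section \<open>A bound on the functional at the stopping index, uniform in the noise\<close>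

text \<open>The cone condition read in reverse: the derivative on a difference is the difference of
  \<open>F\<close> plus the linearisation error, and two points of the ball are at most
  \<open>2 * \<rho>\<close> apart.\<close>

lemma deriv_bound:
  assumes "v \<in> D" "w \<in> D" "dist_L2 \<Omega> v ubar < \<rho>" "dist_L2 \<Omega> w ubar < \<rho>"
  shows "norm (F' v (\<lambda>x. w x - v x)) \<le> (1 + 2 * \<eta> * \<rho>) * norm (F v - F w)"
proof -
  have L: "v \<in> L2 \<Omega>" "w \<in> L2 \<Omega>" using assms DL2 by auto
  have "dist_L2 \<Omega> v w \<le> 2 * \<rho>"
    using dist_L2_triangle[OF L(1) L2s(3) L(2)] assms(3,4) by (simp add: dist_L2_commute[of \<Omega> ubar])
  hence "\<eta> * dist_L2 \<Omega> v w * norm (F v - F w) \<le> \<eta> * (2 * \<rho>) * norm (F v - F w)"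
    using pos by (intro mult_right_mono mult_left_mono) auto
  moreover have "norm (F' v (\<lambda>x. w x - v x)) \<le> norm (F w - F v) + norm (F w - F v - F' v (\<lambda>x. w x - v x))"
    using norm_triangle_ineq4[of "F w - F v" "F w - F v - F' v (\<lambda>x. w x - v x)"] by simp
  ultimately show ?thesis using cone[OF assms] by (simp add: norm_minus_commute algebra_simps)
qed

text \<open>The direction \<open>ubar - u k\<close> is split at the point \<open>u (Suc j)\<close>
  where the derivative is taken. One part costs the residual plus noise; the other costs two
  residuals, of which the later is at most the earlier by monotonicity.\<close>

lemma pairing_term_bound:
  assumes j: "Suc j \<le> k" and near: "gap (Suc j) < \<rho>" "gap k < \<rho>"
  shows "F' (u (Suc j)) (\<lambda>x. ubar x - u k x) \<bullet> e (Suc j)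
     \<le> (1 + 2 * \<eta> * \<rho>) * norm (e (Suc j)) * (3 * norm (e (Suc j)) + \<delta>)"
proof -
  let ?v = "u (Suc j)" and ?n = "norm (e (Suc j))" and ?c = "1 + 2 * \<eta> * \<rho>"
  have c: "?c \<ge> 0" using pos by simp
  \<comment> \<open>Linearity of the derivative is taken from the adjoint relation and the
    bilinearity of the pairing.\<close>
  have A: "F' ?v z \<bullet> e (Suc j) = inner_L2 \<Omega> z (F'adj ?v (e (Suc j)))" "F'adj ?v (e (Suc j)) \<in> L2 \<Omega>" if "z \<in> L2 \<Omega>" for z
    using adj[OF u_D[of "Suc j"]] that by (auto simp: adjoint_L2_def)
  have d: "(\<lambda>x. ubar x - ?v x) \<in> L2 \<Omega>" "(\<lambda>x. u k x - ?v x) \<in> L2 \<Omega>" "(\<lambda>x. ubar x - u k x) \<in> L2 \<Omega>"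
    by (intro L2_diff L2s)+
  have "inner_L2 \<Omega> (\<lambda>x. ubar x - u k x) (F'adj ?v (e (Suc j))) =
     inner_L2 \<Omega> (\<lambda>x. ubar x - ?v x) (F'adj ?v (e (Suc j))) - inner_L2 \<Omega> (\<lambda>x. u k x - ?v x) (F'adj ?v (e (Suc j)))"
    using A(2)[OF d(1)] by (simp add: inner_L2_diff_left L2s)
  hence "F' ?v (\<lambda>x. ubar x - u k x) \<bullet> e (Suc j) = (F' ?v (\<lambda>x. ubar x - ?v x) - F' ?v (\<lambda>x. u k x - ?v x)) \<bullet> e (Suc j)"
    by (simp add: A(1) d inner_diff_left)
  also have "\<dots> \<le> norm (F' ?v (\<lambda>x. ubar x - ?v x) - F' ?v (\<lambda>x. u k x - ?v x)) * ?n" by (rule norm_cauchy_schwarz)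
  also have "\<dots> \<le> (?c * (?n + \<delta>) + ?c * (2 * ?n)) * ?n"
  proof (rule mult_right_mono)
    have z: "dist_L2 \<Omega> ubar ubar < \<rho>" using pos by (simp add: dist_L2_def norm_L2_def inner_L2_def)
    have "norm (F' ?v (\<lambda>x. ubar x - ?v x)) \<le> ?c * norm (F ?v - F ubar)"
      by (rule deriv_bound[OF u_D ubar(1) near(1) z])
    also have "\<dots> \<le> ?c * (?n + \<delta>)"
      using norm_triangle_ineq[of "e (Suc j)" "yd - y"] noise c
      by (intro mult_left_mono) (simp_all add: norm_minus_commute ubar(2))
    finally have 1: "norm (F' ?v (\<lambda>x. ubar x - ?v x)) \<le> ?c * (?n + \<delta>)" .
    have "norm (F' ?v (\<lambda>x. u k x - ?v x)) \<le> ?c * norm (F ?v - F (u k))"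
      by (rule deriv_bound[OF u_D u_D near])
    also have "\<dots> \<le> ?c * (2 * ?n)"
      using norm_triangle_ineq4[of "e (Suc j)" "e k"] residual_antimono[OF j] c by (intro mult_left_mono) simp_all
    finally show "norm (F' ?v (\<lambda>x. ubar x - ?v x) - F' ?v (\<lambda>x. u k x - ?v x)) \<le> ?c * (?n + \<delta>) + ?c * (2 * ?n)"
      using 1 norm_triangle_ineq4[of "F' ?v (\<lambda>x. ubar x - ?v x)" "F' ?v (\<lambda>x. u k x - ?v x)"] by linarith
  qed simp
  finally show ?thesis by (simp add: algebra_simps)
qed

text \<open>Nonnegativity of the Bregman distance bounds \<open>h\<close> at the stopped iterate by
  its value at \<open>ubar\<close> minus a subgradient pairing. In the expansion of that pairing the
  last summand plays a special role, because its residual need not dominate the noise.\<close>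

lemma h_stop_bound:
  assumes small: "\<delta>\<^sup>2 \<le> \<alpha>lo * \<gamma>\<^sup>2"
  shows "hr (u K) \<le> hr ubar + norm_L2 \<Omega> \<xi>0 * \<rho> + (1 + 2 * \<eta> * \<rho>) * (4 * (\<gamma>\<^sup>2 / 8 / decay) + \<tau> * (3 * \<tau> + 1) * \<gamma>\<^sup>2)"
proof -
  let ?d = "\<lambda>x. ubar x - u K x" and ?c = "1 + 2 * \<eta> * \<rho>"
  let ?t = "\<lambda>j. 1 / \<alpha> j * (F' (u (Suc j)) ?d \<bullet> e (Suc j))"
  have c: "?c \<ge> 0" using pos by simp
  have d: "?d \<in> L2 \<Omega>" by (intro L2_diff L2s)
  have near: "gap K < \<rho>" by (rule dist_stop[OF small])
  have inv: "0 \<le> 1 / \<alpha> j" for j using \<alpha>_pos[of j] by simp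
  \<comment> \<open>Here the residual is at most \<open>\<tau> * \<delta>\<close>, and
    \<open>\<delta>\<^sup>2 / \<alpha>lo \<le> \<gamma>\<^sup>2\<close> removes the noise from the
    bound.\<close>
  have last: "?t j \<le> ?c * (\<tau> * (3 * \<tau> + 1) * \<gamma>\<^sup>2)" if j: "Suc j = K" for j
  proof -
    have "?t j \<le> 1 / \<alpha> j * (?c * norm (e K) * (3 * norm (e K) + \<delta>))"
      using pairing_term_bound[of j K] j near inv[of j] by (intro mult_left_mono) auto
    also have "\<dots> \<le> 1 / \<alpha>lo * (?c * (\<tau> * \<delta>) * (3 * (\<tau> * \<delta>) + \<delta>))"
      using c stop_residual pos \<alpha>(1)[of j] \<tau>_gt_1 by (intro mult_mono mult_nonneg_nonneg add_mono mult_left_mono frac_le) auto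
    also have "\<dots> = ?c * (\<tau> * (3 * \<tau> + 1)) * (\<delta>\<^sup>2 / \<alpha>lo)" by (simp add: algebra_simps power2_eq_square)
    also have "\<dots> \<le> ?c * (\<tau> * (3 * \<tau> + 1)) * \<gamma>\<^sup>2"
      using small pos c \<tau>_gt_1 by (intro mult_left_mono mult_nonneg_nonneg) (auto simp: field_simps)
    finally show ?thesis by (simp add: mult.assoc)
  qed
  \<comment> \<open>Before stopping the residual exceeds \<open>\<delta>\<close>, so
    \<open>3\<close> residuals plus the noise are at most \<open>4\<close> residuals.\<close>
  have early: "?t j \<le> ?c * (4 * (1 / \<alpha> j * (norm (e (Suc j)))\<^sup>2))" if j: "Suc j < K" for j
  proof -
    have "breg j \<le> \<gamma>\<^sup>2 / 8" by (rule breg_sum_small(1)) (use j before_stop in auto)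
    from descent(2)[OF this before_stop[OF j]] have nj: "gap (Suc j) < \<rho>" using pos by linarith
    have \<delta>e: "\<delta> \<le> norm (e (Suc j))" using before_stop[OF j] mult_strict_right_mono[OF \<tau>_gt_1 pos(7)] by simp
    have "?t j \<le> 1 / \<alpha> j * (?c * norm (e (Suc j)) * (3 * norm (e (Suc j)) + \<delta>))"
      using pairing_term_bound[OF _ nj near] j inv[of j] by (intro mult_left_mono) auto
    also have "\<dots> \<le> 1 / \<alpha> j * (?c * norm (e (Suc j)) * (4 * norm (e (Suc j))))"
      using \<delta>e inv[of j] c by (intro mult_left_mono mult_nonneg_nonneg) auto
    finally show ?thesis by (simp add: power2_eq_square mult_ac)
  qed
  have nn: "0 \<le> 4 * (\<gamma>\<^sup>2 / 8 / decay)" "0 \<le> \<tau> * (3 * \<tau> + 1) * \<gamma>\<^sup>2" using decay_pos \<tau>_gt_1 by auto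
  have sum: "(\<Sum>j<K. ?t j) \<le> ?c * (4 * (\<gamma>\<^sup>2 / 8 / decay) + \<tau> * (3 * \<tau> + 1) * \<gamma>\<^sup>2)"
  proof (cases K)
    case 0
    thus ?thesis using c nn by simp
  next
    case (Suc k)
    have "(\<Sum>j<k. ?t j) \<le> (\<Sum>j<k. ?c * (4 * (1 / \<alpha> j * (norm (e (Suc j)))\<^sup>2)))"
      using Suc by (intro sum_mono early) auto
    also have "\<dots> = ?c * (4 * (\<Sum>j<k. 1 / \<alpha> j * (norm (e (Suc j)))\<^sup>2))" by (simp add: sum_distrib_left)
    also have "\<dots> \<le> ?c * (4 * (\<gamma>\<^sup>2 / 8 / decay))"
      using Suc before_stop c by (intro mult_left_mono breg_sum_small(2)) auto
    finally show ?thesis using last[of k] Suc by (simp add: distrib_left)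
  qed
  have L: "\<xi>0 \<in> L2 \<Omega>" using \<xi>0 by (auto simp: subdiff_L2_def)
  have "ae_eq \<Omega> (\<xi> 0) \<xi>0" using iter by (simp add: bregman_iterates_def)
  hence "\<bar>inner_L2 \<Omega> (\<xi> 0) ?d\<bar> \<le> norm_L2 \<Omega> \<xi>0 * norm_L2 \<Omega> ?d"
    using Cauchy_Schwarz_L2[OF L d] inner_L2_ae_cong[OF _ L2s(2) L d] by metis
  also have "\<dots> \<le> norm_L2 \<Omega> \<xi>0 * \<rho>"
  proof (rule mult_left_mono[OF _ norm_L2_nonneg])
    have "dist_L2 \<Omega> ubar (u K) \<le> \<rho>" using near dist_L2_commute[of \<Omega> "u K" ubar] by linarith
    thus "norm_L2 \<Omega> ?d \<le> \<rho>" by (simp add: dist_L2_def)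
  qed
  finally have "\<bar>inner_L2 \<Omega> (\<xi> 0) ?d\<bar> \<le> norm_L2 \<Omega> \<xi>0 * \<rho>" .
  moreover have "0 \<le> breg K" using breg(2)[of K] zero_le_power2[of "dist_L2 \<Omega> ubar (u K)"] by linarith
  ultimately show ?thesis using breg(3)[of K] xi_sum[OF d, of K] sum by linarith
qed

end

section \<open>Convergence\<close>

lemma integrable_L2_diff_sq:
  "u \<in> L2 U \<Longrightarrow> v \<in> L2 U \<Longrightarrow> integrable (lebesgue_on U) (\<lambda>x. (u x - v x)\<^sup>2)"
  using L2_diff[of u U v] by (simp add: L2_def)

lemma dist_L2_sq: "(dist_L2 U u v)\<^sup>2 = (\<integral>x. (u x - v x)\<^sup>2 \<partial>lebesgue_on U)"
  unfolding dist_L2_def norm_L2_sq by (simp add: inner_L2_def power2_eq_square)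

text \<open>At each point the truncation is eventually exact, and the square of \<open>g\<close>
  dominates the squared error.\<close>

lemma truncation_L2:
  assumes g: "g \<in> L2 U"
  defines "T n x \<equiv> max (- real n) (min (real n) (g x))"
  shows "T n \<in> L2 U" and "(\<lambda>n. dist_L2 U g (T n)) \<longlonglongrightarrow> 0"
proof -
  let ?M = "lebesgue_on U"
  note [measurable] = L2_measurable[OF g]
  have Tm [measurable]: "T n \<in> borel_measurable ?M" for n unfolding T_def by measurable
  have g2: "integrable ?M (\<lambda>x. (g x)\<^sup>2)" using g by (simp add: L2_def)
  have "\<bar>T n x\<bar> \<le> \<bar>g x\<bar>" for n x unfolding T_def by (auto simp: max_def min_def)
  hence "(T n x)\<^sup>2 \<le> (g x)\<^sup>2" for n x by (simp add: abs_le_square_iff)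
  hence "integrable ?M (\<lambda>x. (T n x)\<^sup>2)" for n by (intro Bochner_Integration.integrable_bound[OF g2]) auto
  thus TL: "T n \<in> L2 U" for n by (simp add: L2_def)
  have "\<bar>g x - T n x\<bar> \<le> \<bar>g x\<bar>" for n x unfolding T_def by (auto simp: max_def min_def)
  hence le: "(g x - T n x)\<^sup>2 \<le> (g x)\<^sup>2" for n x by (simp add: abs_le_square_iff)
  have "(\<lambda>n. \<integral>x. (g x - T n x)\<^sup>2 \<partial>?M) \<longlonglongrightarrow> (\<integral>x. 0 \<partial>?M)"
  proof (rule integral_dominated_convergence[where w="\<lambda>x. (g x)\<^sup>2"])
    show "AE x in ?M. (\<lambda>n. (g x - T n x)\<^sup>2) \<longlonglongrightarrow> 0"
    proof (rule AE_I2)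
      fix x
      have "\<forall>\<^sub>F n in sequentially. (g x - T n x)\<^sup>2 = 0"
        using eventually_ge_at_top[of "nat \<lceil>\<bar>g x\<bar>\<rceil>"]
      proof eventually_elim
        case (elim n)
        hence "\<bar>g x\<bar> \<le> real n" by linarith
        thus ?case by (simp add: T_def)
      qed
      thus "(\<lambda>n. (g x - T n x)\<^sup>2) \<longlonglongrightarrow> 0" by (rule tendsto_eventually)
    qed
  qed (use g2 le in auto)
  hence "(\<lambda>n. sqrt ((dist_L2 U g (T n))\<^sup>2)) \<longlonglongrightarrow> sqrt 0" unfolding dist_L2_sq by (intro tendsto_intros) simp
  thus "(\<lambda>n. dist_L2 U g (T n)) \<longlonglongrightarrow> 0" by (simp add: dist_L2_nonneg)
qed

text \<open>Convergence of the integrals of \<open>\<bar>v j - u\<bar>\<close> suffices against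
  bounded functions. A general \<open>g\<close> is truncated, and the uniform distance bound
  \<open>C\<close> controls the truncation error by Cauchy-Schwarz.\<close>

lemma weak_L2_of_L1_convergence:
  fixes U :: "(real^'n) set"
  assumes U: "bounded U" "open U" and v: "\<And>j. v j \<in> L2 U" "u \<in> L2 U" and C: "\<And>j. dist_L2 U (v j) u \<le> C"
    and lim: "(\<lambda>j. \<integral>x. \<bar>v j x - u x\<bar> \<partial>lebesgue_on U) \<longlonglongrightarrow> 0"
  shows "weak_L2 U v u"
  unfolding weak_L2_def
proof
  let ?M = "lebesgue_on U"
  fix g assume g: "g \<in> L2 U"
  define T where "T n x = max (- real n) (min (real n) (g x))" for n :: nat and x
  have T: "T n \<in> L2 U" "(\<lambda>n. dist_L2 U g (T n)) \<longlonglongrightarrow> 0" for n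
    using truncation_L2[OF g] by (simp_all add: T_def[abs_def])
  show "(\<lambda>j. inner_L2 U (v j) g) \<longlonglongrightarrow> inner_L2 U u g"
  proof (rule tendstoI)
    fix \<epsilon> :: real assume \<epsilon>: "\<epsilon> > 0"
    have C0: "C \<ge> 0" using C[of 0] dist_L2_nonneg order_trans by blast
    have "\<epsilon> / (2 * (C + 1)) > 0" using \<epsilon> C0 by simp
    from order_tendstoD(2)[OF T(2) this] obtain n where n: "dist_L2 U g (T n) < \<epsilon> / (2 * (C + 1))"
      by (auto simp: eventually_sequentially)
    have "C * dist_L2 U g (T n) \<le> (C + 1) * (\<epsilon> / (2 * (C + 1)))"
      using n C0 dist_L2_nonneg[of U g "T n"] by (intro mult_mono) auto
    also have "\<dots> = \<epsilon> / 2" using C0 by (simp add: divide_simps)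
    finally have Cn: "C * dist_L2 U g (T n) \<le> \<epsilon> / 2" .
    have bound: "\<bar>inner_L2 U (v j) g - inner_L2 U u g\<bar> \<le> real n * (\<integral>x. \<bar>v j x - u x\<bar> \<partial>?M) + \<epsilon> / 2" for j
    proof -
      have d: "(\<lambda>x. v j x - u x) \<in> L2 U" "(\<lambda>x. g x - T n x) \<in> L2 U" by (intro L2_diff v g T)+
      have "inner_L2 U (v j) g - inner_L2 U u g = inner_L2 U (\<lambda>x. v j x - u x) g"
        by (simp add: inner_L2_diff_left v g)
      also have "\<dots> = inner_L2 U (\<lambda>x. v j x - u x) (T n) + inner_L2 U (\<lambda>x. v j x - u x) (\<lambda>x. g x - T n x)"
        unfolding inner_L2_diff_right[OF g T(1) d(1)] by simp
      finally have "inner_L2 U (v j) g - inner_L2 U u g = \<dots>" .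
      moreover have "\<bar>inner_L2 U (\<lambda>x. v j x - u x) (T n)\<bar> \<le> real n * (\<integral>x. \<bar>v j x - u x\<bar> \<partial>?M)"
        unfolding inner_L2_def by (intro integral_mult_bound L2_integrable[OF U d(1)]) (auto simp: T_def)
      moreover have "\<bar>inner_L2 U (\<lambda>x. v j x - u x) (\<lambda>x. g x - T n x)\<bar> \<le> C * dist_L2 U g (T n)"
        using order_trans[OF Cauchy_Schwarz_L2[OF d] mult_right_mono[OF C[of j] dist_L2_nonneg[of U g "T n"], unfolded dist_L2_def]]
        by (simp add: dist_L2_def)
      ultimately show ?thesis using Cn by linarith
    qed
    have "(\<lambda>j. real n * (\<integral>x. \<bar>v j x - u x\<bar> \<partial>?M)) \<longlonglongrightarrow> 0" using tendsto_mult_right_zero[OF lim] by simp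
    from order_tendstoD(2)[OF this, of "\<epsilon> / 2"] \<epsilon>
    have "\<forall>\<^sub>F j in sequentially. real n * (\<integral>x. \<bar>v j x - u x\<bar> \<partial>?M) < \<epsilon> / 2" by simp
    thus "\<forall>\<^sub>F j in sequentially. dist (inner_L2 U (v j) g) (inner_L2 U u g) < \<epsilon>"
    proof eventually_elim
      case (elim j)
      thus ?case using bound[of j] unfolding dist_real_def by linarith
    qed
  qed
qed

text \<open>The limit is at first only integrable. Fatou's lemma puts it in \<open>L2\<close> and in
  the closed ball, after which the convergence is weak in \<open>L2\<close> and weak closedness of
  \<open>F\<close> applies.\<close>

lemma solution_subsequence:
  fixes U :: "(real^'n) set" and F :: "(real^'n \<Rightarrow> real) \<Rightarrow> 'h::real_inner"
  assumes U: "bounded U" "open U" and w: "\<And>j. w j \<in> D" "D \<subseteq> L2 U" and H: "\<And>j. hTV U (w j) \<le> ereal H"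
    and ubar: "ubar \<in> L2 U" and \<rho>: "\<rho> \<ge> 0" "\<And>j. dist_L2 U (w j) ubar \<le> \<rho>"
    and closed: "weakly_seq_closed_L2 U D F" and Fw: "(\<lambda>j. F (w j)) \<longlonglongrightarrow> y"
  obtains r v where "strict_mono (r :: nat \<Rightarrow> nat)" "v \<in> solutions D F y" "integrable (lebesgue_on U) v"
    "dist_L2 U v ubar \<le> \<rho>" "(\<lambda>j. \<integral>x. \<bar>w (r j) x - v x\<bar> \<partial>lebesgue_on U) \<longlonglongrightarrow> 0"
proof -
  let ?M = "lebesgue_on U"
  have L: "w j \<in> L2 U" for j using w by auto
  note [measurable] = L2_measurable[OF L] L2_measurable[OF ubar]
  have "tv U (w j) \<le> ereal H \<and> (\<integral>x. (w j x)\<^sup>2 \<partial>?M) \<le> 2 * H" for j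
  proof -
    have "w j \<in> dom_L2 U (hTV U)" using L H[of j] by (auto simp: dom_L2_def)
    then obtain a where a: "a \<ge> 0" "tv U (w j) = ereal a" "hTV U (w j) = ereal (1/2 * (norm_L2 U (w j))\<^sup>2 + a)"
      by (rule dom_hTV_E)
    hence "1/2 * (norm_L2 U (w j))\<^sup>2 + a \<le> H" using H[of j] by simp
    moreover have "(norm_L2 U (w j))\<^sup>2 = (\<integral>x. (w j x)\<^sup>2 \<partial>?M)" unfolding norm_L2_sq by (simp add: inner_L2_def power2_eq_square)
    moreover have "(norm_L2 U (w j))\<^sup>2 \<ge> 0" by simp
    ultimately have "a \<le> H" "(\<integral>x. (w j x)\<^sup>2 \<partial>?M) \<le> 2 * H" using a(1) by linarith+
    thus ?thesis using a by simp
  qed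
  hence tv: "\<And>j. tv U (w j) \<le> ereal H" and w2: "\<And>j. (\<integral>x. (w j x)\<^sup>2 \<partial>?M) \<le> 2 * H" by auto
  have i2: "integrable ?M (\<lambda>x. (w j x)\<^sup>2)" for j using L[of j] by (simp add: L2_def)
  obtain r v where r: "strict_mono (r :: nat \<Rightarrow> nat)" and v: "integrable ?M v"
    and lim: "(\<lambda>j. \<integral>x. \<bar>w (r j) x - v x\<bar> \<partial>?M) \<longlonglongrightarrow> 0"
    by (rule BV_L2_compactness[OF U L2_measurable[OF L] i2 w2 tv])
  have [measurable]: "v \<in> borel_measurable ?M" using v by auto
  \<comment> \<open>The further subsequence serves only Fatou's lemma; the convergence that is
    passed on is along \<open>r\<close>.\<close>
  have "\<exists>q::nat\<Rightarrow>nat. strict_mono q \<and> (AE x in ?M. (\<lambda>n. w (r (q n)) x - v x) \<longlonglongrightarrow> 0)"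
    using tendsto_L1_AE_subseq[of ?M "\<lambda>j x. w (r j) x - v x"] lim v L2_integrable[OF U L] by auto
  then obtain q where q: "AE x in ?M. (\<lambda>n. w (r (q n)) x - v x) \<longlonglongrightarrow> 0" by blast
  hence ae: "AE x in ?M. (\<lambda>n. w (r (q n)) x) \<longlonglongrightarrow> v x"
    by eventually_elim (simp add: LIM_zero_iff)
  have "integrable ?M (\<lambda>x. (v x)\<^sup>2) \<and> (\<integral>x. (v x)\<^sup>2 \<partial>?M) \<le> 2 * H"
  proof (rule fatou_integrable_bound[where f="\<lambda>n x. (w (r (q n)) x)\<^sup>2"])
    show "AE x in ?M. (\<lambda>n. (w (r (q n)) x)\<^sup>2) \<longlonglongrightarrow> (v x)\<^sup>2"
      using ae by eventually_elim (intro tendsto_intros)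
  qed (use i2 w2 in auto)
  hence vL: "v \<in> L2 U" by (simp add: L2_def)
  have "integrable ?M (\<lambda>x. (v x - ubar x)\<^sup>2) \<and> (\<integral>x. (v x - ubar x)\<^sup>2 \<partial>?M) \<le> \<rho>\<^sup>2"
  proof (rule fatou_integrable_bound[where f="\<lambda>n x. (w (r (q n)) x - ubar x)\<^sup>2"])
    show "AE x in ?M. (\<lambda>n. (w (r (q n)) x - ubar x)\<^sup>2) \<longlonglongrightarrow> (v x - ubar x)\<^sup>2"
      using ae by eventually_elim (intro tendsto_intros)
    show "(\<integral>x. (w (r (q n)) x - ubar x)\<^sup>2 \<partial>?M) \<le> \<rho>\<^sup>2" for n
      unfolding dist_L2_sq[symmetric] using \<rho> by (intro power_mono dist_L2_nonneg)
  qed (use integrable_L2_diff_sq[OF L ubar] in auto)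
  hence dv: "dist_L2 U v ubar \<le> \<rho>" using \<rho> power2_le_imp_le[of "dist_L2 U v ubar" \<rho>] by (simp add: dist_L2_sq)
  have "dist_L2 U (w (r j)) v \<le> 2 * \<rho>" for j
    using dist_L2_triangle[OF L[of "r j"] ubar vL] \<rho>(2)[of "r j"] dv by (simp add: dist_L2_commute[of U ubar])
  from weak_L2_of_L1_convergence[OF U L vL this lim] have "weak_L2 U (\<lambda>j. w (r j)) v" .
  moreover have "weak_lim (\<lambda>j. F (w (r j))) y"
    unfolding weak_lim_def using LIMSEQ_subseq_LIMSEQ[OF Fw r] by (auto simp: o_def intro!: tendsto_intros)
  ultimately have "v \<in> D \<and> F v = y"
    using closed[unfolded weakly_seq_closed_L2_def, rule_format, of v "\<lambda>j. w (r j)" y] vL w by auto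
  hence "v \<in> solutions D F y" by (simp add: solutions_def)
  from that[OF r this v dv lim] show ?thesis .
qed

theorem theorem4p9:
  fixes \<Omega> :: "(real^'n) set"
    and D :: "(real^'n \<Rightarrow> real) set"
    and F :: "(real^'n \<Rightarrow> real) \<Rightarrow> 'h::{real_inner, complete_space}"
    and F' :: "(real^'n \<Rightarrow> real) \<Rightarrow> (real^'n \<Rightarrow> real) \<Rightarrow> 'h"
    and F'adj :: "(real^'n \<Rightarrow> real) \<Rightarrow> 'h \<Rightarrow> real^'n \<Rightarrow> real"
    and y :: 'h
    and ubar u0 \<xi>0 :: "real^'n \<Rightarrow> real"
    and \<eta> \<rho> \<gamma> \<tau> \<alpha>lo \<alpha>hi :: real
    and \<alpha> \<delta> :: "nat \<Rightarrow> real"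
    and yd :: "nat \<Rightarrow> 'h"
    and u \<xi> :: "nat \<Rightarrow> nat \<Rightarrow> real^'n \<Rightarrow> real"
  assumes "bounded \<Omega>" and "lipschitz_domain \<Omega>"
    and "operator_L2 \<Omega> D F" and "closed_L2 \<Omega> D" and "convex_L2 D"
    and "\<forall>v\<in>D. has_frechet_L2 \<Omega> D F (F' v) v"
    and "\<forall>w\<in>L2 \<Omega>. operator_L2 \<Omega> D (\<lambda>v. F' v w)"
    and "\<forall>v\<in>D. adjoint_L2 \<Omega> (F' v) (F'adj v)"
    and "assumption_B \<Omega> D F F' (hTV \<Omega>) y ubar \<eta> \<rho>"
    and "0 < \<gamma>" and "\<gamma> < min (1 / \<eta>) (\<rho> / 2)"
    and "0 < \<alpha>lo" and "\<forall>k. \<alpha>lo \<le> \<alpha> k \<and> \<alpha> k \<le> \<alpha>hi"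
    and "u0 \<in> D \<inter> dom_L2 \<Omega> (hTV \<Omega>)" and "\<xi>0 \<in> subdiff_L2 \<Omega> (hTV \<Omega>) u0"
    and "bregman \<Omega> (hTV \<Omega>) \<xi>0 ubar u0 < ereal (\<gamma>\<^sup>2 / 8)"
    and "\<forall>m. 0 < \<delta> m" and "\<delta> \<longlonglongrightarrow> 0"
    and "\<forall>m. norm (y - yd m) < \<delta> m"
    and "\<forall>m. bregman_iterates \<Omega> D F F'adj (hTV \<Omega>) \<alpha> u0 \<xi>0 (yd m) (u m) (\<xi> m)"
    and "\<tau> > (1 + \<eta> * \<gamma>) / (1 - \<eta> * \<gamma>)"
  shows "(\<forall>m. \<exists>k. norm (F (u m k) - yd m) \<le> \<tau> * \<delta> m) \<and>
    (\<exists>r. strict_mono r \<and> (\<exists>v \<in> solutions D F y.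
       weakstar_BV \<Omega> (\<lambda>j. u (r j) (stop_index F (yd (r j)) \<tau> (\<delta> (r j)) (u (r j)))) v)) \<and>
    ((\<forall>v \<in> solutions D F y. dist_L2 \<Omega> v ubar \<le> \<rho> \<longrightarrow> ae_eq \<Omega> v ubar) \<longrightarrow>
       weakstar_BV \<Omega> (\<lambda>m. u m (stop_index F (yd m) \<tau> (\<delta> m) (u m))) ubar)"
proof -
  note B = \<open>assumption_B \<Omega> D F F' (hTV \<Omega>) y ubar \<eta> \<rho>\<close>
  have bdd: "bounded \<Omega>" and opn: "open \<Omega>" and ne: "\<Omega> \<noteq> {}"
    using \<open>bounded \<Omega>\<close> \<open>lipschitz_domain \<Omega>\<close> by (auto simp: lipschitz_domain_def)
  have DL2: "D \<subseteq> L2 \<Omega>" using \<open>operator_L2 \<Omega> D F\<close> by (simp add: operator_L2_def)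
  have closed: "weakly_seq_closed_L2 \<Omega> D F" and ubar: "ubar \<in> D" "F ubar = y" "ubar \<in> dom_L2 \<Omega> (hTV \<Omega>)"
    and \<eta>\<rho>: "\<eta> > 0" "\<rho> > 0" using B by (auto simp: assumption_B_def solutions_def)
  have ubarL: "ubar \<in> L2 \<Omega>" using ubar DL2 by auto
  interpret R: bregman_landweber \<Omega> D F F' F'adj y "yd m" ubar u0 \<xi>0 \<eta> \<rho> \<gamma> \<tau> \<alpha>lo \<alpha>hi "\<delta> m" \<alpha> "u m" "\<xi> m" for m
  proof unfold_locales
    show "norm (F v - F w - F' w (\<lambda>x. v x - w x)) \<le> \<eta> * dist_L2 \<Omega> w v * norm (F w - F v)"
      if "w \<in> D" "v \<in> D" "dist_L2 \<Omega> w ubar < \<rho>" "dist_L2 \<Omega> v ubar < \<rho>" for w v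
      using B that by (simp add: assumption_B_def)
  qed (use assms bdd opn DL2 ubar \<eta>\<rho> in auto)
  define w where "w m = u m (stop_index F (yd m) \<tau> (\<delta> m) (u m))" for m
  \<comment> \<open>The bound at the stopping index, written out so that its independence of
    \<open>m\<close> is visible.\<close>
  define H where "H = real_of_ereal (hTV \<Omega> ubar) + norm_L2 \<Omega> \<xi>0 * \<rho> +
     (1 + 2 * \<eta> * \<rho>) * (4 * (\<gamma>\<^sup>2 / 8 / ((1 - \<eta> * \<gamma>) - (1 + \<eta> * \<gamma>) / \<tau>)) + \<tau> * (3 * \<tau> + 1) * \<gamma>\<^sup>2)"
  have "(\<lambda>m. (\<delta> m)\<^sup>2) \<longlonglongrightarrow> 0\<^sup>2" using \<open>\<delta> \<longlonglongrightarrow> 0\<close> by (intro tendsto_intros)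
  moreover have "0\<^sup>2 < \<alpha>lo * \<gamma>\<^sup>2" using \<open>0 < \<alpha>lo\<close> \<open>0 < \<gamma>\<close> by simp
  ultimately have "\<forall>\<^sub>F m in sequentially. (\<delta> m)\<^sup>2 < \<alpha>lo * \<gamma>\<^sup>2" by (rule order_tendstoD(2))
  \<comment> \<open>The estimates at the stopping index require small noise, so all later sequences
    are shifted by \<open>m0\<close>.\<close>
  then obtain m0 where m0: "\<And>m. m \<ge> m0 \<Longrightarrow> (\<delta> m)\<^sup>2 \<le> \<alpha>lo * \<gamma>\<^sup>2"
    unfolding eventually_sequentially using less_imp_le by blast
  have wD: "w m \<in> D" and wBV: "w m \<in> BV \<Omega>" for m by (auto simp: w_def R.u_D R.u_BV)
  have wH: "hTV \<Omega> (w m) \<le> ereal H" if "m \<ge> m0" for m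
  proof -
    have "w m \<in> dom_L2 \<Omega> (hTV \<Omega>)" by (simp add: w_def R.u_dom)
    then obtain a where "hTV \<Omega> (w m) = ereal (1/2 * (norm_L2 \<Omega> (w m))\<^sup>2 + a)" by (rule dom_hTV_E)
    moreover have "real_of_ereal (hTV \<Omega> (w m)) \<le> H"
      using R.h_stop_bound[OF m0[OF that]] by (simp add: H_def w_def R.decay_def)
    ultimately show ?thesis by simp
  qed
  have wtv: "tv \<Omega> (w m) \<le> ereal H" if "m \<ge> m0" for m
    using order_trans[OF _ wH[OF that], of "tv \<Omega> (w m)"] tv_nonneg[of \<Omega> "w m"] by (simp add: hTV_def add_increasing)
  have w\<rho>: "dist_L2 \<Omega> (w m) ubar \<le> \<rho>" if "m \<ge> m0" for m
    using R.dist_stop[OF m0[OF that]] by (simp add: w_def)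
  have Fw: "(\<lambda>m. F (w m)) \<longlonglongrightarrow> y"
  proof -
    have "norm (F (w m) - y) \<le> (\<tau> + 1) * \<delta> m" for m
      using R.stop_residual[of m] norm_triangle_ineq[of "F (w m) - yd m" "yd m - y"] R.noise[of m]
      by (simp add: w_def norm_minus_commute algebra_simps)
    moreover have "(\<lambda>m. (\<tau> + 1) * \<delta> m) \<longlonglongrightarrow> 0" using tendsto_mult_right_zero[OF \<open>\<delta> \<longlonglongrightarrow> 0\<close>] by simp
    ultimately have "(\<lambda>m. F (w m) - y) \<longlonglongrightarrow> 0"
      using Lim_null_comparison[of "\<lambda>m. F (w m) - y" "\<lambda>m. (\<tau> + 1) * \<delta> m" sequentially] by simp
    thus ?thesis by (simp add: LIM_zero_iff)
  qed
  \<comment> \<open>Stated for an arbitrary subsequence \<open>s\<close>: the identity serves the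
    existence claim, and a subsequence that stays away from \<open>ubar\<close> serves the
    contradiction under uniqueness.\<close>
  have sub: "\<exists>r v. strict_mono (r :: nat \<Rightarrow> nat) \<and> v \<in> solutions D F y \<and> integrable (lebesgue_on \<Omega>) v \<and>
      dist_L2 \<Omega> v ubar \<le> \<rho> \<and> (\<lambda>j. \<integral>x. \<bar>w (s (r j + m0)) x - v x\<bar> \<partial>lebesgue_on \<Omega>) \<longlonglongrightarrow> 0"
    if s: "strict_mono s" for s :: "nat \<Rightarrow> nat"
  proof -
    have ge: "s (j + m0) \<ge> m0" for j using seq_suble[OF s, of "j + m0"] by simp
    have "(\<lambda>j. F (w (s (j + m0)))) \<longlonglongrightarrow> y"
      using LIMSEQ_ignore_initial_segment[OF LIMSEQ_subseq_LIMSEQ[OF Fw s], of m0] by (simp add: o_def)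
    then obtain r v where "strict_mono (r :: nat \<Rightarrow> nat)" "v \<in> solutions D F y" "integrable (lebesgue_on \<Omega>) v"
      "dist_L2 \<Omega> v ubar \<le> \<rho>" "(\<lambda>j. \<integral>x. \<bar>w (s (r j + m0)) x - v x\<bar> \<partial>lebesgue_on \<Omega>) \<longlonglongrightarrow> 0"
      by (rule solution_subsequence[where w="\<lambda>j. w (s (j + m0))", OF bdd opn wD DL2 wH[OF ge] ubarL
            less_imp_le[OF \<eta>\<rho>(2)] w\<rho>[OF ge] closed])
    thus ?thesis by (intro exI[of _ r] exI[of _ v]) simp
  qed
  have "\<exists>r. strict_mono r \<and> (\<exists>v \<in> solutions D F y. weakstar_BV \<Omega> (\<lambda>j. w (r j)) v)"
  proof -
    from sub[OF strict_mono_id] obtain r v where r: "strict_mono (r :: nat \<Rightarrow> nat)" and v: "v \<in> solutions D F y" "integrable (lebesgue_on \<Omega>) v"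
      and lim: "(\<lambda>j. \<integral>x. \<bar>w (r j + m0) x - v x\<bar> \<partial>lebesgue_on \<Omega>) \<longlonglongrightarrow> 0" by auto
    have "weakstar_BV \<Omega> (\<lambda>j. w (r j + m0)) v"
      by (rule weakstar_BV_I[OF bdd opn ne wBV v(2) lim, of H]) (auto intro!: always_eventually wtv)
    moreover have "strict_mono (\<lambda>j. r j + m0)" using r by (simp add: strict_mono_def)
    ultimately show ?thesis using v by blast
  qed
  moreover have "weakstar_BV \<Omega> w ubar" if unique: "\<forall>v \<in> solutions D F y. dist_L2 \<Omega> v ubar \<le> \<rho> \<longrightarrow> ae_eq \<Omega> v ubar"
  proof -
    have ui: "integrable (lebesgue_on \<Omega>) ubar" by (rule L2_integrable[OF bdd opn ubarL])
    \<comment> \<open>Uniqueness is needed only for strong convergence; the derivatives then follow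
      from the uniform bound on the variation.\<close>
    have "(\<lambda>m. \<integral>x. \<bar>w m x - ubar x\<bar> \<partial>lebesgue_on \<Omega>) \<longlonglongrightarrow> 0"
    proof (rule ccontr)
      assume "\<not> ?thesis"
      then obtain c s where c: "c > 0" and s: "strict_mono (s :: nat \<Rightarrow> nat)"
        and big: "\<And>m. \<bar>\<integral>x. \<bar>w (s m) x - ubar x\<bar> \<partial>lebesgue_on \<Omega>\<bar> \<ge> c" by (rule not_tendsto_0_subseq) blast
      obtain r v where v: "v \<in> solutions D F y" "dist_L2 \<Omega> v ubar \<le> \<rho>" "integrable (lebesgue_on \<Omega>) v"
        and lim: "(\<lambda>j. \<integral>x. \<bar>w (s (r j + m0)) x - v x\<bar> \<partial>lebesgue_on \<Omega>) \<longlonglongrightarrow> 0" using sub[OF s] by blast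
      have ae: "AE x in lebesgue_on \<Omega>. v x = ubar x" using unique v by (auto simp: ae_eq_def)
      have "(\<integral>x. \<bar>w (s (r j + m0)) x - v x\<bar> \<partial>lebesgue_on \<Omega>) = (\<integral>x. \<bar>w (s (r j + m0)) x - ubar x\<bar> \<partial>lebesgue_on \<Omega>)" for j
      proof (rule integral_cong_AE)
        show "AE x in lebesgue_on \<Omega>. \<bar>w (s (r j + m0)) x - v x\<bar> = \<bar>w (s (r j + m0)) x - ubar x\<bar>"
          using ae by eventually_elim simp
      qed (use v ui wBV in \<open>auto simp: BV_def intro!: borel_measurable_abs borel_measurable_diff\<close>)
      hence "\<And>j. c \<le> (\<integral>x. \<bar>w (s (r j + m0)) x - v x\<bar> \<partial>lebesgue_on \<Omega>)" using big by simp
      hence "c \<le> 0" using LIMSEQ_le_const[OF lim] by blast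
      thus False using c by simp
    qed
    moreover have "\<forall>\<^sub>F m in sequentially. tv \<Omega> (w m) \<le> ereal H"
      using eventually_ge_at_top[of m0] by eventually_elim (rule wtv)
    ultimately show ?thesis by (rule weakstar_BV_I[OF bdd opn ne wBV ui])
  qed
  ultimately show ?thesis using R.stopping_finite unfolding w_def by blast
qed

end
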